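(* Let $M$ be an MS-measurable $L$-structure and $\mathbb{M}\succeq M$ a monster model. Then every partitioned formula $\varphi(x,y)\in L$ with $|x|\leq d$ satisfies $\mathrm{FHP}_{d+1}$ relatively to the class of measures $\mathfrak{M}_y:=\{\mu_B:B\subseteq\mathbb{M}^y\text{ non-empty and definable with parameters}\}$. In particular, $\varphi(x,y)$ satisfies $\mathrm{FHP}_{d+1}$.
   Context: $M$ is MS-measurable if to every non-empty set $X\subseteq M^n$ definable with parameters is assigned $(\dim(X),\mathrm{meas}(X))\in(\mathbb{N}\times\mathbb{R}_{>0})\cup\{(0,0)\}$ such that: (1) for every $L$-formula $\varphi(x,y)$ with $|x|=1$ there are a finite set $D_\varphi$ of such pairs and $L$-formulas $\psi_{d,\mu}(y)$, $(d,\mu)\in D_\varphi$, partitioning $M^y$, with $\models\psi_{d,\mu}(b)$ iff $(\dim,\mathrm{meas})(\varphi(M,b))=(d,\mu)$; (2) if $X$ is finite then $\dim X=0$ and $\mathrm{meas}(X)=|X|$; (3) for disjoint definable $X,Y$: $\dim(X\cup Y)=\max(\dim X,\dim Y)$ and $\mathrm{meas}(X\cup Y)$ equals $\mathrm{meas}X+\mathrm{meas}Y$ if $\dim X=\dim Y$, and otherwise the measure of the one of larger dimension; (4) if $f:X\to Y$ is a definable surjection with $\dim f^{-1}(a)=d$ and $\mathrm{meas}f^{-1}(a)=r$ for all $a\in Y$, then $\dim X=\dim Y+d$ and $\mathrm{meas}X=r\,\mathrm{meas}Y$. Every elementary extension of an MS-measurable structure is MS-measurable (with the same defining data), so this applies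 in $\mathbb{M}$. For non-empty definable $B\subseteq\mathbb{M}^y$, the Keisler measure $\mu_B$ is defined by $\mu_B(X)=\mathrm{meas}(X\cap B)/\mathrm{meas}(B)$ if $\dim(X\cap B)=\dim B$ and $\mu_B(X)=0$ otherwise; these are definable Keisler measures, so their tensor products are defined. FHP relative to a class $\mathfrak{M}$ of definable measures: $\varphi(x,y)$ satisfies $\mathrm{FHP}_k$ relatively to $\mathfrak{M}$ if for every $\alpha>0$ there is $\beta>0$ such that for every $\mu\in\mathfrak{M}$, if $\mu^{\otimes k}(\exists x\bigwedge_{i\in[k]}\varphi(x,y_i))>\alpha$ then $\mu(\varphi(a,y))>\beta$ for some $a\in\mathbb{M}^x$ (here $\mu^{\otimes k}$ is the $k$-fold Morley product $\mu_{y_1}\otimes\cdots\otimes\mu_{y_k}$, where $(\mu\otimes\nu)(\psi(x,y))=\int F^\psi_\mu\,d\nu$ with $F^\psi_\mu(\operatorname{tp}(b/A))=\mu(\psi(x,b))$). Plain $\mathrm{FHP}_k$: for every $\alpha>0$ there is $\beta>0$ such that for every tuple $(S_1,\dots,S_n)$ of members of $\{\varphi(\mathbb{M},b):b\in\mathbb{M}^y\}$ (repetitions allowed) with at least $\alpha\binom nk$ sets $J\subseteq[n]$, $|J|=k$, satisfying $\bigcap_{i\in J}S_i\neq\emptyset$, there is $J\subseteq[n]$, $|J|\geq\beta n$, with $\bigcap_{i\in J}S_i\neq\emptyset$.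
   Formalization: The hypothesis dim(M^x) ≤ d is added (automatic from |x| ≤ d if dim M ≤ 1); without it the claim fails, e.g. for rows and columns of a grid M = S×S with dim M = 2. Plain FHP_{d+1} is stated for tuples of length n ≥ d+1, since shorter tuples of empty sets refute it. *)

theory Defs
  imports "HOL-Analysis.Analysis" "HOL-Library.NList"
begin

unbundle cardinal_syntax

section \<open>First-order logic\<close>

text \<open>A language is a set of function symbols and a set of relation symbols, each with its arity.
  Constants are function symbols of arity 0.\<close>

record ('f, 'r) lang =
  fun_syms :: "('f \<times> nat) set"
  rel_syms :: "('r \<times> nat) set"

datatype 'f tm = Var nat | Fn 'f "'f tm list"

datatype ('f, 'r) fm =
    Falsum
  | Eql "'f tm" "'f tm"
  | Rel 'r "'f tm list"
  | Neg "('f, 'r) fm"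
  | Con "('f, 'r) fm" "('f, 'r) fm"
  | Exi nat "('f, 'r) fm"

fun wf_tm :: "('f, 'r) lang \<Rightarrow> 'f tm \<Rightarrow> bool" where
  "wf_tm L (Var i) = True"
| "wf_tm L (Fn f ts) = ((f, length ts) \<in> fun_syms L \<and> (\<forall>t\<in>set ts. wf_tm L t))"

fun vars_tm :: "'f tm \<Rightarrow> nat set" where
  "vars_tm (Var i) = {i}"
| "vars_tm (Fn f ts) = (\<Union>t\<in>set ts. vars_tm t)"

fun wf_fm :: "('f, 'r) lang \<Rightarrow> ('f, 'r) fm \<Rightarrow> bool" where
  "wf_fm L Falsum = True"
| "wf_fm L (Eql s t) = (wf_tm L s \<and> wf_tm L t)"
| "wf_fm L (Rel r ts) = ((r, length ts) \<in> rel_syms L \<and> (\<forall>t\<in>set ts. wf_tm L t))"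
| "wf_fm L (Neg \<phi>) = wf_fm L \<phi>"
| "wf_fm L (Con \<phi> \<psi>) = (wf_fm L \<phi> \<and> wf_fm L \<psi>)"
| "wf_fm L (Exi i \<phi>) = wf_fm L \<phi>"

fun fv :: "('f, 'r) fm \<Rightarrow> nat set" where
  "fv Falsum = {}"
| "fv (Eql s t) = vars_tm s \<union> vars_tm t"
| "fv (Rel r ts) = (\<Union>t\<in>set ts. vars_tm t)"
| "fv (Neg \<phi>) = fv \<phi>"
| "fv (Con \<phi> \<psi>) = fv \<phi> \<union> fv \<psi>"
| "fv (Exi i \<phi>) = fv \<phi> - {i}"

record ('f, 'r, 'a) struct =
  univ :: "'a set"
  fun_of :: "'f \<Rightarrow> 'a list \<Rightarrow> 'a"
  rel_of :: "'r \<Rightarrow> 'a list \<Rightarrow> bool"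

definition is_structure :: "('f, 'r) lang \<Rightarrow> ('f, 'r, 'a) struct \<Rightarrow> bool" where
  "is_structure L M \<longleftrightarrow> univ M \<noteq> {} \<and>
     (\<forall>(f, k)\<in>fun_syms L. \<forall>as\<in>nlists k (univ M). fun_of M f as \<in> univ M)"

fun val :: "('f, 'r, 'a) struct \<Rightarrow> (nat \<Rightarrow> 'a) \<Rightarrow> 'f tm \<Rightarrow> 'a" where
  "val M v (Var i) = v i"
| "val M v (Fn f ts) = fun_of M f (map (val M v) ts)"

fun sat :: "('f, 'r, 'a) struct \<Rightarrow> (nat \<Rightarrow> 'a) \<Rightarrow> ('f, 'r) fm \<Rightarrow> bool" where
  "sat M v Falsum = False"
| "sat M v (Eql s t) = (val M v s = val M v t)"
| "sat M v (Rel r ts) = rel_of M r (map (val M v) ts)"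
| "sat M v (Neg \<phi>) = (\<not> sat M v \<phi>)"
| "sat M v (Con \<phi> \<psi>) = (sat M v \<phi> \<and> sat M v \<psi>)"
| "sat M v (Exi i \<phi>) = (\<exists>a\<in>univ M. sat M (v(i := a)) \<phi>)"

text \<open>L-formulas in the variables \<open>0, \<dots>, n - 1\<close>. A partitioned formula \<open>\<phi>(x, y)\<close> with \<open>|x| = n\<close>
  and \<open>|y| = m\<close> is a member of \<open>forms L (n + m)\<close>, where x occupies the first n variables and y the
  following m ones.\<close>

definition forms :: "('f, 'r) lang \<Rightarrow> nat \<Rightarrow> ('f, 'r) fm set" where
  "forms L n = {\<phi>. wf_fm L \<phi> \<and> fv \<phi> \<subseteq> {..<n}}"

text \<open>A tuple is a list, and \<open>M\<^sup>n\<close> is \<open>nlists n (univ M)\<close>. A formula in \<open>forms L (length as)\<close> is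
  evaluated at \<open>as\<close> by sending variable i to the i-th entry; the assignment is irrelevant elsewhere.\<close>

abbreviation holds :: "('f, 'r, 'a) struct \<Rightarrow> ('f, 'r) fm \<Rightarrow> 'a list \<Rightarrow> bool" where
  "holds M \<phi> as \<equiv> sat M (\<lambda>i. as ! i) \<phi>"

text \<open>\<open>inst M n \<phi> b\<close> is the set \<open>\<phi>(M, b)\<close>, a subset of \<open>M\<^sup>n\<close>.\<close>

definition inst :: "('f, 'r, 'a) struct \<Rightarrow> nat \<Rightarrow> ('f, 'r) fm \<Rightarrow> 'a list \<Rightarrow> 'a list set" where
  "inst M n \<phi> b = {a \<in> nlists n (univ M). holds M \<phi> (a @ b)}"

definition definable_over ::
    "('f, 'r) lang \<Rightarrow> ('f, 'r, 'a) struct \<Rightarrow> 'a set \<Rightarrow> nat \<Rightarrow> 'a list set \<Rightarrow> bool" where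
  "definable_over L M A n X \<longleftrightarrow>
     (\<exists>m. \<exists>\<phi>\<in>forms L (n + m). \<exists>b\<in>nlists m A. X = inst M n \<phi> b)"

abbreviation definable ::
    "('f, 'r) lang \<Rightarrow> ('f, 'r, 'a) struct \<Rightarrow> nat \<Rightarrow> 'a list set \<Rightarrow> bool" where
  "definable L M n X \<equiv> definable_over L M (univ M) n X"

definition elem_extension ::
    "('f, 'r) lang \<Rightarrow> ('f, 'r, 'a) struct \<Rightarrow> ('f, 'r, 'a) struct \<Rightarrow> bool" where
  "elem_extension L M N \<longleftrightarrow> is_structure L M \<and> is_structure L N \<and> univ M \<subseteq> univ N \<and>
     (\<forall>n. \<forall>\<phi>\<in>forms L n. \<forall>as\<in>nlists n (univ M). holds M \<phi> as \<longleftrightarrow> holds N \<phi> as)"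

section \<open>Types and monster models\<close>

text \<open>The pair \<open>(\<phi>, c)\<close> stands for the L(A)-formula \<open>\<phi>(x, c)\<close> with \<open>|x| = n\<close>.\<close>

definition pforms ::
    "('f, 'r) lang \<Rightarrow> 'a set \<Rightarrow> nat \<Rightarrow> (('f, 'r) fm \<times> 'a list) set" where
  "pforms L A n = {(\<phi>, c). set c \<subseteq> A \<and> \<phi> \<in> forms L (n + length c)}"

abbreviation pinst ::
    "('f, 'r, 'a) struct \<Rightarrow> nat \<Rightarrow> ('f, 'r) fm \<times> 'a list \<Rightarrow> 'a list set" where
  "pinst N n \<theta> \<equiv> inst N n (fst \<theta>) (snd \<theta>)"

definition types ::
    "('f, 'r) lang \<Rightarrow> ('f, 'r, 'a) struct \<Rightarrow> 'a set \<Rightarrow> nat \<Rightarrow> (('f, 'r) fm \<times> 'a list) set set" where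
  "types L N A n = {p. p \<subseteq> pforms L A n \<and>
     (\<forall>F. finite F \<and> F \<subseteq> p \<longrightarrow> (\<exists>a\<in>nlists n (univ N). \<forall>\<theta>\<in>F. a \<in> pinst N n \<theta>)) \<and>
     (\<forall>(\<phi>, c)\<in>pforms L A n. (\<phi>, c) \<in> p \<or> (Neg \<phi>, c) \<in> p)}"

definition tp ::
    "('f, 'r) lang \<Rightarrow> ('f, 'r, 'a) struct \<Rightarrow> 'a set \<Rightarrow> 'a list \<Rightarrow> (('f, 'r) fm \<times> 'a list) set" where
  "tp L N A a = {\<theta> \<in> pforms L A (length a). a \<in> pinst N (length a) \<theta>}"

definition saturated :: "'k rel \<Rightarrow> ('f, 'r) lang \<Rightarrow> ('f, 'r, 'a) struct \<Rightarrow> bool" where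
  "saturated \<kappa> L N \<longleftrightarrow> (\<forall>A n. A \<subseteq> univ N \<and> |A| <o \<kappa> \<longrightarrow>
     (\<forall>p\<in>types L N A n. \<exists>a\<in>nlists n (univ N). tp L N A a = p))"

definition automorphism ::
    "('f, 'r) lang \<Rightarrow> ('f, 'r, 'a) struct \<Rightarrow> ('a \<Rightarrow> 'a) \<Rightarrow> bool" where
  "automorphism L N \<sigma> \<longleftrightarrow> bij_betw \<sigma> (univ N) (univ N) \<and>
     (\<forall>(f, k)\<in>fun_syms L. \<forall>as\<in>nlists k (univ N). \<sigma> (fun_of N f as) = fun_of N f (map \<sigma> as)) \<and>
     (\<forall>(r, k)\<in>rel_syms L. \<forall>as\<in>nlists k (univ N). rel_of N r as \<longleftrightarrow> rel_of N r (map \<sigma> as))"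

definition partial_elementary ::
    "('f, 'r) lang \<Rightarrow> ('f, 'r, 'a) struct \<Rightarrow> 'a set \<Rightarrow> ('a \<Rightarrow> 'a) \<Rightarrow> bool" where
  "partial_elementary L N A g \<longleftrightarrow> A \<subseteq> univ N \<and> g ` A \<subseteq> univ N \<and>
     (\<forall>n. \<forall>\<phi>\<in>forms L n. \<forall>as\<in>nlists n A. holds N \<phi> as \<longleftrightarrow> holds N \<phi> (map g as))"

definition strongly_homogeneous :: "'k rel \<Rightarrow> ('f, 'r) lang \<Rightarrow> ('f, 'r, 'a) struct \<Rightarrow> bool" where
  "strongly_homogeneous \<kappa> L N \<longleftrightarrow> (\<forall>A g. |A| <o \<kappa> \<and> partial_elementary L N A g \<longrightarrow>
     (\<exists>\<sigma>. automorphism L N \<sigma> \<and> (\<forall>a\<in>A. \<sigma> a = g a)))"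

text \<open>A monster model over M with smallness bound \<open>\<kappa>\<close>: sets of size less than \<open>\<kappa>\<close> are small.\<close>

definition monster ::
    "'k rel \<Rightarrow> ('f, 'r) lang \<Rightarrow> ('f, 'r, 'a) struct \<Rightarrow> ('f, 'r, 'a) struct \<Rightarrow> bool" where
  "monster \<kappa> L M N \<longleftrightarrow> Card_order \<kappa> \<and> natLeq <o \<kappa> \<and>
     |fun_syms L| <o \<kappa> \<and> |rel_syms L| <o \<kappa> \<and> |univ M| <o \<kappa> \<and>
     elem_extension L M N \<and> saturated \<kappa> L N \<and> strongly_homogeneous \<kappa> L N"

section \<open>MS-measurable structures\<close>

definition ms_values :: "(nat \<times> real) set" where
  "ms_values = (UNIV \<times> {0<..}) \<union> {(0, 0)}"

text \<open>\<open>h X = (dim X, meas X)\<close>. The empty set gets the value (0, 0) by the clause on finite sets, so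
  that \<open>h (\<phi>(M, b))\<close> makes sense for every b. The domain in the fibration clause has to be non-empty:
  otherwise the hypothesis on fibres is vacuous and d is arbitrary.\<close>

definition ms_measuring ::
    "('f, 'r) lang \<Rightarrow> ('f, 'r, 'a) struct \<Rightarrow> ('a list set \<Rightarrow> nat \<times> real) \<Rightarrow> bool" where
  "ms_measuring L M h \<longleftrightarrow>
     (\<forall>n X. definable L M n X \<longrightarrow> h X \<in> ms_values) \<and>
     (\<forall>m. \<forall>\<phi>\<in>forms L (1 + m). \<exists>D \<psi>.
        finite D \<and> D \<subseteq> ms_values \<and> (\<forall>p\<in>D. \<psi> p \<in> forms L m) \<and>
        (\<forall>b\<in>nlists m (univ M).
           (\<exists>!p. p \<in> D \<and> holds M (\<psi> p) b) \<and>
           (\<forall>p\<in>D. holds M (\<psi> p) b \<longleftrightarrow> h (inst M 1 \<phi> b) = p))) \<and>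
     (\<forall>n X. definable L M n X \<and> finite X \<longrightarrow> h X = (0, real (card X))) \<and>
     (\<forall>n X Y. definable L M n X \<and> definable L M n Y \<and> X \<inter> Y = {} \<longrightarrow>
        h (X \<union> Y) = (max (fst (h X)) (fst (h Y)),
          if fst (h X) = fst (h Y) then snd (h X) + snd (h Y)
          else if fst (h Y) < fst (h X) then snd (h X) else snd (h Y))) \<and>
     (\<forall>n m X Y f d r. definable L M n X \<and> X \<noteq> {} \<and> definable L M m Y \<and>
        f ` X = Y \<and> definable L M (n + m) {x @ f x | x. x \<in> X} \<and>
        (\<forall>a\<in>Y. h {x \<in> X. f x = a} = (d, r)) \<longrightarrow>
        h X = (fst (h Y) + d, r * snd (h Y)))"

text \<open>The dimension and measure which h induces on an elementary extension N by keeping the defining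
  data: \<open>\<phi>(N, b)\<close> gets the value p if \<open>N \<Turnstile> \<psi>(b)\<close>, where \<open>\<psi>\<close> defines in M the set of those c with
  \<open>h (\<phi>(M, c)) = p\<close>.\<close>

definition ext_measuring ::
    "('f, 'r) lang \<Rightarrow> ('f, 'r, 'a) struct \<Rightarrow> ('a list set \<Rightarrow> nat \<times> real) \<Rightarrow>
     ('f, 'r, 'a) struct \<Rightarrow> 'a list set \<Rightarrow> nat \<times> real" where
  "ext_measuring L M h N X = (THE p. \<exists>n m. \<exists>\<phi>\<in>forms L (n + m). \<exists>\<psi>\<in>forms L m. \<exists>b\<in>nlists m (univ N).
     X = inst N n \<phi> b \<and> holds N \<psi> b \<and>
     (\<forall>c\<in>nlists m (univ M). holds M \<psi> c \<longleftrightarrow> h (inst M n \<phi> c) = p))"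

section \<open>Keisler measures and Morley products\<close>

definition keisler_measure ::
    "('f, 'r) lang \<Rightarrow> ('f, 'r, 'a) struct \<Rightarrow> nat \<Rightarrow> ('a list set \<Rightarrow> real) \<Rightarrow> bool" where
  "keisler_measure L N n \<mu> \<longleftrightarrow>
     (\<forall>X. definable L N n X \<longrightarrow> 0 \<le> \<mu> X) \<and> \<mu> (nlists n (univ N)) = 1 \<and>
     (\<forall>X Y. definable L N n X \<and> definable L N n Y \<and> X \<inter> Y = {} \<longrightarrow> \<mu> (X \<union> Y) = \<mu> X + \<mu> Y)"

definition cyl ::
    "('f, 'r) lang \<Rightarrow> ('f, 'r, 'a) struct \<Rightarrow> 'a set \<Rightarrow> nat \<Rightarrow> ('f, 'r) fm \<times> 'a list \<Rightarrow>
     (('f, 'r) fm \<times> 'a list) set set" where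
  "cyl L N A n \<theta> = {p \<in> types L N A n. \<theta> \<in> p}"

definition type_space ::
    "('f, 'r) lang \<Rightarrow> ('f, 'r, 'a) struct \<Rightarrow> 'a set \<Rightarrow> nat \<Rightarrow> (('f, 'r) fm \<times> 'a list) set topology" where
  "type_space L N A n = topology_generated_by (cyl L N A n ` pforms L A n)"

text \<open>The countably additive measure induced by \<open>\<nu>\<close> on the sigma-algebra generated by the clopen
  subsets of the type space over A. Continuous functions on the type space are measurable for this
  sigma-algebra, so it yields the same integrals as the regular Borel extension of \<open>\<nu>\<close>.\<close>

definition type_measure ::
    "('f, 'r) lang \<Rightarrow> ('f, 'r, 'a) struct \<Rightarrow> 'a set \<Rightarrow> nat \<Rightarrow> ('a list set \<Rightarrow> real) \<Rightarrow>
     (('f, 'r) fm \<times> 'a list) set measure" where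
  "type_measure L N A n \<nu> =
     extend_measure (types L N A n) (pforms L A n) (cyl L N A n) (\<lambda>\<theta>. ennreal (\<nu> (pinst N n \<theta>)))"

text \<open>The function \<open>tp(b/A) \<mapsto> \<mu>(X\<^sub>b)\<close>, where \<open>X\<^sub>b = {a. a @ b \<in> X}\<close>, for X a subset of
  \<open>N\<^sup>n \<times> N\<^sup>m = N\<^bsup>n + m\<^esup>\<close>. It is used only for \<open>\<mu>\<close> invariant over A, so that the choice of b is
  immaterial.\<close>

definition fiber_fun ::
    "('f, 'r) lang \<Rightarrow> ('f, 'r, 'a) struct \<Rightarrow> 'a set \<Rightarrow> nat \<Rightarrow> nat \<Rightarrow> ('a list set \<Rightarrow> real) \<Rightarrow>
     'a list set \<Rightarrow> (('f, 'r) fm \<times> 'a list) set \<Rightarrow> real" where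
  "fiber_fun L N A n m \<mu> X p =
     \<mu> {a \<in> nlists n (univ N). a @ (SOME b. b \<in> nlists m (univ N) \<and> tp L N A b = p) \<in> X}"

definition definable_measure ::
    "('f, 'r) lang \<Rightarrow> ('f, 'r, 'a) struct \<Rightarrow> 'a set \<Rightarrow> nat \<Rightarrow> ('a list set \<Rightarrow> real) \<Rightarrow> bool" where
  "definable_measure L N A n \<mu> \<longleftrightarrow> keisler_measure L N n \<mu> \<and>
     (\<forall>m. \<forall>\<phi>\<in>forms L (n + m).
        (\<forall>b\<in>nlists m (univ N). \<forall>b'\<in>nlists m (univ N).
           tp L N A b = tp L N A b' \<longrightarrow> \<mu> (inst N n \<phi> b) = \<mu> (inst N n \<phi> b')) \<and>
        continuous_map (type_space L N A m) euclideanreal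
          (fiber_fun L N A n m \<mu> (inst N (n + m) \<phi> [])))"

text \<open>The value at X of the Morley product of \<open>\<mu>\<close> (on \<open>N\<^sup>n\<close>) and \<open>\<nu>\<close> (on \<open>N\<^sup>m\<close>). It does not depend
  on the choice of A.\<close>

definition morley ::
    "'k rel \<Rightarrow> ('f, 'r) lang \<Rightarrow> ('f, 'r, 'a) struct \<Rightarrow> nat \<Rightarrow> nat \<Rightarrow>
     ('a list set \<Rightarrow> real) \<Rightarrow> ('a list set \<Rightarrow> real) \<Rightarrow> 'a list set \<Rightarrow> real" where
  "morley \<kappa> L N n m \<mu> \<nu> X =
     (let A = SOME A. A \<subseteq> univ N \<and> |A| <o \<kappa> \<and> definable_measure L N A n \<mu> \<and>
                definable_over L N A (n + m) X
      in integral\<^sup>L (type_measure L N A m \<nu>) (fiber_fun L N A n m \<mu> X))"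

fun morley_power ::
    "'k rel \<Rightarrow> ('f, 'r) lang \<Rightarrow> ('f, 'r, 'a) struct \<Rightarrow> nat \<Rightarrow> ('a list set \<Rightarrow> real) \<Rightarrow>
     nat \<Rightarrow> 'a list set \<Rightarrow> real" where
  "morley_power \<kappa> L N m \<mu> 0 = (\<lambda>X. if [] \<in> X then 1 else 0)"
| "morley_power \<kappa> L N m \<mu> (Suc 0) = \<mu>"
| "morley_power \<kappa> L N m \<mu> (Suc (Suc k)) =
     morley \<kappa> L N m (Suc k * m) \<mu> (morley_power \<kappa> L N m \<mu> (Suc k))"

text \<open>The measure \<open>\<mu>\<^sub>B\<close> attached to the dimension and measure h on N.\<close>

definition ms_keisler :: "('a list set \<Rightarrow> nat \<times> real) \<Rightarrow> 'a list set \<Rightarrow> 'a list set \<Rightarrow> real" where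
  "ms_keisler h B X =
     (if fst (h (X \<inter> B)) = fst (h B) then snd (h (X \<inter> B)) / snd (h B) else 0)"

definition ms_measures ::
    "('f, 'r) lang \<Rightarrow> ('f, 'r, 'a) struct \<Rightarrow> ('a list set \<Rightarrow> nat \<times> real) \<Rightarrow> nat \<Rightarrow>
     ('a list set \<Rightarrow> real) set" where
  "ms_measures L N h m = {ms_keisler h B | B. B \<noteq> {} \<and> definable L N m B}"

section \<open>Fractional Helly properties\<close>

text \<open>The set of all \<open>(y\<^sub>1, \<dots>, y\<^sub>k)\<close> for which the sets \<open>\<phi>(N, y\<^sub>i)\<close> have a common point, as a
  subset of \<open>N\<^bsup>k m\<^esup>\<close>.\<close>

definition consistent_tuples ::
    "('f, 'r, 'a) struct \<Rightarrow> nat \<Rightarrow> nat \<Rightarrow> nat \<Rightarrow> ('f, 'r) fm \<Rightarrow> 'a list set" where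
  "consistent_tuples N n m k \<phi> = {concat bs | bs. bs \<in> nlists k (nlists m (univ N)) \<and>
     (\<exists>a\<in>nlists n (univ N). \<forall>b\<in>set bs. holds N \<phi> (a @ b))}"

definition FHP_rel ::
    "'k rel \<Rightarrow> ('f, 'r) lang \<Rightarrow> ('f, 'r, 'a) struct \<Rightarrow> nat \<Rightarrow> nat \<Rightarrow> nat \<Rightarrow> ('f, 'r) fm \<Rightarrow>
     ('a list set \<Rightarrow> real) set \<Rightarrow> bool" where
  "FHP_rel \<kappa> L N n m k \<phi> \<MM> \<longleftrightarrow> (\<forall>\<alpha>>0. \<exists>\<beta>>0. \<forall>\<mu>\<in>\<MM>.
     morley_power \<kappa> L N m \<mu> k (consistent_tuples N n m k \<phi>) > \<alpha> \<longrightarrow>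
     (\<exists>a\<in>nlists n (univ N). \<mu> {b \<in> nlists m (univ N). holds N \<phi> (a @ b)} > \<beta>))"

text \<open>The restriction \<open>k \<le> l\<close> on the length l of the tuple is necessary: for \<open>l < k\<close> the hypothesis on
  k-subsets reads \<open>0 \<ge> 0\<close>, and the conclusion fails when all \<open>S\<^sub>i\<close> are empty.\<close>

definition FHP :: "('f, 'r, 'a) struct \<Rightarrow> nat \<Rightarrow> nat \<Rightarrow> nat \<Rightarrow> ('f, 'r) fm \<Rightarrow> bool" where
  "FHP N n m k \<phi> \<longleftrightarrow> (\<forall>\<alpha>>0. \<exists>\<beta>>(0::real). \<forall>l\<ge>k. \<forall>S.
     (\<forall>i<l. S i \<in> {inst N n \<phi> b | b. b \<in> nlists m (univ N)}) \<and>
     real (card {J. J \<subseteq> {..<l} \<and> card J = k \<and> (\<Inter>i\<in>J. S i) \<noteq> {}}) \<ge> \<alpha> * real (l choose k) \<longrightarrow>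
     (\<exists>J. J \<subseteq> {..<l} \<and> real (card J) \<ge> \<beta> * real l \<and> (\<Inter>i\<in>J. S i) \<noteq> {}))"

end

(* Write X(b_1, ..., b_j) for the intersection of the sets phi(N, b_i). If dim X < r and an r-tuple in
   B is consistent with X with probability > alpha, then either the b in B with
   dim (X \<inter> phi(N, b)) = dim X have measure > alpha / 2, or some b cuts down the dimension of X and
   an (r-1)-tuple is consistent with X \<inter> phi(N, b) with probability > alpha / 2. The second case
   cannot occur r times. In the first case every such b satisfies mu_X(phi(N, b)) >= eps, where eps > 0
   exists because the sets X(b_1, ..., b_j) with j <= d + 1 have only finitely many values (dim, meas).
   Fubini on X * B then yields a point of X which lies in phi(N, b) for many b in B. For finite tuples
   the same argument works with the counting measure on the indices.

   Of the Morley power of mu_B only the upper bound by mu on the cartesian power of B is needed. It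
   follows from Fubini once the level sets of the fibre function are known to be definable over the
   small set A of the Morley product; this is compactness in the monster model. *)
theory Submission
  imports Defs
begin

text \<open>These rules have a premise with variables that their left-hand side does not bind, and loop
  together with the unfolding of \<open>nlists\<close>.\<close>

declare nlistsE_length [simp del] nlistsE_set [simp del] nlists_appendE [rule del]

text \<open>Clause (1) of MS-measurability speaks about one variable and about M only, while the
  argument lives on powers of N with parameters from N. Two steps close the gap: an induction on the
  number of variables inside M, and a transfer, which works because every level set of the value is
  cut out by one formula, the same in M and in N. Definability is therefore treated for a family of
  structures at once. Since a definable family has finitely many values, all functions that occur
  are simple and Fubini is a finite sum; integration theory enters only through the definition of
  the Morley product. That definition picks its small set A by choice, and A is known only to make
  mu_B a definable measure and to carry parameters for the integrand: nothing says that B is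
  definable over A. The level sets must be recovered from continuity, by isolating one value among
  finitely many. The bound dim X < r survives the descent because both sides drop together; at r = 0
  it is absurd. Each step of the descent halves alpha.\<close>

lemma in_nlists: "xs \<in> nlists n A \<longleftrightarrow> length xs = n \<and> set xs \<subseteq> A"
  by (simp add: nlists_def)

lemma take_in_nlists: "as \<in> nlists n A \<Longrightarrow> k \<le> n \<Longrightarrow> take k as \<in> nlists k A"
  by (auto simp: in_nlists dest: in_set_takeD)

lemma drop_in_nlists: "as \<in> nlists (n + m) A \<Longrightarrow> drop n as \<in> nlists m A"
  by (auto simp: in_nlists dest: in_set_dropD)

lemma nlists_split:
  assumes "as \<in> nlists (n + m) A"
  obtains a b where "as = a @ b" "a \<in> nlists n A" "b \<in> nlists m A"
  using take_in_nlists[OF assms, of n] drop_in_nlists[OF assms]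
  by (metis append_take_drop_id le_add1)

lemma take_append_nlists [simp]: "a \<in> nlists n A \<Longrightarrow> take n (a @ b) = a"
  by (simp add: in_nlists)

lemma drop_append_nlists [simp]: "a \<in> nlists n A \<Longrightarrow> drop n (a @ b) = b"
  by (simp add: in_nlists)

section \<open>Renaming of variables\<close>

lemma val_cong: "(\<And>i. i \<in> vars_tm t \<Longrightarrow> v i = w i) \<Longrightarrow> val M v t = val M w t"
proof (induction t)
  case (Fn f ts)
  then have "map (val M v) ts = map (val M w) ts" by auto
  then show ?case by (simp only: val.simps)
qed auto

lemma sat_cong: "(\<And>i. i \<in> fv \<phi> \<Longrightarrow> v i = w i) \<Longrightarrow> sat M v \<phi> \<longleftrightarrow> sat M w \<phi>"
proof (induction \<phi> arbitrary: v w)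
  case (Eql s t)
  then show ?case using val_cong[of s v w M] val_cong[of t v w M] by simp
next
  case (Rel r ts)
  then have "map (val M v) ts = map (val M w) ts" by (auto intro!: val_cong)
  then show ?case by (simp only: sat.simps)
next
  case (Con \<phi>1 \<phi>2)
  then show ?case by (metis UnI1 UnI2 fv.simps(5) sat.simps(5))
next
  case (Exi i \<phi>)
  have "sat M (v(i := a)) \<phi> \<longleftrightarrow> sat M (w(i := a)) \<phi>" for a
    by (rule Exi.IH) (use Exi.prems in auto)
  then show ?case by simp
next
  case (Neg \<phi>)
  then show ?case by (metis fv.simps(4) sat.simps(4))
qed simp

lemma finite_vars_tm: "finite (vars_tm t)"
  by (induction t) auto

lemma finite_fv: "finite (fv \<phi>)"
  by (induction \<phi>) (auto simp: finite_vars_tm)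

primrec rn_tm :: "(nat \<Rightarrow> nat) \<Rightarrow> 'f tm \<Rightarrow> 'f tm" where
  "rn_tm \<rho> (Var i) = Var (\<rho> i)"
| "rn_tm \<rho> (Fn f ts) = Fn f (map (rn_tm \<rho>) ts)"

lemma wf_rn_tm: "wf_tm L t \<Longrightarrow> wf_tm L (rn_tm \<rho> t)"
  by (induction t) auto

lemma vars_rn_tm: "vars_tm (rn_tm \<rho> t) = \<rho> ` vars_tm t"
  by (induction t) auto

lemma val_rn_tm: "val M v (rn_tm \<rho> t) = val M (\<lambda>j. v (\<rho> j)) t"
proof (induction t)
  case (Fn f ts)
  then have "map (val M v) (map (rn_tm \<rho>) ts) = map (val M (\<lambda>j. v (\<rho> j))) ts" by auto
  then show ?case by (simp only: val.simps rn_tm.simps)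
qed simp

text \<open>Stated as existence because bound variables have to be chosen fresh for
  \<open>\<rho>\<close>, which need not be injective. One \<open>\<phi>'\<close> serves all
  structures of the given type, so it can be evaluated in M and in N alike.\<close>

lemma rename_ex:
  "\<exists>\<phi>'. (wf_fm L \<phi> \<longrightarrow> wf_fm L \<phi>') \<and> fv \<phi>' \<subseteq> \<rho> ` fv \<phi> \<and>
     (\<forall>(M :: ('f, 'r, 'a) struct) v. sat M v \<phi>' \<longleftrightarrow> sat M (\<lambda>j. v (\<rho> j)) \<phi>)"
proof (induction \<phi> arbitrary: \<rho>)
  case Falsum
  show ?case by (rule exI[of _ Falsum]) auto
next
  case (Eql s t)
  show ?case
    by (rule exI[of _ "Eql (rn_tm \<rho> s) (rn_tm \<rho> t)"])
      (auto simp: wf_rn_tm vars_rn_tm val_rn_tm)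
next
  case (Rel r ts)
  have "map (val M v) (map (rn_tm \<rho>) ts) = map (val M (\<lambda>j. v (\<rho> j))) ts"
    for M :: "('f, 'r, 'a) struct" and v
    by (auto simp: val_rn_tm)
  then show ?case
    by (intro exI[of _ "Rel r (map (rn_tm \<rho>) ts)"])
      (auto simp: wf_rn_tm vars_rn_tm simp del: map_map)
next
  case (Neg \<phi>)
  obtain \<phi>' where "wf_fm L \<phi> \<longrightarrow> wf_fm L \<phi>'" "fv \<phi>' \<subseteq> \<rho> ` fv \<phi>"
    "\<forall>(M :: ('f, 'r, 'a) struct) v. sat M v \<phi>' \<longleftrightarrow> sat M (\<lambda>j. v (\<rho> j)) \<phi>"
    using Neg.IH by blast
  then show ?case by (intro exI[of _ "Neg \<phi>'"]) auto
next
  case (Con \<phi>1 \<phi>2)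
  obtain \<phi>1' where "wf_fm L \<phi>1 \<longrightarrow> wf_fm L \<phi>1'" "fv \<phi>1' \<subseteq> \<rho> ` fv \<phi>1"
    "\<forall>(M :: ('f, 'r, 'a) struct) v. sat M v \<phi>1' \<longleftrightarrow> sat M (\<lambda>j. v (\<rho> j)) \<phi>1"
    using Con.IH(1) by blast
  moreover obtain \<phi>2' where "wf_fm L \<phi>2 \<longrightarrow> wf_fm L \<phi>2'" "fv \<phi>2' \<subseteq> \<rho> ` fv \<phi>2"
    "\<forall>(M :: ('f, 'r, 'a) struct) v. sat M v \<phi>2' \<longleftrightarrow> sat M (\<lambda>j. v (\<rho> j)) \<phi>2"
    using Con.IH(2) by blast
  ultimately show ?case by (intro exI[of _ "Con \<phi>1' \<phi>2'"]) auto
next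
  case (Exi i \<phi>)
  \<comment> \<open>\<open>z\<close> avoids the images of the remaining free variables, so the
    quantifier captures nothing. The induction hypothesis is used for \<open>\<rho>\<close>
    redirected to send \<open>i\<close> to \<open>z\<close>.\<close>
  obtain z where z: "z \<notin> \<rho> ` (fv \<phi> - {i})"
    using ex_new_if_finite[OF infinite_UNIV_nat finite_imageI[of "fv \<phi> - {i}" \<rho>]]
    by (auto simp: finite_fv)
  obtain \<phi>' where *: "wf_fm L \<phi> \<longrightarrow> wf_fm L \<phi>'" "fv \<phi>' \<subseteq> (\<rho>(i := z)) ` fv \<phi>"
    "\<And>(M :: ('f, 'r, 'a) struct) v. sat M v \<phi>' \<longleftrightarrow> sat M (\<lambda>j. v ((\<rho>(i := z)) j)) \<phi>"
    using Exi.IH[of "\<rho>(i := z)"] by blast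
  have "sat M (\<lambda>j. (v(z := a)) ((\<rho>(i := z)) j)) \<phi> \<longleftrightarrow> sat M ((\<lambda>j. v (\<rho> j))(i := a)) \<phi>"
    for M :: "('f, 'r, 'a) struct" and v a
    by (rule sat_cong) (use z in auto)
  with * show ?case by (intro exI[of _ "Exi z \<phi>'"]) (auto split: if_splits)
qed

section \<open>Uniformly definable predicates\<close>

text \<open>Maps that pick, repeat or permute entries. Substituting such a map into a predicate is
  renaming of variables, and its graph is definable without parameters.\<close>

definition coord :: "nat \<Rightarrow> nat \<Rightarrow> ('a list \<Rightarrow> 'a list) \<Rightarrow> bool" where
  "coord k n f \<longleftrightarrow> (\<exists>\<rho>. (\<forall>j<n. \<rho> j < k) \<and>
     (\<forall>as. length as = k \<longrightarrow> f as = map (\<lambda>j. as ! \<rho> j) [0..<n]))"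

lemma coord_id: "coord k k (\<lambda>as. as)"
  unfolding coord_def by (rule exI[of _ id]) (auto intro: nth_equalityI)

lemma coordE:
  assumes "coord k n f"
  obtains \<rho> where "\<And>j. j < n \<Longrightarrow> \<rho> j < k"
    "\<And>as. length as = k \<Longrightarrow> f as = map (\<lambda>j. as ! \<rho> j) [0..<n]"
  using assms unfolding coord_def by blast

lemma coordI:
  assumes "\<And>j. j < n \<Longrightarrow> \<rho> j < k"
    "\<And>as. length as = k \<Longrightarrow> f as = map (\<lambda>j. as ! \<rho> j) [0..<n]"
  shows "coord k n f"
  using assms unfolding coord_def by blast

lemma coord_take:
  assumes "coord k n f" "l \<le> n"
  shows "coord k l (\<lambda>as. take l (f as))"
proof -
  obtain \<rho> where "\<And>j. j < n \<Longrightarrow> \<rho> j < k"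
    "\<And>as. length as = k \<Longrightarrow> f as = map (\<lambda>j. as ! \<rho> j) [0..<n]"
    using assms(1) by (rule coordE) blast
  with assms(2) show ?thesis by (intro coordI[of _ \<rho>]) (simp_all add: take_map)
qed

lemma coord_drop:
  assumes "coord k (l + n) f"
  shows "coord k n (\<lambda>as. drop l (f as))"
proof -
  obtain \<rho> where \<rho>: "\<And>j. j < l + n \<Longrightarrow> \<rho> j < k"
    "\<And>as. length as = k \<Longrightarrow> f as = map (\<lambda>j. as ! \<rho> j) [0..<l + n]"
    using assms by (rule coordE) blast
  show ?thesis
  proof (rule coordI[of _ "\<lambda>j. \<rho> (l + j)"])
    fix as :: "'a list" assume "length as = k"
    then show "drop l (f as) = map (\<lambda>j. as ! \<rho> (l + j)) [0..<n]"
      by (simp add: \<rho>(2) list_eq_iff_nth_eq)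
  qed (simp add: \<rho>(1))
qed

lemma coord_append:
  assumes "coord k n f" "coord k m g"
  shows "coord k (n + m) (\<lambda>as. f as @ g as)"
proof -
  obtain \<rho> where \<rho>: "\<And>j. j < n \<Longrightarrow> \<rho> j < k"
    "\<And>as. length as = k \<Longrightarrow> f as = map (\<lambda>j. as ! \<rho> j) [0..<n]"
    using assms(1) by (rule coordE) blast
  obtain \<sigma> where \<sigma>: "\<And>j. j < m \<Longrightarrow> \<sigma> j < k"
    "\<And>as. length as = k \<Longrightarrow> g as = map (\<lambda>j. as ! \<sigma> j) [0..<m]"
    using assms(2) by (rule coordE) blast
  show ?thesis
  proof (rule coordI[of _ "\<lambda>j. if j < n then \<rho> j else \<sigma> (j - n)"])
    fix as :: "'a list" assume "length as = k"
    then show "f as @ g as = map (\<lambda>j. as ! (if j < n then \<rho> j else \<sigma> (j - n))) [0..<n + m]"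
      by (simp add: \<rho>(2) \<sigma>(2) list_eq_iff_nth_eq nth_append)
        (metis add_diff_inverse_nat add_less_cancel_left nth_upt plus_nat.add_0)
  qed (simp add: \<rho>(1) \<sigma>(1))
qed

lemma coord_Nil: "coord k 0 (\<lambda>as. [])"
  unfolding coord_def by auto

lemma coord_in_nlists: "coord k n f \<Longrightarrow> as \<in> nlists k A \<Longrightarrow> f as \<in> nlists n A"
  by (erule coordE) (auto simp: in_nlists)

lemma coord_take_id: "l \<le> k \<Longrightarrow> coord k l (take l)"
  by (rule coord_take[OF coord_id])

lemma coord_drop_id: "k = l + n \<Longrightarrow> coord k n (drop l)"
  using coord_drop[OF coord_id] by blast

lemma coord_take_drop: "l + n \<le> k \<Longrightarrow> coord k n (\<lambda>as. take n (drop l as))"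
  by (rule coord_take[OF coord_drop_id[of k l "k - l"]]) auto

lemma coord_drop_drop: "k = l + (l' + n) \<Longrightarrow> coord k n (\<lambda>as. drop l' (drop l as))"
  by (rule coord_drop[OF coord_drop_id])

lemmas coord_intros =
  coord_take_id coord_drop_id coord_take_drop coord_drop_drop coord_append coord_Nil coord_id

text \<open>With index type \<open>unit\<close> this is one structure; with index type
  \<open>bool\<close> it will be the pair of M and N, so that a formula found once can be read in
  both.\<close>

locale structs =
  fixes L :: "('f, 'r) lang" and st :: "'i \<Rightarrow> ('f, 'r, 'a) struct"
  assumes struct: "is_structure L (st i)"
begin

text \<open>\<open>P i\<close> is defined in \<open>st i\<close> by a formula which does not depend on i, with parameters chosen
  by finitely many of the sections \<open>c \<in> K\<close>.\<close>

definition dfn :: "('i \<Rightarrow> 'a) set \<Rightarrow> nat \<Rightarrow> ('i \<Rightarrow> 'a list \<Rightarrow> bool) \<Rightarrow> bool" where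
  "dfn K n P \<longleftrightarrow> (\<exists>cs \<phi>. set cs \<subseteq> K \<and> \<phi> \<in> forms L (n + length cs) \<and>
     (\<forall>i. \<forall>as\<in>nlists n (univ (st i)). P i as \<longleftrightarrow> holds (st i) \<phi> (as @ map (\<lambda>c. c i) cs)))"

lemma dfnI:
  assumes "set cs \<subseteq> K" "\<phi> \<in> forms L (n + length cs)"
    "\<And>i as. as \<in> nlists n (univ (st i)) \<Longrightarrow> P i as \<longleftrightarrow> holds (st i) \<phi> (as @ map (\<lambda>c. c i) cs)"
  shows "dfn K n P"
  using assms unfolding dfn_def by blast

lemma dfnE:
  assumes "dfn K n P"
  obtains cs \<phi> where "set cs \<subseteq> K" "\<phi> \<in> forms L (n + length cs)"
    "\<And>i as. as \<in> nlists n (univ (st i)) \<Longrightarrow> P i as \<longleftrightarrow> holds (st i) \<phi> (as @ map (\<lambda>c. c i) cs)"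
  using assms unfolding dfn_def by blast

lemma dfn_cong:
  assumes "dfn K n P" "\<And>i as. as \<in> nlists n (univ (st i)) \<Longrightarrow> Q i as \<longleftrightarrow> P i as"
  shows "dfn K n Q"
  using assms unfolding dfn_def by simp

lemma dfn_holds: "\<phi> \<in> forms L n \<Longrightarrow> dfn K n (\<lambda>i as. holds (st i) \<phi> as)"
  by (rule dfnI[of "[]"]) auto

lemma dfn_mono: "dfn K n P \<Longrightarrow> K \<subseteq> K' \<Longrightarrow> dfn K' n P"
  unfolding dfn_def by blast

lemma dfn_not:
  assumes "dfn K n P"
  shows "dfn K n (\<lambda>i as. \<not> P i as)"
proof -
  from assms obtain cs \<phi> where "set cs \<subseteq> K" "\<phi> \<in> forms L (n + length cs)"
    "\<And>i as. as \<in> nlists n (univ (st i)) \<Longrightarrow> P i as \<longleftrightarrow> holds (st i) \<phi> (as @ map (\<lambda>c. c i) cs)"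
    by (rule dfnE) blast
  then show ?thesis by (intro dfnI[of cs _ "Neg \<phi>"]) (auto simp: forms_def)
qed

lemma holds_rename:
  assumes "\<phi> \<in> forms L n" "\<And>j. j < n \<Longrightarrow> \<rho> j < k"
  obtains \<psi> where "\<psi> \<in> forms L k"
    "\<And>(S :: ('f, 'r, 'a) struct) as bs. length bs = k \<Longrightarrow>
       (\<And>j. j < n \<Longrightarrow> as ! j = bs ! \<rho> j) \<Longrightarrow> holds S \<psi> bs \<longleftrightarrow> holds S \<phi> as"
proof -
  obtain \<psi> where \<psi>: "wf_fm L \<phi> \<longrightarrow> wf_fm L \<psi>" "fv \<psi> \<subseteq> \<rho> ` fv \<phi>"
    "\<And>(S :: ('f, 'r, 'a) struct) v. sat S v \<psi> \<longleftrightarrow> sat S (\<lambda>j. v (\<rho> j)) \<phi>"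
    using rename_ex[of L \<phi> \<rho>] by blast
  show thesis
  proof
    show "\<psi> \<in> forms L k" using assms \<psi>(1,2) by (auto simp: forms_def)
    fix S :: "('f, 'r, 'a) struct" and as bs :: "'a list"
    assume "length bs = k" and *: "\<And>j. j < n \<Longrightarrow> as ! j = bs ! \<rho> j"
    have "sat S (\<lambda>j. bs ! \<rho> j) \<phi> \<longleftrightarrow> holds S \<phi> as"
      by (rule sat_cong) (use assms(1) * in \<open>auto simp: forms_def\<close>)
    then show "holds S \<psi> bs \<longleftrightarrow> holds S \<phi> as" by (simp add: \<psi>(3))
  qed
qed

lemma dfn_and:
  assumes "dfn K n P" "dfn K n Q"
  shows "dfn K n (\<lambda>i as. P i as \<and> Q i as)"
proof -
  from assms(1) obtain cs \<phi> where 1: "set cs \<subseteq> K" "\<phi> \<in> forms L (n + length cs)"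
    "\<And>i as. as \<in> nlists n (univ (st i)) \<Longrightarrow> P i as \<longleftrightarrow> holds (st i) \<phi> (as @ map (\<lambda>c. c i) cs)"
    by (rule dfnE) blast
  from assms(2) obtain ds \<psi> where 2: "set ds \<subseteq> K" "\<psi> \<in> forms L (n + length ds)"
    "\<And>i as. as \<in> nlists n (univ (st i)) \<Longrightarrow> Q i as \<longleftrightarrow> holds (st i) \<psi> (as @ map (\<lambda>c. c i) ds)"
    by (rule dfnE) blast
  obtain \<phi>' where 3: "\<phi>' \<in> forms L (n + length (cs @ ds))"
    "\<And>(S :: ('f, 'r, 'a) struct) as bs. length bs = n + length (cs @ ds) \<Longrightarrow>
       (\<And>j. j < n + length cs \<Longrightarrow> as ! j = bs ! j) \<Longrightarrow> holds S \<phi>' bs \<longleftrightarrow> holds S \<phi> as"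
    using holds_rename[OF 1(2), of "\<lambda>j. j" "n + length (cs @ ds)"] by auto
  \<comment> \<open>In the common list the parameters \<open>ds\<close> stand behind
    \<open>cs\<close>, so the parameter variables of \<open>\<psi>\<close> move up by
    \<open>length cs\<close>.\<close>
  let ?\<rho> = "\<lambda>j. if j < n then j else j + length cs"
  obtain \<psi>' where 4: "\<psi>' \<in> forms L (n + length (cs @ ds))"
    "\<And>(S :: ('f, 'r, 'a) struct) as bs. length bs = n + length (cs @ ds) \<Longrightarrow>
       (\<And>j. j < n + length ds \<Longrightarrow> as ! j = bs ! ?\<rho> j) \<Longrightarrow> holds S \<psi>' bs \<longleftrightarrow> holds S \<psi> as"
  proof (rule holds_rename[OF 2(2)])
    show "?\<rho> j < n + length (cs @ ds)" if "j < n + length ds" for j using that by auto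
  qed blast
  show ?thesis
  proof (rule dfnI[of "cs @ ds" _ "Con \<phi>' \<psi>'"])
    show "set (cs @ ds) \<subseteq> K" using 1 2 by simp
    show "Con \<phi>' \<psi>' \<in> forms L (n + length (cs @ ds))" using 3(1) 4(1) by (simp add: forms_def)
    fix i and as assume as: "as \<in> nlists n (univ (st i))"
    then have len: "length as = n" by (simp add: in_nlists)
    let ?p = "map (\<lambda>c. c i)"
    have "holds (st i) \<phi>' (as @ ?p (cs @ ds)) \<longleftrightarrow> holds (st i) \<phi> (as @ ?p cs)"
      by (rule 3(2)) (auto simp: nth_append len)
    moreover have "holds (st i) \<psi>' (as @ ?p (cs @ ds)) \<longleftrightarrow> holds (st i) \<psi> (as @ ?p ds)"
      by (rule 4(2)) (auto simp: nth_append len)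
    ultimately show "P i as \<and> Q i as \<longleftrightarrow> holds (st i) (Con \<phi>' \<psi>') (as @ ?p (cs @ ds))"
      using 1(3)[OF as] 2(3)[OF as] by simp
  qed
qed

lemma dfn_or: "dfn K n P \<Longrightarrow> dfn K n Q \<Longrightarrow> dfn K n (\<lambda>i as. P i as \<or> Q i as)"
  using dfn_not[OF dfn_and[OF dfn_not dfn_not], of K n P Q] by simp

lemma dfn_imp:
  assumes "dfn K n P" "dfn K n Q"
  shows "dfn K n (\<lambda>i as. P i as \<longrightarrow> Q i as)"
  by (rule dfn_cong[OF dfn_or[OF dfn_not[OF assms(1)] assms(2)]]) blast

lemma dfn_iff:
  assumes "dfn K n P" "dfn K n Q"
  shows "dfn K n (\<lambda>i as. P i as \<longleftrightarrow> Q i as)"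
  by (rule dfn_cong[OF dfn_and[OF dfn_imp[OF assms] dfn_imp[OF assms(2,1)]]]) blast

lemma dfn_const: "dfn K n (\<lambda>i as. b)"
proof -
  have "dfn K n (\<lambda>i as. False)" by (rule dfnI[of "[]" _ Falsum]) (auto simp: forms_def)
  with dfn_not[OF this] show ?thesis by (cases b) auto
qed

lemma dfn_finite_ex:
  assumes "finite I" "\<And>x. x \<in> I \<Longrightarrow> dfn K n (P x)"
  shows "dfn K n (\<lambda>i as. \<exists>x\<in>I. P x i as)"
  using assms
proof (induction I rule: finite_induct)
  case empty
  show ?case using dfn_const[of K n False] by simp
next
  case (insert x I)
  have "dfn K n (\<lambda>i as. P x i as \<or> (\<exists>x\<in>I. P x i as))"
    by (rule dfn_or) (use insert in auto)
  then show ?case by simp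
qed

lemma dfn_finite_all:
  assumes "finite I" "\<And>x. x \<in> I \<Longrightarrow> dfn K n (P x)"
  shows "dfn K n (\<lambda>i as. \<forall>x\<in>I. P x i as)"
  using dfn_not[OF dfn_finite_ex[OF assms(1) dfn_not[OF assms(2)]]] by simp

lemma dfn_comp:
  assumes "dfn K n P" "coord k n f"
  shows "dfn K k (\<lambda>i as. P i (f as))"
proof -
  from assms(1) obtain cs \<phi> where 1: "set cs \<subseteq> K" "\<phi> \<in> forms L (n + length cs)"
    "\<And>i as. as \<in> nlists n (univ (st i)) \<Longrightarrow> P i as \<longleftrightarrow> holds (st i) \<phi> (as @ map (\<lambda>c. c i) cs)"
    by (rule dfnE) blast
  obtain \<rho> where \<rho>: "\<And>j. j < n \<Longrightarrow> \<rho> j < k"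
    "\<And>as. length as = k \<Longrightarrow> f as = map (\<lambda>j. as ! \<rho> j) [0..<n]"
    using assms(2) by (rule coordE) blast
  let ?\<sigma> = "\<lambda>j. if j < n then \<rho> j else j - n + k"
  obtain \<psi> where 2: "\<psi> \<in> forms L (k + length cs)"
    "\<And>(S :: ('f, 'r, 'a) struct) as bs. length bs = k + length cs \<Longrightarrow>
       (\<And>j. j < n + length cs \<Longrightarrow> as ! j = bs ! ?\<sigma> j) \<Longrightarrow> holds S \<psi> bs \<longleftrightarrow> holds S \<phi> as"
  proof (rule holds_rename[OF 1(2)])
    show "?\<sigma> j < k + length cs" if "j < n + length cs" for j
      using that \<rho>(1)[of j] by auto
  qed blast
  show ?thesis
  proof (rule dfnI[OF 1(1) 2(1)])
    fix i and as assume as: "as \<in> nlists k (univ (st i))"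
    have "holds (st i) \<psi> (as @ map (\<lambda>c. c i) cs) \<longleftrightarrow> holds (st i) \<phi> (f as @ map (\<lambda>c. c i) cs)"
      by (rule 2(2)) (use as in \<open>auto simp: nth_append in_nlists \<rho>\<close>)
    then show "P i (f as) \<longleftrightarrow> holds (st i) \<psi> (as @ map (\<lambda>c. c i) cs)"
      using 1(3)[OF coord_in_nlists[OF assms(2) as]] by simp
  qed
qed

text \<open>A binary predicate is entered as a predicate of the concatenated tuple, through
  \<open>take\<close> and \<open>drop\<close>. The rules for quantifiers and for level sets use the
  same format.\<close>

lemma dfn_comp2:
  assumes "dfn K (n + m) (\<lambda>i as. P i (take n as) (drop n as))" "coord k n f" "coord k m g"
  shows "dfn K k (\<lambda>i as. P i (f as) (g as))"
proof (rule dfn_cong[OF dfn_comp[OF assms(1) coord_append[OF assms(2,3)]]])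
  fix i as assume "as \<in> nlists k (univ (st i))"
  then have "f as \<in> nlists n (univ (st i))" by (rule coord_in_nlists[OF assms(2)])
  then show "P i (f as) (g as) \<longleftrightarrow> P i (take n (f as @ g as)) (drop n (f as @ g as))"
    by (simp add: in_nlists)
qed

lemma dfn_eq:
  assumes "coord k n f" "coord k n g"
  shows "dfn K k (\<lambda>i as. f as = g as)"
proof -
  obtain \<rho> where \<rho>: "\<And>j. j < n \<Longrightarrow> \<rho> j < k"
    "\<And>as. length as = k \<Longrightarrow> f as = map (\<lambda>j. as ! \<rho> j) [0..<n]"
    using assms(1) by (rule coordE) blast
  obtain \<sigma> where \<sigma>: "\<And>j. j < n \<Longrightarrow> \<sigma> j < k"
    "\<And>as. length as = k \<Longrightarrow> g as = map (\<lambda>j. as ! \<sigma> j) [0..<n]"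
    using assms(2) by (rule coordE) blast
  have "dfn K k (\<lambda>i as. as ! \<rho> j = as ! \<sigma> j)" if "j \<in> {..<n}" for j
    by (rule dfnI[of "[]" _ "Eql (Var (\<rho> j)) (Var (\<sigma> j))"])
      (use that \<rho>(1)[of j] \<sigma>(1)[of j] in \<open>auto simp: forms_def\<close>)
  then have "dfn K k (\<lambda>i as. \<forall>j\<in>{..<n}. as ! \<rho> j = as ! \<sigma> j)"
    by (intro dfn_finite_all) auto
  then show ?thesis by (rule dfn_cong) (auto simp: \<rho>(2) \<sigma>(2) in_nlists)
qed

lemma dfn_param:
  assumes "dfn K (n + length cs) P" "set cs \<subseteq> K" "\<And>i c. c \<in> K \<Longrightarrow> c i \<in> univ (st i)"
  shows "dfn K n (\<lambda>i as. P i (as @ map (\<lambda>c. c i) cs))"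
proof -
  from assms(1) obtain ds \<phi> where 1: "set ds \<subseteq> K" "\<phi> \<in> forms L (n + length cs + length ds)"
    "\<And>i as. as \<in> nlists (n + length cs) (univ (st i)) \<Longrightarrow>
       P i as \<longleftrightarrow> holds (st i) \<phi> (as @ map (\<lambda>c. c i) ds)"
    by (rule dfnE) blast
  show ?thesis
  proof (rule dfnI[of "cs @ ds" _ \<phi>])
    fix i and as assume as: "as \<in> nlists n (univ (st i))"
    have "map (\<lambda>c. c i) cs \<in> nlists (length cs) (univ (st i))"
      using assms(2,3) by (auto simp: in_nlists)
    then show "P i (as @ map (\<lambda>c. c i) cs) \<longleftrightarrow> holds (st i) \<phi> (as @ map (\<lambda>c. c i) (cs @ ds))"
      using 1(3)[OF nlists_appendI[OF as]] by simp
  qed (use 1 assms(2) in \<open>auto simp: add.assoc\<close>)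
qed

lemma dfn_ex1:
  assumes "dfn K (Suc n) P"
  shows "dfn K n (\<lambda>i as. \<exists>a\<in>univ (st i). P i (as @ [a]))"
proof -
  from assms(1) obtain cs \<phi> where 1: "set cs \<subseteq> K" "\<phi> \<in> forms L (Suc n + length cs)"
    "\<And>i as. as \<in> nlists (Suc n) (univ (st i)) \<Longrightarrow>
       P i as \<longleftrightarrow> holds (st i) \<phi> (as @ map (\<lambda>c. c i) cs)"
    by (rule dfnE) blast
  let ?q = "length cs"
  \<comment> \<open>The quantified entry stands before the parameters in \<open>\<phi>\<close>. It
    is moved behind them, to index \<open>n + length cs\<close>, so that binding it leaves exactly
    the variables of \<open>as\<close> and of the parameters.\<close>
  let ?\<rho> = "\<lambda>j. if j < n then j else if j = n then n + ?q else j - 1"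
  obtain \<psi> where 2: "\<psi> \<in> forms L (Suc (n + ?q))"
    "\<And>(S :: ('f, 'r, 'a) struct) as bs. length bs = Suc (n + ?q) \<Longrightarrow>
       (\<And>j. j < Suc n + ?q \<Longrightarrow> as ! j = bs ! ?\<rho> j) \<Longrightarrow> holds S \<psi> bs \<longleftrightarrow> holds S \<phi> as"
  proof (rule holds_rename[OF 1(2)])
    show "?\<rho> j < Suc (n + ?q)" if "j < Suc n + ?q" for j using that by auto
  qed blast
  show ?thesis
  proof (rule dfnI[OF 1(1), of "Exi (n + ?q) \<psi>"])
    show "Exi (n + ?q) \<psi> \<in> forms L (n + ?q)"
      using 2(1) by (fastforce simp: forms_def less_Suc_eq)
    fix i as assume as: "as \<in> nlists n (univ (st i))"
    then have len: "length as = n" by (simp add: in_nlists)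
    let ?p = "map (\<lambda>c. c i) cs"
    have "sat (st i) (((!) (as @ ?p))(n + ?q := a)) \<psi> \<longleftrightarrow> P i (as @ [a])"
      if "a \<in> univ (st i)" for a
    proof -
      have "sat (st i) (((!) (as @ ?p))(n + ?q := a)) \<psi> \<longleftrightarrow> holds (st i) \<psi> (as @ ?p @ [a])"
        by (rule sat_cong)
          (use 2(1) in \<open>auto simp: forms_def nth_append len less_Suc_eq\<close>)
      also have "\<dots> \<longleftrightarrow> holds (st i) \<phi> ((as @ [a]) @ ?p)"
        by (rule 2(2)) (auto simp: nth_append nth_Cons' len)
      also have "\<dots> \<longleftrightarrow> P i (as @ [a])"
        by (rule 1(3)[symmetric]) (use as that in \<open>auto simp: in_nlists\<close>)
      finally show ?thesis .
    qed
    then show "(\<exists>a\<in>univ (st i). P i (as @ [a])) \<longleftrightarrow> holds (st i) (Exi (n + ?q) \<psi>) (as @ ?p)"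
      by (simp add: len)
  qed
qed

lemma dfn_ex:
  assumes "dfn K (n + m) P"
  shows "dfn K n (\<lambda>i as. \<exists>bs\<in>nlists m (univ (st i)). P i (as @ bs))"
  using assms
proof (induction m arbitrary: P)
  case (Suc m)
  have "dfn K n (\<lambda>i as. \<exists>bs\<in>nlists m (univ (st i)). \<exists>a\<in>univ (st i). P i ((as @ bs) @ [a]))"
    by (rule Suc.IH[OF dfn_ex1]) (use Suc.prems in simp)
  moreover have "(\<exists>bs\<in>nlists m (univ (st i)). \<exists>a\<in>univ (st i). P i ((as @ bs) @ [a])) \<longleftrightarrow>
      (\<exists>bs\<in>nlists (Suc m) (univ (st i)). P i (as @ bs))" for i as
  proof
    assume "\<exists>bs\<in>nlists m (univ (st i)). \<exists>a\<in>univ (st i). P i ((as @ bs) @ [a])"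
    then obtain bs a where "bs \<in> nlists m (univ (st i))" "a \<in> univ (st i)" "P i (as @ bs @ [a])"
      by auto
    then show "\<exists>bs\<in>nlists (Suc m) (univ (st i)). P i (as @ bs)"
      by (intro bexI[of _ "bs @ [a]"]) (auto simp: in_nlists)
  next
    assume "\<exists>bs\<in>nlists (Suc m) (univ (st i)). P i (as @ bs)"
    then obtain cs where cs: "cs \<in> nlists (m + 1) (univ (st i))" "P i (as @ cs)" by auto
    from cs(1) obtain bs b where "cs = bs @ b" "bs \<in> nlists m (univ (st i))" "b \<in> nlists 1 (univ (st i))"
      by (rule nlists_split)
    with cs(2) show "\<exists>bs\<in>nlists m (univ (st i)). \<exists>a\<in>univ (st i). P i ((as @ bs) @ [a])"
      by (auto simp: in_nlists_Suc_iff)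
  qed
  ultimately show ?case by simp
qed simp

lemma dfn_bex:
  assumes "dfn K (n + m) (\<lambda>i as. P i (take n as) (drop n as))"
  shows "dfn K n (\<lambda>i as. \<exists>b\<in>nlists m (univ (st i)). P i as b)"
  by (rule dfn_cong[OF dfn_ex[OF assms]]) (simp add: in_nlists)

lemma dfn_ball:
  assumes "dfn K (n + m) (\<lambda>i as. P i (take n as) (drop n as))"
  shows "dfn K n (\<lambda>i as. \<forall>b\<in>nlists m (univ (st i)). P i as b)"
  using dfn_not[OF dfn_bex[OF dfn_not[OF assms]]] by simp

end

section \<open>Definable sets in one structure\<close>

text \<open>A parameter a is the constant section \<open>\<lambda>_. a\<close> of a family indexed by \<open>unit\<close>.\<close>

abbreviation kset :: "'a set \<Rightarrow> (unit \<Rightarrow> 'a) set" where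
  "kset A \<equiv> (\<lambda>a _. a) ` A"

locale single =
  fixes L :: "('f, 'r) lang" and N :: "('f, 'r, 'a) struct"
  assumes is_struct: "is_structure L N"
begin

sublocale structs L "\<lambda>_::unit. N"
  by unfold_locales (rule is_struct)

abbreviation U :: "nat \<Rightarrow> 'a list set" where
  "U n \<equiv> nlists n (univ N)"

text \<open>Moves definability into the calculus of \<open>dfn\<close>, where Boolean operations,
  quantifiers and substitutions are rules and parameters are kept track of by the set
  \<open>kset A\<close>.\<close>

lemma definable_over_iff:
  "definable_over L N A n X \<longleftrightarrow> X \<subseteq> U n \<and> dfn (kset A) n (\<lambda>_ as. as \<in> X)"
proof
  assume "definable_over L N A n X"
  then obtain m \<phi> b where *: "\<phi> \<in> forms L (n + m)" "b \<in> nlists m A" "X = inst N n \<phi> b"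
    unfolding definable_over_def by blast
  have "dfn (kset A) n (\<lambda>_ as. as \<in> X)"
    by (rule dfnI[of "map (\<lambda>a _. a) b" _ \<phi>])
      (use * in \<open>auto simp: in_nlists inst_def comp_def\<close>)
  then show "X \<subseteq> U n \<and> dfn (kset A) n (\<lambda>_ as. as \<in> X)"
    using *(3) by (auto simp: inst_def)
next
  assume *: "X \<subseteq> U n \<and> dfn (kset A) n (\<lambda>_ as. as \<in> X)"
  then have "dfn (kset A) n (\<lambda>_ as. as \<in> X)" by blast
  then obtain cs \<phi> where cs: "set cs \<subseteq> kset A" "\<phi> \<in> forms L (n + length cs)"
    "\<And>i as. as \<in> U n \<Longrightarrow> as \<in> X \<longleftrightarrow> holds N \<phi> (as @ map (\<lambda>c. c i) cs)"
    by (rule dfnE) blast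
  have "X = inst N n \<phi> (map (\<lambda>c. c ()) cs)"
    using * cs(3)[of _ "()"] by (auto simp: inst_def)
  moreover have "map (\<lambda>c. c ()) cs \<in> nlists (length cs) A"
    using cs(1) by (auto simp: in_nlists)
  ultimately show "definable_over L N A n X"
    using cs(2) unfolding definable_over_def by blast
qed

lemma definable_Collect:
  "dfn (kset A) n (\<lambda>_ as. P as) \<Longrightarrow> definable_over L N A n {a \<in> U n. P a}"
  unfolding definable_over_iff by (auto elim!: dfn_cong)

lemma definable_over_mono: "definable_over L N A n X \<Longrightarrow> A \<subseteq> B \<Longrightarrow> definable_over L N B n X"
  unfolding definable_over_def using nlists_mono[of A B] by blast

lemma definable_subset: "definable_over L N A n X \<Longrightarrow> X \<subseteq> U n"
  by (simp add: definable_over_iff)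

lemma dfn_mem:
  assumes "definable_over L N A n X" "coord k n f"
  shows "dfn (kset A) k (\<lambda>_ as. f as \<in> X)"
  using dfn_comp[OF _ assms(2), of "kset A" "\<lambda>_ as. as \<in> X"] assms(1)
  by (simp add: definable_over_iff)

lemma dfn_mem_id: "definable_over L N A n X \<Longrightarrow> dfn (kset A) n (\<lambda>_ as. as \<in> X)"
  by (simp add: definable_over_iff)

lemma dfn_section:
  assumes "dfn (kset A) (n + m) (\<lambda>_ as. Q (take n as) (drop n as))" "b \<in> nlists m A" "A \<subseteq> univ N"
  shows "dfn (kset A) n (\<lambda>_ a. Q a b)"
proof -
  have len: "length (map (\<lambda>a _. a) b) = m" using assms(2) by (simp add: in_nlists)
  have "dfn (kset A) n (\<lambda>_ as. Q (take n (as @ b)) (drop n (as @ b)))"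
    using dfn_param[of "kset A" n "map (\<lambda>a _. a) b" "\<lambda>_ as. Q (take n as) (drop n as)"] assms
    by (auto simp: in_nlists comp_def)
  then show ?thesis by (rule dfn_cong) (simp add: in_nlists)
qed

lemma definable_section:
  assumes "dfn {} (n + m) (\<lambda>_ as. Q (take n as) (drop n as))" "b \<in> U m"
  shows "definable L N n {a \<in> U n. Q a b}"
  by (rule definable_Collect[OF dfn_section[OF dfn_mono[OF assms(1)] assms(2)]]) auto

lemma definable_0: "\<phi> \<in> forms L n \<Longrightarrow> definable_over L N A n (inst N n \<phi> [])"
  unfolding definable_over_def by (intro exI[of _ 0] bexI[of _ \<phi>] bexI[of _ "[]"]) auto

lemma definable_empty: "definable_over L N A n {}"
  using definable_Collect[OF dfn_const, of A n False] by simp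

lemma definable_U: "definable_over L N A n (U n)"
  using definable_Collect[OF dfn_const, of A n True] by simp

lemma definable_Int:
  assumes "definable_over L N A n X" "definable_over L N A n Y"
  shows "definable_over L N A n (X \<inter> Y)"
  using dfn_and[of "kset A" n "\<lambda>_ as. as \<in> X" "\<lambda>_ as. as \<in> Y"] assms
  by (auto simp: definable_over_iff)

lemma definable_Un:
  assumes "definable_over L N A n X" "definable_over L N A n Y"
  shows "definable_over L N A n (X \<union> Y)"
  using dfn_or[of "kset A" n "\<lambda>_ as. as \<in> X" "\<lambda>_ as. as \<in> Y"] assms
  by (auto simp: definable_over_iff)

lemma definable_Diff:
  assumes "definable_over L N A n X" "definable_over L N A n Y"
  shows "definable_over L N A n (X - Y)"
  using dfn_and[of "kset A" n "\<lambda>_ as. as \<in> X" "\<lambda>_ as. as \<notin> Y"] assms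
    dfn_not[of "kset A" n "\<lambda>_ as. as \<in> Y"]
  by (auto simp: definable_over_iff)

lemma definable_UN:
  assumes "finite I" "\<And>i. i \<in> I \<Longrightarrow> definable_over L N A n (X i)"
  shows "definable_over L N A n (\<Union>i\<in>I. X i)"
  using assms by (induction I rule: finite_induct) (auto intro: definable_empty definable_Un)

lemma definable_singleton: "x \<in> U n \<Longrightarrow> definable L N n {x}"
proof -
  assume x: "x \<in> U n"
  have "dfn {} (n + n) (\<lambda>_ as. take n as = drop n as)"
    by (intro dfn_eq[of _ n] coord_intros) auto
  from definable_section[OF this x] show ?thesis
    using x by (auto simp: Collect_conv_if conj_commute)
qed

text \<open>The image is a projection of the graph of \<open>f\<close>, and the graph is given by
  equalities between variables.\<close>

lemma definable_image:
  assumes "definable_over L N A n X" "coord n m f"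
  shows "definable_over L N A m (f ` X)"
proof -
  have f: "f x \<in> U m" if "x \<in> X" for x
    using coord_in_nlists[OF assms(2)] definable_subset[OF assms(1)] that by blast
  have "coord (m + n) m (\<lambda>as. f (drop m as))"
  proof -
    obtain \<rho> where \<rho>: "\<And>j. j < m \<Longrightarrow> \<rho> j < n"
      "\<And>as. length as = n \<Longrightarrow> f as = map (\<lambda>j. as ! \<rho> j) [0..<m]"
      using assms(2) by (rule coordE) blast
    show ?thesis by (rule coordI[of _ "\<lambda>j. m + \<rho> j"]) (use \<rho> in auto)
  qed
  then have "dfn (kset A) (m + n) (\<lambda>_ as. drop m as \<in> X \<and> f (drop m as) = take m as)"
    by (intro dfn_and dfn_eq[of _ m] dfn_mem[OF assms(1)] coord_intros) auto
  then have "definable_over L N A m {y \<in> U m. \<exists>x\<in>U n. x \<in> X \<and> f x = y}"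
    by (intro definable_Collect dfn_bex)
  also have "{y \<in> U m. \<exists>x\<in>U n. x \<in> X \<and> f x = y} = f ` X"
    using f definable_subset[OF assms(1)] by auto
  finally show ?thesis .
qed

lemma definable_graph:
  assumes "definable_over L N A n X" "coord n m f"
  shows "definable_over L N A (n + m) {x @ f x | x. x \<in> X}"
proof -
  have "coord n (n + m) (\<lambda>as. as @ f as)"
    by (intro coord_append coord_id assms)
  then have "definable_over L N A (n + m) ((\<lambda>as. as @ f as) ` X)"
    by (rule definable_image[OF assms(1)])
  also have "(\<lambda>as. as @ f as) ` X = {x @ f x | x. x \<in> X}" by auto
  finally show ?thesis .
qed

lemma definable_drop:
  assumes "definable_over L N A (n + m) Z" "definable_over L N A m Y"
  shows "definable_over L N A (n + m) {z \<in> Z. drop n z \<in> Y}"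
proof -
  have "dfn (kset A) (n + m) (\<lambda>_ z. z \<in> Z \<and> drop n z \<in> Y)"
    by (intro dfn_and dfn_mem_id dfn_mem[of _ m] assms coord_intros refl)
  then have "definable_over L N A (n + m) {z \<in> U (n + m). z \<in> Z \<and> drop n z \<in> Y}"
    by (rule definable_Collect)
  also have "\<dots> = {z \<in> Z. drop n z \<in> Y}" using definable_subset[OF assms(1)] by auto
  finally show ?thesis .
qed

end

section \<open>Measurable structures\<close>

text \<open>Addition of leading terms: a pair \<open>(d, r)\<close> behaves like r * t ^ d for large
  t, and a sum keeps only its term of top degree.\<close>

definition comb :: "nat \<times> real \<Rightarrow> nat \<times> real \<Rightarrow> nat \<times> real" where
  "comb p q = (max (fst p) (fst q),
     if fst p = fst q then snd p + snd q else if fst q < fst p then snd p else snd q)"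

text \<open>The level formula \<open>\<psi>\<close> does not depend on \<open>i\<close>: this is
  what makes statements about values transferable between the members of the family.\<close>

locale ms_family = structs L st
  for L :: "('f, 'r) lang" and st :: "'i \<Rightarrow> ('f, 'r, 'a) struct" +
  fixes hh :: "'i \<Rightarrow> 'a list set \<Rightarrow> nat \<times> real"
  assumes level: "\<phi> \<in> forms L (n + m) \<Longrightarrow> \<exists>\<psi>\<in>forms L m. \<forall>i. \<forall>b\<in>nlists m (univ (st i)).
    holds (st i) \<psi> b \<longleftrightarrow> hh i (inst (st i) n \<phi> b) = p"
begin

text \<open>Parameters are appended to the variables \<open>b\<close>; the axiom
  \<open>level\<close> applies to the longer tuple, after which they are fixed again.\<close>

lemma dfn_level:
  assumes "dfn K (n + m) (\<lambda>i as. Q i (take n as) (drop n as))"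
    and K: "\<And>i c. c \<in> K \<Longrightarrow> c i \<in> univ (st i)"
  shows "dfn K m (\<lambda>i b. hh i {a \<in> nlists n (univ (st i)). Q i a b} = p)"
proof -
  from assms(1) obtain cs \<phi> where cs: "set cs \<subseteq> K" "\<phi> \<in> forms L (n + m + length cs)"
    "\<And>i as. as \<in> nlists (n + m) (univ (st i)) \<Longrightarrow>
       Q i (take n as) (drop n as) \<longleftrightarrow> holds (st i) \<phi> (as @ map (\<lambda>c. c i) cs)"
    by (rule dfnE) blast
  obtain \<psi> where \<psi>: "\<psi> \<in> forms L (m + length cs)"
    "\<And>i b. b \<in> nlists (m + length cs) (univ (st i)) \<Longrightarrow>
      holds (st i) \<psi> b \<longleftrightarrow> hh i (inst (st i) n \<phi> b) = p"
    using level[of \<phi> n "m + length cs" p] cs(2) by (auto simp: add.assoc)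
  show ?thesis
  proof (rule dfnI[OF cs(1) \<psi>(1)])
    fix i and b assume b: "b \<in> nlists m (univ (st i))"
    have p: "map (\<lambda>c. c i) cs \<in> nlists (length cs) (univ (st i))"
      using cs(1) K by (auto simp: in_nlists)
    have "Q i a b \<longleftrightarrow> holds (st i) \<phi> (a @ b @ map (\<lambda>c. c i) cs)" if "a \<in> nlists n (univ (st i))" for a
      using cs(3)[OF nlists_appendI[OF that b]] that by (simp add: in_nlists)
    then have "{a \<in> nlists n (univ (st i)). Q i a b} = inst (st i) n \<phi> (b @ map (\<lambda>c. c i) cs)"
      by (auto simp: inst_def)
    then show "hh i {a \<in> nlists n (univ (st i)). Q i a b} = p \<longleftrightarrow>
        holds (st i) \<psi> (b @ map (\<lambda>c. c i) cs)"
      using \<psi>(2)[OF nlists_appendI[OF b p]] by simp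
  qed
qed

end

text \<open>The common interface of \<open>(M, h)\<close> and of N with its induced value. Fibration
  is kept only for projections to the last coordinates and with \<open>r > 0\<close>, which forces
  non-empty fibres; \<open>H_swap\<close> makes the first coordinates available as well. In this
  form each clause can be expressed by formulas and level sets.\<close>

locale ms_struct = single L N
  for L :: "('f, 'r) lang" and N :: "('f, 'r, 'a) struct" +
  fixes H :: "'a list set \<Rightarrow> nat \<times> real"
  assumes level_single: "\<phi> \<in> forms L (n + m) \<Longrightarrow>
      \<exists>\<psi>\<in>forms L m. \<forall>b\<in>U m. holds N \<psi> b \<longleftrightarrow> H (inst N n \<phi> b) = p"
    and values_finite: "\<phi> \<in> forms L (n + m) \<Longrightarrow> \<exists>D. finite D \<and> (\<forall>b\<in>U m. H (inst N n \<phi> b) \<in> D)"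
    and H_empty: "H {} = (0, 0)"
    and H_pos: "definable L N n X \<Longrightarrow> X \<noteq> {} \<Longrightarrow> snd (H X) > 0"
    and H_Un: "definable L N n X \<Longrightarrow> definable L N n Y \<Longrightarrow> X \<inter> Y = {} \<Longrightarrow>
      H (X \<union> Y) = comb (H X) (H Y)"
    and H_fib: "definable L N (n + m) Z \<Longrightarrow> definable L N m Y \<Longrightarrow> Y \<noteq> {} \<Longrightarrow>
      \<forall>z\<in>Z. drop n z \<in> Y \<Longrightarrow> \<forall>b\<in>Y. H {a \<in> U n. a @ b \<in> Z} = (d, r) \<Longrightarrow> r > 0 \<Longrightarrow>
      H Z = (fst (H Y) + d, r * snd (H Y))"
    and H_swap: "definable L N (n + m) Z \<Longrightarrow> H ((\<lambda>z. drop n z @ take n z) ` Z) = H Z"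
begin

sublocale ms_family L "\<lambda>_::unit. N" "\<lambda>_. H"
  by unfold_locales (use level_single in auto)

end

locale ms_measuring_struct = single L M
  for L :: "('f, 'r) lang" and M :: "('f, 'r, 'a) struct" +
  fixes h :: "'a list set \<Rightarrow> nat \<times> real"
  assumes ms: "ms_measuring L M h"
begin

lemma vals: "definable L M n X \<Longrightarrow> h X \<in> ms_values"
  using ms unfolding ms_measuring_def by (elim conjE) blast

lemma h_finite: "definable L M n X \<Longrightarrow> finite X \<Longrightarrow> h X = (0, real (card X))"
  using ms unfolding ms_measuring_def by blast

lemma h_Un: "definable L M n X \<Longrightarrow> definable L M n Y \<Longrightarrow> X \<inter> Y = {} \<Longrightarrow>
    h (X \<union> Y) = comb (h X) (h Y)"
  using ms unfolding ms_measuring_def comb_def by blast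

lemma h_empty: "h {} = (0, 0)"
  using h_finite[OF definable_empty] by simp

lemma h_singleton: "x \<in> U n \<Longrightarrow> h {x} = (0, 1)"
  using h_finite[OF definable_singleton] by simp

text \<open>A non-empty set could a priori receive the value \<open>(0, 0)\<close>. Splitting off a
  point, which has value \<open>(0, 1)\<close>, excludes this: either the rest has dimension 0 and
  the measures add up to at least 1, or it has positive dimension and hence positive
  measure.\<close>

lemma h_pos:
  assumes "definable L M n X" "X \<noteq> {}"
  shows "snd (h X) > 0"
proof -
  obtain x where x: "x \<in> X" using assms by blast
  then have xU: "x \<in> U n" using definable_subset[OF assms(1)] by blast
  have d: "definable L M n (X - {x})"
    by (intro definable_Diff assms definable_singleton xU)
  have "h ({x} \<union> (X - {x})) = comb (h {x}) (h (X - {x}))"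
    by (rule h_Un[OF definable_singleton[OF xU] d]) simp
  moreover have "{x} \<union> (X - {x}) = X" using x by blast
  ultimately show ?thesis
    using vals[OF d] by (auto simp: comb_def h_singleton[OF xU] ms_values_def)
qed

lemma h_fib_coord:
  assumes "definable L M n X" "X \<noteq> {}" "coord n m f"
    and "\<And>a. a \<in> f ` X \<Longrightarrow> h {x \<in> X. f x = a} = (d, r)"
  shows "h X = (fst (h (f ` X)) + d, r * snd (h (f ` X)))"
proof -
  have "\<forall>n m X Y f d r. definable L M n X \<and> X \<noteq> {} \<and> definable L M m Y \<and>
        f ` X = Y \<and> definable L M (n + m) {x @ f x | x. x \<in> X} \<and>
        (\<forall>a\<in>Y. h {x \<in> X. f x = a} = (d, r)) \<longrightarrow>
        h X = (fst (h Y) + d, r * snd (h Y))"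
    using ms unfolding ms_measuring_def by (elim conjE) assumption
  from this[rule_format, of n X m "f ` X" f d r] show ?thesis
    using assms definable_image[OF assms(1,3)] definable_graph[OF assms(1,3)] by blast
qed

text \<open>Clause (4) with one-point fibres, whose value is \<open>(0, 1)\<close>.\<close>

lemma h_inj:
  assumes "definable L M n X" "coord n m f" "inj_on f X"
  shows "h (f ` X) = h X"
proof (cases "X = {}")
  case False
  have "h {x \<in> X. f x = a} = (0, 1)" if "a \<in> f ` X" for a
  proof -
    from that obtain x where x: "x \<in> X" "a = f x" by blast
    then have "{x \<in> X. f x = a} = {x}" using assms(3) by (auto simp: inj_on_def)
    then show ?thesis using h_singleton[of x n] x definable_subset[OF assms(1)] by auto
  qed
  from h_fib_coord[OF assms(1) False assms(2) this] show ?thesis by (auto simp: prod_eq_iff)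
qed simp

text \<open>The fibres in clause (4) consist of \<open>(n + m)\<close>-tuples that end in b.
  Deleting b is injective on each of them, so they have the same value as the fibres in the first n
  coordinates.\<close>

lemma h_fib:
  assumes Z: "definable L M (n + m) Z" and Y: "definable L M m Y" "Y \<noteq> {}" "\<forall>z\<in>Z. drop n z \<in> Y"
    and fib: "\<forall>b\<in>Y. h {a \<in> U n. a @ b \<in> Z} = (d, r)" and "r > 0"
  shows "h Z = (fst (h Y) + d, r * snd (h Y))"
proof -
  \<comment> \<open>An empty fibre would have the value \<open>(0, 0)\<close>, against
    \<open>r > 0\<close>. Hence the projection is onto Y, as clause (4) requires.\<close>
  have ne: "\<exists>a\<in>U n. a @ b \<in> Z" if "b \<in> Y" for b
  proof (rule ccontr)
    assume "\<not> ?thesis"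
    then have "{a \<in> U n. a @ b \<in> Z} = {}" by blast
    then have "h {} = (d, r)" using fib that by metis
    then show False using h_empty \<open>r > 0\<close> by simp
  qed
  then have "Z \<noteq> {}" using Y by blast
  have im: "drop n ` Z = Y"
  proof
    show "Y \<subseteq> drop n ` Z"
    proof
      fix b assume "b \<in> Y"
      then obtain a where "a \<in> U n" "a @ b \<in> Z" using ne by blast
      then show "b \<in> drop n ` Z" by (intro image_eqI[of _ _ "a @ b"]) (simp_all add: in_nlists)
    qed
  qed (use Y in blast)
  have "h {z \<in> Z. drop n z = b} = (d, r)" if "b \<in> Y" for b
  proof -
    have b: "b \<in> U m" using that definable_subset[OF Y(1)] by blast
    have "definable L M (n + m) {z \<in> Z. drop n z \<in> {b}}"
      by (intro definable_drop Z definable_singleton b)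
    then have F: "definable L M (n + m) {z \<in> Z. drop n z = b}" by simp
    have "h (take n ` {z \<in> Z. drop n z = b}) = h {z \<in> Z. drop n z = b}"
    proof (rule h_inj[OF F])
      show "coord (n + m) n (take n)" by (intro coord_intros) simp
      show "inj_on (take n) {z \<in> Z. drop n z = b}"
        by (rule inj_onI) (metis (mono_tags, lifting) append_take_drop_id mem_Collect_eq)
    qed
    moreover have "take n ` {z \<in> Z. drop n z = b} = {a \<in> U n. a @ b \<in> Z}"
    proof
      show "take n ` {z \<in> Z. drop n z = b} \<subseteq> {a \<in> U n. a @ b \<in> Z}"
        using definable_subset[OF Z] by (auto intro: take_in_nlists)
      show "{a \<in> U n. a @ b \<in> Z} \<subseteq> take n ` {z \<in> Z. drop n z = b}"
      proof
        fix x assume "x \<in> {a \<in> U n. a @ b \<in> Z}"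
        then show "x \<in> take n ` {z \<in> Z. drop n z = b}"
          by (intro image_eqI[of _ _ "x @ b"]) (simp_all add: in_nlists)
      qed
    qed
    ultimately have "h {z \<in> Z. drop n z = b} = h {a \<in> U n. a @ b \<in> Z}" by simp
    then show ?thesis using fib that by simp
  qed
  moreover have "coord (n + m) m (drop n)" by (intro coord_intros refl)
  ultimately show ?thesis
    using h_fib_coord[OF Z \<open>Z \<noteq> {}\<close>, of m "drop n" d r] im by simp
qed

lemma h_swap:
  assumes "definable L M (n + m) Z"
  shows "h ((\<lambda>z. drop n z @ take n z) ` Z) = h Z"
proof (rule h_inj[OF assms])
  show "coord (n + m) (m + n) (\<lambda>z. drop n z @ take n z)" by (intro coord_intros) simp_all
  show "inj_on (\<lambda>z. drop n z @ take n z) Z"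
  proof (rule inj_onI)
    fix x y assume "x \<in> Z" "y \<in> Z" and eq: "drop n x @ take n x = drop n y @ take n y"
    then have "length x = n + m" "length y = n + m"
      using definable_subset[OF assms] by (auto simp: in_nlists)
    then have "drop n x = drop n y \<and> take n x = take n y" using eq by (simp add: append_eq_append_conv)
    then show "x = y" by (metis append_take_drop_id)
  qed
qed

section \<open>Clause (1) for formulas in any number of variables\<close>

definition good :: "nat \<Rightarrow> ('a list \<Rightarrow> 'a list set) \<Rightarrow> bool" where
  "good m F \<longleftrightarrow> (\<exists>D. finite D \<and> (\<forall>b\<in>U m. h (F b) \<in> D)) \<and>
     (\<forall>p. dfn {} m (\<lambda>_ b. h (F b) = p))"

text \<open>Finitely many pairs of values occur for A and B, so each level set of F is a finite
  disjunction over the pairs that \<open>g\<close> sends to \<open>p\<close>.\<close>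

lemma good_compose:
  assumes "good m A" "good m B" "\<And>b. b \<in> U m \<Longrightarrow> h (F b) = g (h (A b)) (h (B b))"
  shows "good m F"
proof -
  obtain D where D: "finite D" "\<And>b. b \<in> U m \<Longrightarrow> h (A b) \<in> D"
    using assms(1) unfolding good_def by blast
  obtain E where E: "finite E" "\<And>b. b \<in> U m \<Longrightarrow> h (B b) \<in> E"
    using assms(2) unfolding good_def by blast
  have "dfn {} m (\<lambda>_ b. \<exists>x\<in>D. \<exists>y\<in>E. (h (A b) = x \<and> h (B b) = y) \<and> g x y = p)" for p
    using assms(1,2) unfolding good_def
    by (intro dfn_finite_ex dfn_and dfn_const D E) auto
  then have "dfn {} m (\<lambda>_ b. h (F b) = p)" for p
    by (rule dfn_cong) (use D E assms(3) in auto)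
  moreover have "finite (case_prod g ` (D \<times> E))" using D E by simp
  moreover have "h (F b) \<in> case_prod g ` (D \<times> E)" if "b \<in> U m" for b
    using D E assms(3) that by force
  ultimately show ?thesis unfolding good_def by blast
qed

text \<open>Clause (1) itself. It supplies formulas only for \<open>p \<in> D\<close>; any other
  \<open>p\<close> is never attained and has the empty level set.\<close>

lemma good_unary:
  assumes "dfn {} (1 + m) (\<lambda>_ as. Q (take 1 as) (drop 1 as))"
  shows "good m (\<lambda>b. {a \<in> U 1. Q a b})"
proof -
  from assms obtain cs \<phi> where cs: "set cs \<subseteq> ({} :: (unit \<Rightarrow> 'a) set)" "\<phi> \<in> forms L (1 + m + length cs)"
    "\<And>i as. as \<in> U (1 + m) \<Longrightarrow> Q (take 1 as) (drop 1 as) \<longleftrightarrow> holds M \<phi> (as @ map (\<lambda>c. c i) cs)"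
    by (rule dfnE) blast
  then have \<phi>: "\<phi> \<in> forms L (1 + m)" "\<And>as. as \<in> U (1 + m) \<Longrightarrow> Q (take 1 as) (drop 1 as) \<longleftrightarrow> holds M \<phi> as"
    by auto
  have Q: "{a \<in> U 1. Q a b} = inst M 1 \<phi> b" if "b \<in> U m" for b
  proof -
    have "Q a b \<longleftrightarrow> holds M \<phi> (a @ b)" if "a \<in> U 1" for a
      using \<phi>(2)[OF nlists_appendI[OF that \<open>b \<in> U m\<close>]] that by (simp add: in_nlists)
    then show ?thesis by (auto simp: inst_def)
  qed
  have "\<forall>m. \<forall>\<phi>\<in>forms L (1 + m). \<exists>D \<psi>.
        finite D \<and> D \<subseteq> ms_values \<and> (\<forall>p\<in>D. \<psi> p \<in> forms L m) \<and>
        (\<forall>b\<in>nlists m (univ M).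
           (\<exists>!p. p \<in> D \<and> holds M (\<psi> p) b) \<and>
           (\<forall>p\<in>D. holds M (\<psi> p) b \<longleftrightarrow> h (inst M 1 \<phi> b) = p))"
    using ms unfolding ms_measuring_def by (elim conjE) assumption
  from this[rule_format, OF \<phi>(1)] obtain D \<psi> where D: "finite D" "\<forall>p\<in>D. \<psi> p \<in> forms L m"
    "\<And>b. b \<in> U m \<Longrightarrow> \<exists>!p. p \<in> D \<and> holds M (\<psi> p) b"
    "\<And>b p. b \<in> U m \<Longrightarrow> p \<in> D \<Longrightarrow> holds M (\<psi> p) b \<longleftrightarrow> h (inst M 1 \<phi> b) = p"
    by auto
  have inD: "h (inst M 1 \<phi> b) \<in> D" if "b \<in> U m" for b
    using D(3,4)[OF that] by blast
  have "dfn {} m (\<lambda>_ b. h {a \<in> U 1. Q a b} = p)" for p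
  proof (cases "p \<in> D")
    case True
    show ?thesis by (rule dfn_cong[OF dfn_holds[of "\<psi> p"]]) (use D True Q in auto)
  next
    case False
    show ?thesis by (rule dfn_cong[OF dfn_const[of _ _ False]]) (use inD Q False in auto)
  qed
  with D(1) inD Q show ?thesis unfolding good_def by auto
qed

text \<open>The value of a set fibred over a base of value \<open>y\<close> with all fibres of value
  \<open>q\<close>. The first branch is the empty base.\<close>

definition tens :: "nat \<times> real \<Rightarrow> nat \<times> real \<Rightarrow> nat \<times> real" where
  "tens q y = (if snd y = 0 then (0, 0) else (fst y + fst q, snd q * snd y))"

text \<open>Fibre the set over its last n coordinates and sort the fibres by their values.\<close>

lemma good_all:
  "dfn {} (n + m) (\<lambda>_ as. Q (take n as) (drop n as)) \<Longrightarrow> good m (\<lambda>b. {a \<in> U n. Q a b})"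
proof (induction n arbitrary: m Q)
  case 0
  then have Q: "dfn {} m (\<lambda>_ b. Q [] b)" by simp
  have *: "h {a \<in> U 0. Q a b} = (if Q [] b then (0, 1) else (0, 0))" for b
  proof -
    have "{a \<in> U 0. Q a b} = (if Q [] b then {[]} else {})" by auto
    then show ?thesis using h_singleton[of "[]" 0] h_empty by simp
  qed
  have "dfn {} m (\<lambda>_ b. (Q [] b \<and> p = (0, 1)) \<or> (\<not> Q [] b \<and> p = (0, 0)))" for p :: "nat \<times> real"
    by (intro dfn_or dfn_and dfn_not dfn_const Q)
  then have "dfn {} m (\<lambda>_ b. h {a \<in> U 0. Q a b} = p)" for p
    by (rule dfn_cong) (auto simp only: * split: if_splits)
  moreover have "\<exists>D. finite D \<and> (\<forall>b\<in>U m. h {a \<in> U 0. Q a b} \<in> D)"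
    by (rule exI[of _ "{(0, 1), (0, 0)}"]) (simp only: *, simp)
  ultimately show ?case unfolding good_def by blast
next
  case (Suc n)
  have Qd: "dfn {} (Suc n + m) (\<lambda>_ as. Q (take (Suc n) as) (drop (Suc n) as))" by fact
  \<comment> \<open>The first coordinate is split off: \<open>W a' b\<close> is its fibre over the
    remaining n coordinates. Clause (1) applies to these fibres and the induction hypothesis to the
    sets of \<open>a'\<close> with a given fibre value.\<close>
  define W where "W a' b = {x \<in> U 1. Q (x @ a') b}" for a' b
  have "good (n + m) (\<lambda>c. {x \<in> U 1. Q (x @ take n c) (drop n c)})"
  proof (rule good_unary)
    have "dfn {} (1 + (n + m)) (\<lambda>_ as. Q (take 1 as @ take n (drop 1 as)) (drop n (drop 1 as)))"
    proof (rule dfn_comp2[OF Qd])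
      have "coord (1 + (n + m)) (1 + n) (\<lambda>as. take 1 as @ take n (drop 1 as))"
        by (intro coord_intros) auto
      then show "coord (1 + (n + m)) (Suc n) (\<lambda>as. take 1 as @ take n (drop 1 as))" by simp
      show "coord (1 + (n + m)) m (\<lambda>as. drop n (drop 1 as))"
        by (intro coord_intros) simp
    qed
    then show "dfn {} (1 + (n + m)) (\<lambda>_ as. Q (take 1 as @ take n (drop 1 as)) (drop n (drop 1 as)))" .
  qed
  then have gW: "good (n + m) (\<lambda>c. W (take n c) (drop n c))" unfolding W_def .
  then obtain D where D: "finite D" "\<And>c. c \<in> U (n + m) \<Longrightarrow> h (W (take n c) (drop n c)) \<in> D"
    unfolding good_def by blast
  have WD: "h (W a b) \<in> D" if "a \<in> U n" "b \<in> U m" for a b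
    using D(2)[OF nlists_appendI[OF that]] that by (simp add: in_nlists)
  define Y where "Y q b = {a \<in> U n. h (W a b) = q}" for q b
  have Yd: "dfn {} (n + m) (\<lambda>_ c. h (W (take n c) (drop n c)) = q)" for q
    using gW unfolding good_def by blast
  have gY: "good m (Y q)" for q
    using Suc.IH[OF Yd] unfolding Y_def .
  \<comment> \<open>The part of the set that lies over base points whose fibre value is in
    \<open>E\<close>. For a single value this is computed by fibration, and the parts for different
    values are disjoint.\<close>
  define Z where "Z E b = {z \<in> U (1 + n). Q z b \<and> (\<exists>q\<in>E. drop 1 z \<in> Y q b)}" for E b
  have Ydef: "definable L M n (Y q b)" if "b \<in> U m" for q b
    unfolding Y_def by (rule definable_section[OF Yd that])
  have Q0: "definable L M (1 + n) {z \<in> U (1 + n). Q z b}" if "b \<in> U m" for b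
    using definable_section[OF Qd that] by simp
  have Zdef: "definable L M (1 + n) (Z E b)" if "b \<in> U m" "finite E" for E b
  proof -
    have "definable L M (1 + n) {z \<in> {z \<in> U (1 + n). Q z b}. drop 1 z \<in> (\<Union>q\<in>E. Y q b)}"
      by (intro definable_drop Q0 definable_UN that Ydef)
    also have "\<dots> = Z E b" by (auto simp: Z_def)
    finally show ?thesis .
  qed
  have sec: "{x \<in> U 1. x @ a \<in> Z {q} b} = W a b" if "a \<in> Y q b" for q a b
  proof -
    from that have "a \<in> U n" by (simp add: Y_def)
    then have "x @ a \<in> Z {q} b \<longleftrightarrow> Q (x @ a) b" if "x \<in> U 1" for x
      using nlists_appendI[OF that] that \<open>a \<in> Y q b\<close> by (auto simp: Z_def in_nlists)
    then show ?thesis by (auto simp: W_def)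
  qed
  have hZ: "h (Z {q} b) = tens q (h (Y q b))" if "b \<in> U m" "snd q > 0" for q b
  proof (cases "Y q b = {}")
    case True
    then have "Z {q} b = {}" by (auto simp: Z_def)
    with True show ?thesis by (simp add: h_empty tens_def)
  next
    case False
    have "h (Z {q} b) = (fst (h (Y q b)) + fst q, snd q * snd (h (Y q b)))"
      by (rule h_fib[OF Zdef Ydef False])
        (use that sec in \<open>auto simp: Z_def Y_def\<close>)
    then show ?thesis using h_pos[OF Ydef[OF that(1)] False] by (simp add: tens_def)
  qed
  have gZ1: "good m (Z {q})" if "snd q > 0" for q
    by (rule good_compose[OF gY[of q] gY[of q], where g = "\<lambda>y _. tens q y"])
      (use hZ that in auto)
  have gZ: "good m (Z E)" if "finite E" "\<forall>q\<in>E. snd q > 0" for E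
    using that
  proof (induction E rule: finite_induct)
    case empty
    have "h (Z {} b) = (0, 0)" for b by (simp add: Z_def h_empty)
    then show ?case unfolding good_def by (auto intro!: dfn_const)
  next
    case (insert q E)
    show ?case
    proof (rule good_compose[where g = comb])
      show "good m (Z {q})" using gZ1 insert by simp
      show "good m (Z E)" using insert by simp
      fix b assume b: "b \<in> U m"
      have "Z (insert q E) b = Z {q} b \<union> Z E b" by (auto simp: Z_def)
      moreover have "Z {q} b \<inter> Z E b = {}"
        using insert by (auto simp: Z_def Y_def)
      ultimately show "h (Z (insert q E) b) = comb (h (Z {q} b)) (h (Z E b))"
        using h_Un[of "1 + n" "Z {q} b" "Z E b"] Zdef[OF b] insert by simp
    qed
  qed
  \<comment> \<open>Values of measure 0 may be discarded, as \<open>h_fib\<close> demands: a point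
    of the set lies in its own fibre, which is therefore non-empty and has positive measure.\<close>
  have "Z {q \<in> D. snd q > 0} b = {a \<in> U (Suc n). Q a b}" if b: "b \<in> U m" for b
  proof -
    have "\<exists>q\<in>{q \<in> D. snd q > 0}. drop 1 z \<in> Y q b" if z: "z \<in> U (1 + n)" "Q z b" for z
    proof -
      from z(1) obtain x a where xa: "z = x @ a" "x \<in> U 1" "a \<in> U n" by (rule nlists_split)
      have "definable L M 1 (W a b)"
      proof -
        have "definable L M 1 {x \<in> U 1. x @ a \<in> {z \<in> U (1 + n). Q z b}}"
        proof (rule definable_Collect, 
            rule dfn_section[where m = n and b = a and Q = "\<lambda>x a. x @ a \<in> {z \<in> U (1 + n). Q z b}"])
          show "dfn (kset (univ M)) (1 + n) (\<lambda>_ as. take 1 as @ drop 1 as \<in> {z \<in> U (1 + n). Q z b})"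
            unfolding append_take_drop_id by (rule dfn_mem_id[OF Q0[OF b]])
        qed (use xa in auto)
        also have "{x \<in> U 1. x @ a \<in> {z \<in> U (1 + n). Q z b}} = W a b"
          using xa by (auto simp: W_def in_nlists)
        finally show ?thesis .
      qed
      moreover have "x \<in> W a b" using xa z by (simp add: W_def)
      ultimately have "snd (h (W a b)) > 0" by (intro h_pos) auto
      then show ?thesis
        using WD[OF xa(3) b] xa by (intro bexI[of _ "h (W a b)"]) (auto simp: Y_def in_nlists)
    qed
    then show ?thesis by (auto simp: Z_def)
  qed
  then have eq: "h {a \<in> U (Suc n). Q a b} = h (Z {q \<in> D. snd q > 0} b)" if "b \<in> U m" for b
    using that by simp
  have "good m (Z {q \<in> D. snd q > 0})" by (rule gZ) (use D in auto)
  from good_compose[OF this this, where g = "\<lambda>x _. x", OF eq] show ?case .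
qed

lemma ms_struct: "ms_struct L M h"
proof unfold_locales
  fix \<phi> and n m :: nat assume \<phi>: "\<phi> \<in> forms L (n + m)"
  have "dfn {} (n + m) (\<lambda>_ as. holds M \<phi> (take n as @ drop n as))"
    using dfn_holds[OF \<phi>] by simp
  then have g: "good m (inst M n \<phi>)"
    unfolding inst_def by (rule good_all)
  then show "\<exists>D. finite D \<and> (\<forall>b\<in>U m. h (inst M n \<phi> b) \<in> D)"
    unfolding good_def by blast
  fix p
  have "dfn {} m (\<lambda>_ b. h (inst M n \<phi> b) = p)" using g unfolding good_def by blast
  then show "\<exists>\<psi>\<in>forms L m. \<forall>b\<in>U m. holds M \<psi> b \<longleftrightarrow> h (inst M n \<phi> b) = p"
    by (rule dfnE) auto
next
  show "h {} = (0, 0)" by (rule h_empty)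
  show "0 < snd (h X)" if "definable L M n X" "X \<noteq> {}" for n X using that by (rule h_pos)
  show "h (X \<union> Y) = comb (h X) (h Y)"
    if "definable L M n X" "definable L M n Y" "X \<inter> Y = {}" for n X Y using that by (rule h_Un)
  show "h ((\<lambda>z. drop n z @ take n z) ` Z) = h Z" if "definable L M (n + m) Z" for n m Z
    using that by (rule h_swap)
  show "h Z = (fst (h Y) + d, r * snd (h Y))"
    if "definable L M (n + m) Z" "definable L M m Y" "Y \<noteq> {}" "\<forall>z\<in>Z. drop n z \<in> Y"
      "\<forall>b\<in>Y. h {a \<in> U n. a @ b \<in> Z} = (d, r)" "r > 0" for n m Z Y d r
    using that by (rule h_fib)
qed

end

section \<open>Passing to an elementary extension\<close>

locale ms_extension =
  fixes L :: "('f, 'r) lang" and M N :: "('f, 'r, 'a) struct" and h :: "'a list set \<Rightarrow> nat \<times> real"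
  assumes ext: "elem_extension L M N" and ms_measuring: "ms_measuring L M h"
begin

abbreviation st :: "bool \<Rightarrow> ('f, 'r, 'a) struct" where
  "st i \<equiv> if i then M else N"

abbreviation H :: "'a list set \<Rightarrow> nat \<times> real" where
  "H \<equiv> ext_measuring L M h N"

abbreviation hh :: "bool \<Rightarrow> 'a list set \<Rightarrow> nat \<times> real" where
  "hh i \<equiv> if i then h else H"

sublocale structs L st
  by unfold_locales (use ext in \<open>auto simp: elem_extension_def\<close>)

sublocale M: ms_struct L M h
  by (rule ms_measuring_struct.ms_struct, unfold_locales)
    (use ext ms_measuring in \<open>auto simp: elem_extension_def\<close>)

sublocale N: single L N
  by unfold_locales (use ext in \<open>auto simp: elem_extension_def\<close>)

text \<open>The existence of a tuple with the property P is expressed by a sentence, and M and N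
  satisfy the same sentences. To prove a clause for N, the whole configuration is described by P,
  including the values that it takes; a copy of it in M then obeys the clause for
  \<open>h\<close>.\<close>

lemma transfer:
  assumes "dfn {} m P" "e \<in> nlists m (univ N)" "P False e"
  obtains e' where "e' \<in> nlists m (univ M)" "P True e'"
proof -
  have "dfn {} 0 (\<lambda>i as. \<exists>e\<in>nlists m (univ (st i)). P i e)"
    by (rule dfn_bex) (use assms(1) in simp)
  then obtain cs \<phi> where *: "set cs \<subseteq> ({} :: (bool \<Rightarrow> 'a) set)" "\<phi> \<in> forms L (0 + length cs)"
    "\<And>i as. as \<in> nlists 0 (univ (st i)) \<Longrightarrow>
       (\<exists>e\<in>nlists m (univ (st i)). P i e) \<longleftrightarrow> holds (st i) \<phi> (as @ map (\<lambda>c. c i) cs)"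
    by (rule dfnE) blast
  then have "\<phi> \<in> forms L 0" and **: "(\<exists>e\<in>nlists m (univ (st i)). P i e) \<longleftrightarrow> holds (st i) \<phi> []" for i
    by auto
  moreover have "[] \<in> nlists 0 (univ M)" by simp
  ultimately have "holds M \<phi> [] \<longleftrightarrow> holds N \<phi> []"
    using ext unfolding elem_extension_def by blast
  then show thesis using **[of True] **[of False] assms(2,3) that by auto
qed

text \<open>Justifies the description operator in \<open>ext_measuring\<close>: two presentations of
  one set in N have copies in M that again present one set, so both assign the value of that set
  under \<open>h\<close>.\<close>

lemma ext_measuring_unique:
  assumes "\<phi> \<in> forms L (n + m)" "\<psi> \<in> forms L m" "b \<in> nlists m (univ N)" "holds N \<psi> b"
    and "\<forall>c\<in>nlists m (univ M). holds M \<psi> c \<longleftrightarrow> h (inst M n \<phi> c) = p"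
    and "\<phi>' \<in> forms L (n' + m')" "\<psi>' \<in> forms L m'" "b' \<in> nlists m' (univ N)" "holds N \<psi>' b'"
    and "\<forall>c\<in>nlists m' (univ M). holds M \<psi>' c \<longleftrightarrow> h (inst M n' \<phi>' c) = p'"
    and eq: "inst N n \<phi> b = inst N n' \<phi>' b'"
  shows "p = p'"
proof -
  \<comment> \<open>The empty set does not determine the power in which it lives, so its
    presentations may differ in \<open>n\<close>. They are treated separately: a copy in M is empty
    too and has the value \<open>(0, 0)\<close>.\<close>
  have empty: "p = (0, 0)"
    if "\<phi> \<in> forms L (n + m)" "\<psi> \<in> forms L m" "b \<in> nlists m (univ N)" "holds N \<psi> b"
    "\<forall>c\<in>nlists m (univ M). holds M \<psi> c \<longleftrightarrow> h (inst M n \<phi> c) = p" "inst N n \<phi> b = {}"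
  for n m \<phi> \<psi> b p
  proof -
    note b = that(3)
    have "dfn {} (m + n) (\<lambda>i as. holds (st i) \<phi> (drop m as @ take m as))"
      by (rule dfn_comp[OF dfn_holds[OF that(1)]]) (intro coord_intros; simp)
    then have "dfn {} m (\<lambda>i c. holds (st i) \<psi> c \<and> \<not> (\<exists>a\<in>nlists n (univ (st i)). holds (st i) \<phi> (a @ c)))"
      by (intro dfn_and dfn_not dfn_bex dfn_holds[OF that(2)])
    moreover have "holds (st False) \<psi> b \<and> \<not> (\<exists>a\<in>nlists n (univ (st False)). holds (st False) \<phi> (a @ b))"
      using that(4,6) by (auto simp: inst_def)
    ultimately obtain c where c: "c \<in> nlists m (univ M)"
      "holds (st True) \<psi> c \<and> \<not> (\<exists>a\<in>nlists n (univ (st True)). holds (st True) \<phi> (a @ c))"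
      by (rule transfer[OF _ b])
    then have "inst M n \<phi> c = {}" by (auto simp: inst_def)
    then show ?thesis using c that(5) M.H_empty by auto
  qed
  show ?thesis
  proof (cases "inst N n \<phi> b = {}")
    case True
    then show ?thesis
      using empty[OF assms(1-5)] empty[OF assms(6-10)] eq by simp
  next
    case False
    then obtain a where "a \<in> inst N n \<phi> b" "a \<in> inst N n' \<phi>' b'" using eq by auto
    then have [simp]: "n' = n" by (auto simp: inst_def in_nlists)
    have 1: "dfn {} (m + m' + n) (\<lambda>i as. holds (st i) \<phi> (drop (m + m') as @ take m (take (m + m') as)))"
      by (rule dfn_comp[OF dfn_holds[OF assms(1)]]) (simp add: take_take, intro coord_intros; simp)
    have 2: "dfn {} (m + m' + n) (\<lambda>i as. holds (st i) \<phi>' (drop (m + m') as @ drop m (take (m + m') as)))"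
      by (rule dfn_comp[OF dfn_holds[OF assms(6)]]) (simp add: drop_take, intro coord_intros; simp)
    have 3: "dfn {} (m + m') (\<lambda>i c. holds (st i) \<psi> (take m c))"
      by (rule dfn_comp[OF dfn_holds[OF assms(2)]]) (intro coord_intros; simp)
    have 4: "dfn {} (m + m') (\<lambda>i c. holds (st i) \<psi>' (drop m c))"
      by (rule dfn_comp[OF dfn_holds[OF assms(7)]]) (intro coord_intros; simp)
    \<comment> \<open>The parameters of both presentations in one tuple: the two instances coincide
      and both level formulas hold.\<close>
    define P where "P = (\<lambda>i c. (\<forall>a\<in>nlists n (univ (st i)). holds (st i) \<phi> (a @ take m c) \<longleftrightarrow>
        holds (st i) \<phi>' (a @ drop m c)) \<and> holds (st i) \<psi> (take m c) \<and> holds (st i) \<psi>' (drop m c))"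
    have dP: "dfn {} (m + m') P"
      unfolding P_def by (intro dfn_and 3 4 dfn_ball dfn_iff 1 2)
    have PF: "P False (b @ b')"
    proof -
      have [simp]: "length b = m" using assms(3) by (simp add: in_nlists)
      have "holds N \<phi> (a @ b) \<longleftrightarrow> holds N \<phi>' (a @ b')" if "a \<in> nlists n (univ N)" for a
        using eq that by (auto simp: inst_def set_eq_iff)
      then show ?thesis unfolding P_def using assms(4,9) by simp
    qed
    have mem: "b @ b' \<in> nlists (m + m') (univ N)" by (intro nlists_appendI assms)
    obtain c where c: "c \<in> nlists (m + m') (univ M)" "P True c"
      by (rule transfer[OF dP mem PF]) (rule that)
    note c = c(1) c(2)[unfolded P_def]
    have cc: "take m c \<in> nlists m (univ M)" "drop m c \<in> nlists m' (univ M)"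
      using c(1) by (auto intro: take_in_nlists drop_in_nlists)
    have "inst M n \<phi> (take m c) = inst M n \<phi>' (drop m c)"
      using c(2) by (auto simp: inst_def)
    then show ?thesis
      using c(2) assms(5) assms(10) cc by auto
  qed
qed

lemma ext_measuring_eq:
  assumes "\<phi> \<in> forms L (n + m)" "\<psi> \<in> forms L m" "b \<in> nlists m (univ N)" "holds N \<psi> b"
    and "\<forall>c\<in>nlists m (univ M). holds M \<psi> c \<longleftrightarrow> h (inst M n \<phi> c) = p"
  shows "H (inst N n \<phi> b) = p"
  unfolding ext_measuring_def
proof (rule the_equality)
  show "\<exists>n' m. \<exists>\<phi>'\<in>forms L (n' + m). \<exists>\<psi>\<in>forms L m. \<exists>b'\<in>nlists m (univ N).
      inst N n \<phi> b = inst N n' \<phi>' b' \<and> holds N \<psi> b' \<and>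
      (\<forall>c\<in>nlists m (univ M). holds M \<psi> c \<longleftrightarrow> h (inst M n' \<phi>' c) = p)"
    using assms by blast
next
  fix p'
  assume "\<exists>n' m. \<exists>\<phi>'\<in>forms L (n' + m). \<exists>\<psi>\<in>forms L m. \<exists>b'\<in>nlists m (univ N).
      inst N n \<phi> b = inst N n' \<phi>' b' \<and> holds N \<psi> b' \<and>
      (\<forall>c\<in>nlists m (univ M). holds M \<psi> c \<longleftrightarrow> h (inst M n' \<phi>' c) = p')"
  then obtain n' m' \<phi>' \<psi>' b' where *: "\<phi>' \<in> forms L (n' + m')" "\<psi>' \<in> forms L m'" "b' \<in> nlists m' (univ N)"
    "inst N n \<phi> b = inst N n' \<phi>' b'" "holds N \<psi>' b'"
    "\<forall>c\<in>nlists m' (univ M). holds M \<psi>' c \<longleftrightarrow> h (inst M n' \<phi>' c) = p'"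
    by blast
  show "p' = p"
    using ext_measuring_unique[OF assms *(1-3,5,6,4)] by simp
qed

text \<open>As \<open>D\<close> is finite, it is first-order that every tuple satisfies one of the
  level formulas with \<open>p \<in> D\<close>. This passes to N, so every instance there has a
  value by \<open>ext_measuring_eq\<close>, and it lies in the same \<open>D\<close>.\<close>

lemma level_pair:
  assumes \<phi>: "\<phi> \<in> forms L (n + m)"
  obtains D \<psi> where "finite D" "\<And>p. \<psi> p \<in> forms L m"
    "\<And>b. b \<in> nlists m (univ M) \<Longrightarrow> h (inst M n \<phi> b) \<in> D"
    "\<And>b. b \<in> nlists m (univ N) \<Longrightarrow> H (inst N n \<phi> b) \<in> D"
    "\<And>b p. b \<in> nlists m (univ M) \<Longrightarrow> holds M (\<psi> p) b \<longleftrightarrow> h (inst M n \<phi> b) = p"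
    "\<And>b p. b \<in> nlists m (univ N) \<Longrightarrow> holds N (\<psi> p) b \<longleftrightarrow> H (inst N n \<phi> b) = p"
proof -
  obtain D where D: "finite D" "\<And>b. b \<in> nlists m (univ M) \<Longrightarrow> h (inst M n \<phi> b) \<in> D"
    using M.values_finite[OF \<phi>] by blast
  have "\<forall>p. \<exists>\<psi>\<in>forms L m. \<forall>b\<in>nlists m (univ M). holds M \<psi> b \<longleftrightarrow> h (inst M n \<phi> b) = p"
    using M.level_single[OF \<phi>] by blast
  then obtain \<psi> where \<psi>: "\<And>p. \<psi> p \<in> forms L m"
    "\<And>b p. b \<in> nlists m (univ M) \<Longrightarrow> holds M (\<psi> p) b \<longleftrightarrow> h (inst M n \<phi> b) = p"
    by metis
  have ex: "\<exists>p\<in>D. holds N (\<psi> p) b" if b: "b \<in> nlists m (univ N)" for b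
  proof (rule ccontr)
    assume *: "\<not> ?thesis"
    have "dfn {} m (\<lambda>i b. \<not> (\<exists>p\<in>D. holds (st i) (\<psi> p) b))"
      by (intro dfn_not dfn_finite_ex D dfn_holds \<psi>)
    then obtain c where "c \<in> nlists m (univ M)" "\<not> (\<exists>p\<in>D. holds (st True) (\<psi> p) c)"
      by (rule transfer[OF _ b]) (use * in auto)
    then show False using \<psi>(2) D(2) by auto
  qed
  have val: "H (inst N n \<phi> b) = p" if "b \<in> nlists m (univ N)" "holds N (\<psi> p) b" for b p
    by (rule ext_measuring_eq[OF \<phi> \<psi>(1) that]) (use \<psi>(2) in auto)
  show thesis
  proof
    show "H (inst N n \<phi> b) \<in> D" if "b \<in> nlists m (univ N)" for b
      using ex[OF that] val[OF that] by auto
    show "holds N (\<psi> p) b \<longleftrightarrow> H (inst N n \<phi> b) = p" if "b \<in> nlists m (univ N)" for b p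
      using ex[OF that] val[OF that] by metis
  qed (use D \<psi> in auto)
qed

sublocale ms_family L st hh
proof unfold_locales
  fix \<phi> and n m :: nat and p
  assume "\<phi> \<in> forms L (n + m)"
  then obtain D \<psi> where "\<And>p. \<psi> p \<in> forms L m"
    "\<And>b p. b \<in> nlists m (univ M) \<Longrightarrow> holds M (\<psi> p) b \<longleftrightarrow> h (inst M n \<phi> b) = p"
    "\<And>b p. b \<in> nlists m (univ N) \<Longrightarrow> holds N (\<psi> p) b \<longleftrightarrow> H (inst N n \<phi> b) = p"
    by (rule level_pair) blast
  then show "\<exists>\<psi>\<in>forms L m. \<forall>i. \<forall>b\<in>nlists m (univ (st i)).
      holds (st i) \<psi> b \<longleftrightarrow> hh i (inst (st i) n \<phi> b) = p"
    by (intro bexI[of _ "\<psi> p"]) auto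
qed

lemma dfn_hh:
  assumes "\<phi> \<in> forms L k" "coord (n + m) k (\<lambda>as. f (take n as) (drop n as))"
  shows "dfn {} m (\<lambda>i b. hh i {a \<in> nlists n (univ (st i)). holds (st i) \<phi> (f a b)} = p)"
  by (rule dfn_level, rule dfn_comp[OF dfn_holds[OF assms(1)] assms(2)]) simp

lemma definableN:
  assumes "definable L N n X"
  obtains m \<phi> b where "\<phi> \<in> forms L (n + m)" "b \<in> nlists m (univ N)"
    "X = {a \<in> nlists n (univ N). holds N \<phi> (a @ b)}"
  using assms unfolding definable_over_def inst_def by blast

lemma definableM:
  assumes "\<phi> \<in> forms L (n + m)" "b \<in> nlists m (univ M)"
  shows "definable L M n {a \<in> nlists n (univ M). holds M \<phi> (a @ b)}"
  using assms unfolding definable_over_def inst_def by blast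

section \<open>The clauses for the induced value on N\<close>

lemma HN_pos:
  assumes "definable L N n X" "X \<noteq> {}"
  shows "snd (H X) > 0"
proof -
  obtain m \<phi> b where X: "\<phi> \<in> forms L (n + m)" "b \<in> nlists m (univ N)"
    "X = {a \<in> nlists n (univ N). holds N \<phi> (a @ b)}"
    using assms(1) by (rule definableN)
  \<comment> \<open>The pair \<open>H X\<close> enters as the constant of a level set. In the copy
    in M it becomes the value under \<open>h\<close>, so a fact about \<open>h\<close> there is a
    fact about this very pair. The next three lemmas use the same device.\<close>
  let ?P = "\<lambda>i b. (\<exists>a\<in>nlists n (univ (st i)). holds (st i) \<phi> (a @ b)) \<and>
    hh i {a \<in> nlists n (univ (st i)). holds (st i) \<phi> (a @ b)} = H X"
  have "dfn {} (m + n) (\<lambda>i as. holds (st i) \<phi> (drop m as @ take m as))"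
    by (rule dfn_comp[OF dfn_holds[OF X(1)]]) (intro coord_intros; simp)
  moreover have "coord (n + m) (n + m) (\<lambda>as. take n as @ drop n as)" by (simp add: coord_id)
  ultimately have "dfn {} m ?P"
    by (intro dfn_and dfn_bex dfn_hh[OF X(1)])
  then obtain c where c: "c \<in> nlists m (univ M)" "?P True c"
    by (rule transfer[OF _ X(2)]) (use X assms(2) in auto)
  then show ?thesis
    using M.H_pos[OF definableM[OF X(1) c(1)]] by auto
qed

lemma HN_Un:
  assumes "definable L N n X" "definable L N n Y" "X \<inter> Y = {}"
  shows "H (X \<union> Y) = comb (H X) (H Y)"
proof -
  obtain m \<phi> b where X: "\<phi> \<in> forms L (n + m)" "b \<in> nlists m (univ N)"
    "X = {a \<in> nlists n (univ N). holds N \<phi> (a @ b)}"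
    using assms(1) by (rule definableN)
  obtain m' \<phi>' b' where Y: "\<phi>' \<in> forms L (n + m')" "b' \<in> nlists m' (univ N)"
    "Y = {a \<in> nlists n (univ N). holds N \<phi>' (a @ b')}"
    using assms(2) by (rule definableN)
  let ?A = "\<lambda>i e. {a \<in> nlists n (univ (st i)). holds (st i) \<phi> (a @ take m e)}"
  let ?B = "\<lambda>i e. {a \<in> nlists n (univ (st i)). holds (st i) \<phi>' (a @ drop m e)}"
  let ?C = "\<lambda>i e. {a \<in> nlists n (univ (st i)). holds (st i) \<phi> (a @ take m e) \<or> holds (st i) \<phi>' (a @ drop m e)}"
  define P where "P = (\<lambda>i e. (\<not> (\<exists>a\<in>nlists n (univ (st i)). holds (st i) \<phi> (a @ take m e) \<and> holds (st i) \<phi>' (a @ drop m e))) \<and>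
    hh i (?A i e) = H X \<and> hh i (?B i e) = H Y \<and> hh i (?C i e) = H (X \<union> Y))"
  have 1: "dfn {} (m + m' + n) (\<lambda>i as. holds (st i) \<phi> (drop (m + m') as @ take m (take (m + m') as)))"
    by (rule dfn_comp[OF dfn_holds[OF X(1)]]) (simp add: take_take, intro coord_intros; simp)
  have 2: "dfn {} (m + m' + n) (\<lambda>i as. holds (st i) \<phi>' (drop (m + m') as @ drop m (take (m + m') as)))"
    by (rule dfn_comp[OF dfn_holds[OF Y(1)]]) (simp add: drop_take, intro coord_intros; simp)
  have c1: "coord (n + (m + m')) (n + m) (\<lambda>as. take n as @ take m (drop n as))"
    by (intro coord_intros; simp)
  have c2: "coord (n + (m + m')) (n + m') (\<lambda>as. take n as @ drop m (drop n as))"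
    by (intro coord_intros; simp)
  have 3: "dfn {} (m + m') (\<lambda>i e. hh i (?C i e) = H (X \<union> Y))"
    by (rule dfn_level, rule dfn_or) (rule dfn_comp[OF dfn_holds] X Y c1 c2 | simp)+
  have dP: "dfn {} (m + m') P"
    unfolding P_def by (intro dfn_and dfn_not dfn_bex dfn_hh[OF X(1)] dfn_hh[OF Y(1)] 1 2 3 c1 c2)
  have PF: "P False (b @ b')"
  proof -
    have [simp]: "length b = m" using X(2) by (simp add: in_nlists)
    have "?C False (b @ b') = X \<union> Y" by (auto simp: X(3) Y(3))
    then show ?thesis unfolding P_def using assms(3) X(3) Y(3) by auto
  qed
  have mem: "b @ b' \<in> nlists (m + m') (univ N)" by (intro nlists_appendI X Y)
  obtain e where e: "e \<in> nlists (m + m') (univ M)" "P True e"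
    by (rule transfer[OF dP mem PF]) (rule that)
  note e = e(1) e(2)[unfolded P_def]
  have "take m e \<in> nlists m (univ M)" "drop m e \<in> nlists m' (univ M)"
    using e(1) by (auto intro: take_in_nlists drop_in_nlists)
  then have "h (?A True e \<union> ?B True e) = comb (h (?A True e)) (h (?B True e))"
    using e(2) definableM[OF X(1), of "take m e"] definableM[OF Y(1), of "drop m e"]
    by (intro M.H_Un) auto
  moreover have "?A True e \<union> ?B True e = ?C True e" by auto
  ultimately show ?thesis using e(2) by simp
qed

lemma HN_fib:
  assumes Z: "definable L N (n + m) Z" and Y: "definable L N m Y" "Y \<noteq> {}" "\<forall>z\<in>Z. drop n z \<in> Y"
    and fib: "\<forall>b\<in>Y. H {a \<in> nlists n (univ N). a @ b \<in> Z} = (d, r)" and "r > 0"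
  shows "H Z = (fst (H Y) + d, r * snd (H Y))"
proof -
  obtain k \<zeta> u where Z': "\<zeta> \<in> forms L (n + m + k)" "u \<in> nlists k (univ N)"
    "Z = {a \<in> nlists (n + m) (univ N). holds N \<zeta> (a @ u)}"
    using Z by (rule definableN)
  obtain l \<upsilon> v where Y': "\<upsilon> \<in> forms L (m + l)" "v \<in> nlists l (univ N)"
    "Y = {a \<in> nlists m (univ N). holds N \<upsilon> (a @ v)}"
    using Y(1) by (rule definableN)
  let ?Z = "\<lambda>i e. {z \<in> nlists (n + m) (univ (st i)). holds (st i) \<zeta> (z @ take k e)}"
  let ?Y = "\<lambda>i e. {b \<in> nlists m (univ (st i)). holds (st i) \<upsilon> (b @ drop k e)}"
  \<comment> \<open>All hypotheses of the fibration clause, with both values recorded. Constancy of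
    the fibre value is first-order because the level set of \<open>(d, r)\<close> is definable
    uniformly in M and N.\<close>
  define P where "P = (\<lambda>i e. (\<exists>b\<in>nlists m (univ (st i)). holds (st i) \<upsilon> (b @ drop k e)) \<and>
    (\<forall>z\<in>nlists (n + m) (univ (st i)). holds (st i) \<zeta> (z @ take k e) \<longrightarrow> holds (st i) \<upsilon> (drop n z @ drop k e)) \<and>
    (\<forall>b\<in>nlists m (univ (st i)). holds (st i) \<upsilon> (b @ drop k e) \<longrightarrow>
       hh i {a \<in> nlists n (univ (st i)). holds (st i) \<zeta> ((a @ b) @ take k e)} = (d, r)) \<and>
    hh i (?Z i e) = H Z \<and> hh i (?Y i e) = H Y)"
  have 1: "dfn {} (k + l + m) (\<lambda>i as. holds (st i) \<upsilon> (drop (k + l) as @ drop k (take (k + l) as)))"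
    by (rule dfn_comp[OF dfn_holds[OF Y'(1)]]) (simp add: drop_take, intro coord_intros; simp)
  have 2: "dfn {} (k + l + (n + m)) (\<lambda>i as. holds (st i) \<zeta> (drop (k + l) as @ take k (take (k + l) as)))"
    by (rule dfn_comp[OF dfn_holds[OF Z'(1)]]) (simp add: take_take, intro coord_intros; simp)
  have 3: "dfn {} (k + l + (n + m)) (\<lambda>i as. holds (st i) \<upsilon> (drop n (drop (k + l) as) @ drop k (take (k + l) as)))"
    by (rule dfn_comp[OF dfn_holds[OF Y'(1)]]) (simp only: drop_take diff_add_inverse, intro coord_intros; simp)
  have 4: "dfn {} (k + l + m) (\<lambda>i as. hh i {a \<in> nlists n (univ (st i)).
      holds (st i) \<zeta> ((a @ drop (k + l) as) @ take k (take (k + l) as))} = (d, r))"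
    by (rule dfn_hh[OF Z'(1)]) (simp only: take_take min_absorb1 le_add1, intro coord_intros; simp)
  have 5: "coord (n + m + (k + l)) (n + m + k) (\<lambda>as. take (n + m) as @ take k (drop (n + m) as))"
    by (intro coord_intros; simp)
  have 6: "coord (m + (k + l)) (m + l) (\<lambda>as. take m as @ drop k (drop m as))"
    by (intro coord_intros; simp)
  have dP: "dfn {} (k + l) P"
    unfolding P_def by (intro dfn_and dfn_bex dfn_ball dfn_imp 1 2 3 4 dfn_hh[OF Z'(1)] dfn_hh[OF Y'(1)] 5 6)
  have PF: "P False (u @ v)"
  proof -
    have [simp]: "length u = k" using Z'(2) by (simp add: in_nlists)
    have *: "{a \<in> nlists n (univ N). holds N \<zeta> ((a @ b) @ u)} = {a \<in> nlists n (univ N). a @ b \<in> Z}"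
      if "b \<in> nlists m (univ N)" for b
      using that by (auto simp: Z'(3) in_nlists)
    have "(\<forall>z\<in>nlists (n + m) (univ N). holds N \<zeta> (z @ u) \<longrightarrow> holds N \<upsilon> (drop n z @ v))"
      using Y(3) by (auto simp: Z'(3) Y'(3))
    moreover have "\<exists>b\<in>nlists m (univ N). holds N \<upsilon> (b @ v)"
      using Y(2) by (auto simp: Y'(3))
    moreover have "\<forall>b\<in>nlists m (univ N). holds N \<upsilon> (b @ v) \<longrightarrow>
        H {a \<in> nlists n (univ N). holds N \<zeta> ((a @ b) @ u)} = (d, r)"
      using fib * by (auto simp: Y'(3))
    ultimately show ?thesis unfolding P_def by (simp add: Z'(3)[symmetric] Y'(3)[symmetric])
  qed
  have mem: "u @ v \<in> nlists (k + l) (univ N)" by (intro nlists_appendI Z' Y')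
  obtain e where e: "e \<in> nlists (k + l) (univ M)" "P True e"
    by (rule transfer[OF dP mem PF]) (rule that)
  note e = e(1) e(2)[unfolded P_def]
  have ee: "take k e \<in> nlists k (univ M)" "drop k e \<in> nlists l (univ M)"
    using e(1) by (auto intro: take_in_nlists drop_in_nlists)
  have "h (?Z True e) = (fst (h (?Y True e)) + d, r * snd (h (?Y True e)))"
  proof (rule M.H_fib)
    show "definable L M (n + m) (?Z True e)" using definableM[OF Z'(1) ee(1)] by simp
    show "definable L M m (?Y True e)" using definableM[OF Y'(1) ee(2)] by simp
    show "?Y True e \<noteq> {}" using e(2) by auto
    show "\<forall>z\<in>?Z True e. drop n z \<in> ?Y True e" using e(2) by (auto intro: drop_in_nlists)
    show "\<forall>b\<in>?Y True e. h {a \<in> nlists n (univ M). a @ b \<in> ?Z True e} = (d, r)"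
    proof
      fix b assume b: "b \<in> ?Y True e"
      then have "{a \<in> nlists n (univ M). a @ b \<in> ?Z True e} =
          {a \<in> nlists n (univ M). holds M \<zeta> ((a @ b) @ take k e)}"
        by (auto simp: in_nlists)
      then show "h {a \<in> nlists n (univ M). a @ b \<in> ?Z True e} = (d, r)" using e(2) b by simp
    qed
  qed fact
  moreover have "h (?Z True e) = H Z" "h (?Y True e) = H Y" using e(2) by simp_all
  ultimately show ?thesis by simp
qed

text \<open>Writes the swapped set as the solution set of a condition again, so that its value can
  be one of the transferred level conditions.\<close>

lemma swap_Collect:
  "(\<lambda>z. drop n z @ take n z) ` {z \<in> nlists (n + m) A. R z} =
     {y \<in> nlists (m + n) A. R (drop m y @ take m y)}"
proof
  show "(\<lambda>z. drop n z @ take n z) ` {z \<in> nlists (n + m) A. R z} \<subseteq>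
     {y \<in> nlists (m + n) A. R (drop m y @ take m y)}"
    by (auto simp: in_nlists dest!: in_set_takeD in_set_dropD)
next
  show "{y \<in> nlists (m + n) A. R (drop m y @ take m y)} \<subseteq>
    (\<lambda>z. drop n z @ take n z) ` {z \<in> nlists (n + m) A. R z}"
  proof
    fix y assume "y \<in> {y \<in> nlists (m + n) A. R (drop m y @ take m y)}"
    then have y: "y \<in> nlists (m + n) A" "R (drop m y @ take m y)" by auto
    from y(1) obtain b a where "y = b @ a" "b \<in> nlists m A" "a \<in> nlists n A" by (rule nlists_split)
    then show "y \<in> (\<lambda>z. drop n z @ take n z) ` {z \<in> nlists (n + m) A. R z}"
      using y by (intro image_eqI[of _ _ "a @ b"]) (auto simp: in_nlists)
  qed
qed

lemma HN_swap:
  assumes "definable L N (n + m) Z"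
  shows "H ((\<lambda>z. drop n z @ take n z) ` Z) = H Z"
proof -
  obtain k \<zeta> u where Z: "\<zeta> \<in> forms L (n + m + k)" "u \<in> nlists k (univ N)"
    "Z = {a \<in> nlists (n + m) (univ N). holds N \<zeta> (a @ u)}"
    using assms by (rule definableN)
  let ?Z = "\<lambda>i e. {z \<in> nlists (n + m) (univ (st i)). holds (st i) \<zeta> (z @ e)}"
  let ?Y = "\<lambda>i e. {y \<in> nlists (m + n) (univ (st i)). holds (st i) \<zeta> ((drop m y @ take m y) @ e)}"
  let ?s = "\<lambda>z. drop n z @ take n z"
  have 1: "coord (n + m + k) (n + m + k) (\<lambda>as. take (n + m) as @ drop (n + m) as)"
    by (simp add: coord_id)
  have 2: "coord (m + n + k) (n + m + k)
      (\<lambda>as. (drop m (take (m + n) as) @ take m (take (m + n) as)) @ drop (m + n) as)"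
    by (simp only: take_take drop_take diff_add_inverse min_absorb1 le_add1, intro coord_intros; simp)
  have "dfn {} k (\<lambda>i e. hh i (?Z i e) = H Z \<and> hh i (?Y i e) = H (?s ` Z))"
    by (intro dfn_and dfn_hh[OF Z(1)] 1 2)
  moreover have "hh False (?Z False u) = H Z \<and> hh False (?Y False u) = H (?s ` Z)"
    using Z(3) swap_Collect[of n m "univ N" "\<lambda>z. holds N \<zeta> (z @ u)"] by auto
  ultimately obtain e where e: "e \<in> nlists k (univ M)"
    "hh True (?Z True e) = H Z \<and> hh True (?Y True e) = H (?s ` Z)"
    by (rule transfer[OF _ Z(2)])
  have "h (?s ` ?Z True e) = h (?Z True e)"
    using M.H_swap[OF definableM[OF Z(1) e(1)]] by simp
  moreover have "?s ` ?Z True e = ?Y True e"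
    using swap_Collect[of n m "univ M" "\<lambda>z. holds M \<zeta> (z @ e)"] by simp
  ultimately show ?thesis using e(2) by (simp del: append_assoc)
qed

lemma ms_struct_extension: "ms_struct L N H"
proof unfold_locales
  fix \<phi> and n m :: nat assume \<phi>: "\<phi> \<in> forms L (n + m)"
  show "\<exists>D. finite D \<and> (\<forall>b\<in>nlists m (univ N). H (inst N n \<phi> b) \<in> D)"
    using \<phi> by (rule level_pair) blast
  show "\<exists>\<psi>\<in>forms L m. \<forall>b\<in>nlists m (univ N). holds N \<psi> b \<longleftrightarrow> H (inst N n \<phi> b) = p" for p
    using \<phi> by (rule level_pair) blast
next
  have "H (inst N 0 Falsum []) = (0, 0)"
    by (rule ext_measuring_eq[of _ _ 0 "Neg Falsum"]) (auto simp: forms_def inst_def M.H_empty)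
  then show "H {} = (0, 0)" by (simp add: inst_def)
qed (fact HN_pos HN_Un HN_fib HN_swap)+

text \<open>Carries the dimension bound from M to N: the full power is presented by a true formula,
  with a true level formula and no parameters.\<close>

lemma ext_measuring_univ: "H (nlists n (univ N)) = h (nlists n (univ M))"
proof -
  have "H (inst N n (Neg Falsum) []) = h (nlists n (univ M))"
    by (rule ext_measuring_eq[of _ _ 0 "Neg Falsum"]) (auto simp: forms_def inst_def)
  then show ?thesis by (simp add: inst_def)
qed

end

section \<open>The measures attached to definable sets\<close>

abbreviation prodset :: "'a list set \<Rightarrow> 'a list set \<Rightarrow> 'a list set" where
  "prodset X Y \<equiv> {a @ b | a b. a \<in> X \<and> b \<in> Y}"

context ms_struct
begin

text \<open>The mu_B-measure of a subset of B depends only on the value of the subset; this is the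
  resulting function of the value.\<close>

definition rat :: "'a list set \<Rightarrow> nat \<times> real \<Rightarrow> real" where
  "rat B p = (if fst p = fst (H B) then snd p / snd (H B) else 0)"

abbreviation keis :: "'a list set \<Rightarrow> 'a list set \<Rightarrow> real" where
  "keis \<equiv> ms_keisler H"

lemma keis_eq: "keis B X = rat B (H (X \<inter> B))"
  by (simp add: ms_keisler_def rat_def)

lemma rat_zero [simp]: "rat B (0, 0) = 0"
  by (simp add: rat_def)

lemma H_nonneg: "definable L N n X \<Longrightarrow> snd (H X) \<ge> 0"
  using H_pos[of n X] H_empty by (cases "X = {}") auto

lemma H_split:
  assumes "definable L N n X" "definable L N n Y" "X \<subseteq> Y"
  shows "H Y = comb (H X) (H (Y - X))"
proof -
  have "X \<union> (Y - X) = Y" using assms(3) by blast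
  then show ?thesis using H_Un[OF assms(1) definable_Diff[OF assms(2,1)]] by simp
qed

lemma dim_mono: "definable L N n X \<Longrightarrow> definable L N n Y \<Longrightarrow> X \<subseteq> Y \<Longrightarrow> fst (H X) \<le> fst (H Y)"
  by (subst H_split[of n X Y]) (auto simp: comb_def)

text \<open>Turns addition of leading terms into additivity: below the dimension of B a summand
  counts 0, and at that dimension the measures add. The bounds on the dimensions exclude terms that
  would outweigh B.\<close>

lemma rat_comb:
  "fst p \<le> fst (H B) \<Longrightarrow> fst q \<le> fst (H B) \<Longrightarrow> rat B (comb p q) = rat B p + rat B q"
  by (auto simp: rat_def comb_def add_divide_distrib)

lemma keis_Un:
  assumes B: "definable L N n B" and X: "definable L N n X" and Y: "definable L N n Y" "X \<inter> Y = {}"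
  shows "keis B (X \<union> Y) = keis B X + keis B Y"
proof -
  have XY: "definable L N n (X \<inter> B)" "definable L N n (Y \<inter> B)"
    by (intro definable_Int assms)+
  have "H ((X \<union> Y) \<inter> B) = comb (H (X \<inter> B)) (H (Y \<inter> B))"
  proof -
    have "(X \<union> Y) \<inter> B = X \<inter> B \<union> Y \<inter> B" "(X \<inter> B) \<inter> (Y \<inter> B) = {}" using Y(2) by blast+
    then show ?thesis using H_Un[OF XY] by simp
  qed
  then show ?thesis
    using dim_mono[OF XY(1) B] dim_mono[OF XY(2) B] by (simp add: keis_eq rat_comb)
qed

lemma keis_empty [simp]: "keis B {} = 0"
  by (simp add: keis_eq H_empty)

lemma keis_nonneg: "definable L N n B \<Longrightarrow> definable L N n X \<Longrightarrow> keis B X \<ge> 0"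
  using H_nonneg[of n B] H_nonneg[OF definable_Int, of n X B] by (simp add: ms_keisler_def)

lemma keis_mono:
  assumes B: "definable L N n B" and "definable L N n X" "definable L N n Y" "X \<subseteq> Y"
  shows "keis B X \<le> keis B Y"
proof -
  have "X \<union> (Y - X) = Y" using assms by blast
  moreover have "keis B (X \<union> (Y - X)) = keis B X + keis B (Y - X)"
    by (rule keis_Un) (use assms in \<open>auto intro: definable_Diff\<close>)
  moreover have "keis B (Y - X) \<ge> 0"
    using B assms by (intro keis_nonneg[of n] definable_Diff) auto
  ultimately show ?thesis by simp
qed

lemma keis_disjoint: "X \<inter> B = {} \<Longrightarrow> keis B X = 0"
  by (simp add: keis_eq H_empty)

lemma keis_superset: "definable L N n B \<Longrightarrow> B \<noteq> {} \<Longrightarrow> B \<subseteq> X \<Longrightarrow> keis B X = 1"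
  using H_pos[of n B] by (simp add: ms_keisler_def inf.absorb2)

lemma keis_le_1:
  assumes "definable L N n B" "B \<noteq> {}" "definable L N n X"
  shows "keis B X \<le> 1"
  using keis_mono[OF assms(1,3) definable_U definable_subset[OF assms(3)]]
    keis_superset[OF assms(1,2) definable_subset[OF assms(1)]] by simp

lemma keis_UN:
  assumes "definable L N n B" "finite I" "\<And>i. i \<in> I \<Longrightarrow> definable L N n (X i)"
    "\<And>i j. i \<in> I \<Longrightarrow> j \<in> I \<Longrightarrow> i \<noteq> j \<Longrightarrow> X i \<inter> X j = {}"
  shows "keis B (\<Union>i\<in>I. X i) = (\<Sum>i\<in>I. keis B (X i))"
  using assms(2-)
proof (induction I rule: finite_induct)
  case (insert i I)
  have "keis B (X i \<union> (\<Union>j\<in>I. X j)) = keis B (X i) + keis B (\<Union>j\<in>I. X j)"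
  proof (rule keis_Un[OF assms(1)])
    show "definable L N n (\<Union>j\<in>I. X j)" using insert by (intro definable_UN) auto
    show "X i \<inter> (\<Union>j\<in>I. X j) = {}" using insert by blast
  qed (use insert in auto)
  then show ?case using insert by simp
qed simp

section \<open>Definable families of fibres, and Fubini as a finite sum\<close>

lemma fiber_values:
  assumes "definable L N (n + m) Z"
  obtains D where "finite D" "\<And>b. b \<in> U m \<Longrightarrow> H {a \<in> U n. a @ b \<in> Z} \<in> D"
proof -
  obtain q \<phi> c where *: "\<phi> \<in> forms L (n + m + q)" "c \<in> U q" "Z = inst N (n + m) \<phi> c"
    using assms unfolding definable_over_def by blast
  then obtain D where D: "finite D" "\<And>b. b \<in> U (m + q) \<Longrightarrow> H (inst N n \<phi> b) \<in> D"
    using values_finite[of \<phi> n "m + q"] by (auto simp: add.assoc)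
  have "{a \<in> U n. a @ b \<in> Z} = inst N n \<phi> (b @ c)" if "b \<in> U m" for b
    using * that by (auto simp: inst_def in_nlists)
  then show thesis
    using D(2)[OF nlists_appendI[OF _ *(2)]] by (intro that[OF D(1)]) simp
qed

text \<open>The parameter set stays \<open>A\<close>; this matters later, when \<open>A\<close> is
  the small set of a Morley product.\<close>

lemma fiber_level:
  assumes "definable_over L N A (n + m) Z" "A \<subseteq> univ N"
  shows "definable_over L N A m {b \<in> U m. H {a \<in> U n. a @ b \<in> Z} = p}"
proof (rule definable_Collect, rule dfn_level)
  show "dfn (kset A) (n + m) (\<lambda>_ as. take n as @ drop n as \<in> Z)"
    using dfn_mem_id[OF assms(1)] by simp
qed (use assms(2) in auto)

lemma definable_over_fiber:
  assumes "definable_over L N A (n + m) Z" "b \<in> nlists m A" "A \<subseteq> univ N"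
  shows "definable_over L N A n {a \<in> U n. a @ b \<in> Z}"
proof (rule definable_Collect, rule dfn_section[where b = b and m = m and Q = "\<lambda>a b. a @ b \<in> Z"])
  show "dfn (kset A) (n + m) (\<lambda>_ as. take n as @ drop n as \<in> Z)"
    using dfn_mem_id[OF assms(1)] by simp
qed (use assms(2,3) in auto)

lemma definable_fiber:
  "definable L N (n + m) Z \<Longrightarrow> b \<in> U m \<Longrightarrow> definable L N n {a \<in> U n. a @ b \<in> Z}"
  by (rule definable_over_fiber) auto

lemma definable_prodset:
  assumes "definable_over L N A n X" "definable_over L N A m Y"
  shows "definable_over L N A (n + m) (prodset X Y)"
proof -
  have "dfn (kset A) (n + m) (\<lambda>_ z. take n z \<in> X \<and> drop n z \<in> Y)"
    by (intro dfn_and dfn_mem[OF assms(1)] dfn_mem[OF assms(2)] coord_intros) auto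
  then have "definable_over L N A (n + m) {z \<in> U (n + m). take n z \<in> X \<and> drop n z \<in> Y}"
    by (rule definable_Collect)
  also have "{z \<in> U (n + m). take n z \<in> X \<and> drop n z \<in> Y} = prodset X Y"
  proof
    show "{z \<in> U (n + m). take n z \<in> X \<and> drop n z \<in> Y} \<subseteq> prodset X Y"
    proof
      fix z assume "z \<in> {z \<in> U (n + m). take n z \<in> X \<and> drop n z \<in> Y}"
      then have "z = take n z @ drop n z" "take n z \<in> X" "drop n z \<in> Y" by auto
      then show "z \<in> prodset X Y" by blast
    qed
    show "prodset X Y \<subseteq> {z \<in> U (n + m). take n z \<in> X \<and> drop n z \<in> Y}"
    proof
      fix z assume "z \<in> prodset X Y"
      then obtain a b where "z = a @ b" "a \<in> X" "b \<in> Y" by blast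
      moreover from this have "a \<in> U n" "b \<in> U m"
        using definable_subset[OF assms(1)] definable_subset[OF assms(2)] by auto
      ultimately show "z \<in> {z \<in> U (n + m). take n z \<in> X \<and> drop n z \<in> Y}"
        by (auto simp: in_nlists)
    qed
  qed
  finally show ?thesis .
qed

lemma append_in_prodset:
  assumes "definable L N n X" "a \<in> U n"
  shows "a @ b \<in> prodset X Y \<longleftrightarrow> a \<in> X \<and> b \<in> Y"
proof
  assume "a @ b \<in> prodset X Y"
  then obtain a' b' where *: "a @ b = a' @ b'" "a' \<in> X" "b' \<in> Y" by blast
  moreover have "length a' = length a"
    using assms definable_subset[OF assms(1)] *(2) by (auto simp: in_nlists)
  ultimately show "a \<in> X \<and> b \<in> Y" by simp
qed blast

text \<open>All fibres over Y are equal to X, so the fibration clause applies directly.\<close>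

lemma H_prodset:
  assumes X: "definable L N n X" "X \<noteq> {}" and Y: "definable L N m Y" "Y \<noteq> {}"
  shows "H (prodset X Y) = (fst (H Y) + fst (H X), snd (H X) * snd (H Y))"
proof (rule H_fib[OF definable_prodset[OF X(1) Y(1)] Y])
  show "\<forall>z\<in>prodset X Y. drop n z \<in> Y"
    using definable_subset[OF X(1)] by (auto simp: in_nlists)
  have "{a \<in> U n. a @ b \<in> prodset X Y} = X" if "b \<in> Y" for b
    using append_in_prodset[OF X(1)] that definable_subset[OF X(1)] by blast
  then show "\<forall>b\<in>Y. H {a \<in> U n. a @ b \<in> prodset X Y} = (fst (H X), snd (H X))" by simp
  show "0 < snd (H X)" by (rule H_pos[OF X])
qed

text \<open>Over one level set all fibres have the same value, so clause (4) computes the value of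
  the part of Z above it; what remains is to see that the normalised measure factorises.\<close>

lemma keis_fubini_level:
  assumes X: "definable L N n X" "X \<noteq> {}" and Y: "definable L N m Y" "Y \<noteq> {}"
    and Z: "definable L N (n + m) Z" "Z \<subseteq> prodset X Y"
  shows "keis (prodset X Y) {z \<in> Z. drop n z \<in> {b \<in> U m. H {a \<in> U n. a @ b \<in> Z} = p}} =
    rat X p * keis Y {b \<in> U m. H {a \<in> U n. a @ b \<in> Z} = p}"
proof -
  define E where "E = {b \<in> U m. H {a \<in> U n. a @ b \<in> Z} = p}"
  define Zp where "Zp = {z \<in> Z. drop n z \<in> E}"
  have E: "definable L N m E" unfolding E_def by (rule fiber_level[OF Z(1)]) simp
  then have EY: "definable L N m (E \<inter> Y)" by (intro definable_Int Y)
  have Zp: "definable L N (n + m) Zp" unfolding Zp_def by (rule definable_drop[OF Z(1) E])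
  have sub: "Zp \<inter> prodset X Y = Zp" using Z(2) by (auto simp: Zp_def)
  have drop: "drop n z \<in> E \<inter> Y" if "z \<in> Zp" for z
    using that Z(2) definable_subset[OF X(1)] by (force simp: Zp_def in_nlists)
  have fib: "{a \<in> U n. a @ b \<in> Zp} = {a \<in> U n. a @ b \<in> Z}" if "b \<in> E" for b
    using that by (auto simp: Zp_def in_nlists)
  have fibX: "{a \<in> U n. a @ b \<in> Z} \<subseteq> X" for b
    using Z(2) append_in_prodset[OF X(1)] by blast
  have "rat (prodset X Y) (H Zp) = rat X p * rat Y (H (E \<inter> Y))"
  proof (cases "E \<inter> Y = {}")
    case True
    then have "Zp = {}" using drop by blast
    then show ?thesis using True H_empty by simp
  next
    case False
    then obtain b where b: "b \<in> E" "b \<in> Y" by blast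
    then have Hb: "H {a \<in> U n. a @ b \<in> Z} = p" and "b \<in> U m" by (auto simp: E_def)
    have dfib: "definable L N n {a \<in> U n. a @ b \<in> Z}" by (rule definable_fiber[OF Z(1) \<open>b \<in> U m\<close>])
    show ?thesis
    proof (cases "snd p > 0")
      case True
      have "H Zp = (fst (H (E \<inter> Y)) + fst p, snd p * snd (H (E \<inter> Y)))"
        by (rule H_fib[OF Zp EY False]) (use True drop fib in \<open>auto simp: E_def\<close>)
      moreover have "fst p \<le> fst (H X)" using dim_mono[OF dfib X(1) fibX] Hb by simp
      moreover have "fst (H (E \<inter> Y)) \<le> fst (H Y)" by (rule dim_mono[OF EY Y(1)]) simp
      \<comment> \<open>Both dimensions are bounded by those of X and Y, so their sum reaches
        \<open>dim X + dim Y\<close> only if both bounds are attained. Hence the left side is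
        non-zero only if both factors are.\<close>
      ultimately show ?thesis by (auto simp: rat_def H_prodset[OF X Y])
    next
      \<comment> \<open>Only an empty set has no positive measure. So \<open>p\<close> is
        \<open>(0, 0)\<close>, and no point of Z lies over its level set.\<close>
      case neg: False
      then have emp: "{a \<in> U n. a @ b \<in> Z} = {}" using H_pos[OF dfib] Hb by blast
      from Hb have "H {} = p" unfolding emp .
      then have p: "p = (0, 0)" using H_empty by simp
      have "Zp = {}"
      proof (rule ccontr)
        assume "Zp \<noteq> {}"
        then obtain z where z: "z \<in> Z" "drop n z \<in> E" by (auto simp: Zp_def)
        then have zU: "z \<in> U (n + m)" using definable_subset[OF Z(1)] by blast
        then obtain x y where xy: "z = x @ y" "x \<in> U n" "y \<in> U m" by (rule nlists_split)
        then have "y \<in> E" using z by (simp add: in_nlists)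
        moreover have "x \<in> {a \<in> U n. a @ y \<in> Z}" using xy z by simp
        ultimately show False
          using H_pos[OF definable_fiber[OF Z(1) xy(3)]] p by (auto simp: E_def)
      qed
      then show ?thesis using p H_empty by simp
    qed
  qed
  then show ?thesis unfolding E_def[symmetric] Zp_def[symmetric] by (simp add: keis_eq sub)
qed

text \<open>The part of Z inside the product is partitioned by the values of its fibres, and
  \<open>keis_fubini_level\<close> evaluates each of the finitely many parts.\<close>

lemma keis_fubini:
  assumes X: "definable L N n X" "X \<noteq> {}" and Y: "definable L N m Y" "Y \<noteq> {}"
    and Z: "definable L N (n + m) Z"
    and D: "finite D" "\<And>b. b \<in> U m \<Longrightarrow> H ({a \<in> U n. a @ b \<in> Z} \<inter> X) \<in> D"
  shows "keis (prodset X Y) Z = (\<Sum>p\<in>D. rat X p * keis Y {b \<in> U m. H ({a \<in> U n. a @ b \<in> Z} \<inter> X) = p})"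
proof -
  define W where "W = Z \<inter> prodset X Y"
  have W: "definable L N (n + m) W" unfolding W_def by (intro definable_Int Z definable_prodset X Y)
  have WXY: "W \<subseteq> prodset X Y" by (auto simp: W_def)
  define E where "E p = {b \<in> U m. H {a \<in> U n. a @ b \<in> W} = p}" for p
  have E: "definable L N m (E p)" for p unfolding E_def by (rule fiber_level[OF W]) simp
  have fib: "{a \<in> U n. a @ b \<in> W} = {a \<in> U n. a @ b \<in> Z} \<inter> X" if "b \<in> Y" for b
    using append_in_prodset[OF X(1), of _ b Y] that unfolding W_def by blast
  have "W = (\<Union>p\<in>D. {z \<in> W. drop n z \<in> E p})"
  proof
    show "W \<subseteq> (\<Union>p\<in>D. {z \<in> W. drop n z \<in> E p})"
    proof
      fix z assume z: "z \<in> W"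
      then obtain x y where xy: "z = x @ y" "x \<in> X" "y \<in> Y" using WXY by blast
      then have "drop n z = y" using definable_subset[OF X(1)] by (auto simp: in_nlists)
      moreover have "y \<in> U m" using xy definable_subset[OF Y(1)] by blast
      ultimately show "z \<in> (\<Union>p\<in>D. {z \<in> W. drop n z \<in> E p})"
        using z D(2)[of y] fib[OF xy(3)] by (auto simp: E_def)
    qed
  qed auto
  then have "keis (prodset X Y) W = keis (prodset X Y) (\<Union>p\<in>D. {z \<in> W. drop n z \<in> E p})" by simp
  also have "\<dots> = (\<Sum>p\<in>D. keis (prodset X Y) {z \<in> W. drop n z \<in> E p})"
    by (rule keis_UN[OF definable_prodset[OF X(1) Y(1)] D(1) definable_drop[OF W E]])
      (auto simp: E_def)
  also have "\<dots> = (\<Sum>p\<in>D. rat X p * keis Y {b \<in> U m. H ({a \<in> U n. a @ b \<in> Z} \<inter> X) = p})"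
  proof (rule sum.cong[OF refl])
    fix p
    \<comment> \<open>\<open>E p\<close> is formed with the fibres of \<open>W\<close>, which agree
      with those of Z cut by X only over Y. Points outside Y do not affect
      \<open>keis Y\<close>.\<close>
    have "E p \<inter> Y = {b \<in> U m. H ({a \<in> U n. a @ b \<in> Z} \<inter> X) = p} \<inter> Y"
      by (auto simp: E_def fib)
    then have "keis Y (E p) = keis Y {b \<in> U m. H ({a \<in> U n. a @ b \<in> Z} \<inter> X) = p}"
      by (simp only: keis_eq)
    then show "keis (prodset X Y) {z \<in> W. drop n z \<in> E p} =
        rat X p * keis Y {b \<in> U m. H ({a \<in> U n. a @ b \<in> Z} \<inter> X) = p}"
      using keis_fubini_level[OF X Y W WXY, of p] by (simp add: E_def)
  qed
  finally show ?thesis by (simp add: keis_eq W_def)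
qed

text \<open>Cutting Z by the cylinder over X turns the intersection with X into a plain fibre,
  without leaving the parameter set \<open>A\<close>.\<close>

lemma fiber_Int_level_over:
  assumes X: "definable_over L N A n X" and Z: "definable_over L N A (n + m) Z" and A: "A \<subseteq> univ N"
  obtains D where "finite D" "\<And>b. b \<in> U m \<Longrightarrow> H ({a \<in> U n. a @ b \<in> Z} \<inter> X) \<in> D"
    "\<And>p. definable_over L N A m {b \<in> U m. H ({a \<in> U n. a @ b \<in> Z} \<inter> X) = p}"
proof -
  define W where "W = Z \<inter> prodset X (U m)"
  have W: "definable_over L N A (n + m) W"
    unfolding W_def by (intro definable_Int Z definable_prodset X definable_U)
  have fib: "{a \<in> U n. a @ b \<in> W} = {a \<in> U n. a @ b \<in> Z} \<inter> X" if "b \<in> U m" for b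
    using append_in_prodset[OF definable_over_mono[OF X A], of _ b "U m"] that unfolding W_def by blast
  obtain D where D: "finite D" "\<And>b. b \<in> U m \<Longrightarrow> H {a \<in> U n. a @ b \<in> W} \<in> D"
    using definable_over_mono[OF W A] by (rule fiber_values) blast
  have "definable_over L N A m {b \<in> U m. H ({a \<in> U n. a @ b \<in> Z} \<inter> X) = p}" for p
  proof -
    have "{b \<in> U m. H ({a \<in> U n. a @ b \<in> Z} \<inter> X) = p} = {b \<in> U m. H {a \<in> U n. a @ b \<in> W} = p}"
      using fib by auto
    then show ?thesis using fiber_level[OF W A, of p] by simp
  qed
  then show thesis using that[OF D(1)] D(2) fib by auto
qed

text \<open>Fibres have measure at most 1 over \<open>G\<close> and at most \<open>t\<close> over
  the rest of Y, whose mass is at most 1.\<close>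

lemma keis_fubini_le:
  assumes X: "definable L N n X" "X \<noteq> {}" and Y: "definable L N m Y" "Y \<noteq> {}"
    and Z: "definable L N (n + m) Z" and G: "definable L N m G"
    and le: "\<And>b. b \<in> Y - G \<Longrightarrow> keis X {a \<in> U n. a @ b \<in> Z} \<le> t" and "t \<ge> 0"
  shows "keis (prodset X Y) Z \<le> keis Y G + t"
proof -
  obtain D where D: "finite D" "\<And>b. b \<in> U m \<Longrightarrow> H ({a \<in> U n. a @ b \<in> Z} \<inter> X) \<in> D"
    and dE: "\<And>p. definable L N m {b \<in> U m. H ({a \<in> U n. a @ b \<in> Z} \<inter> X) = p}"
    using fiber_Int_level_over[OF X(1) Z subset_refl] by blast
  define E where "E p = {b \<in> U m. H ({a \<in> U n. a @ b \<in> Z} \<inter> X) = p}" for p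
  have E: "definable L N m (E p)" for p unfolding E_def by (rule dE)
  have EG: "definable L N m (E p \<inter> G)" "definable L N m (E p - G)" for p
    by (intro definable_Int definable_Diff E G)+
  have rat: "rat X p = keis X {a \<in> U n. a @ b \<in> Z}" "b \<in> U m" if "b \<in> E p" for p b
    using that by (auto simp: E_def keis_eq)
  have "rat X p * keis Y (E p) \<le> keis Y (E p \<inter> G) + t * keis Y (E p - G)" for p
  \<comment> \<open>If the level set misses Y, its term is 0. Otherwise a point of it exhibits
    \<open>rat X p\<close> as the measure of a fibre, hence as a number that is at most 1.\<close>
  proof (cases "E p \<inter> Y = {}")
    case True
    then show ?thesis
      using keis_nonneg[OF Y(1) EG(1)] keis_nonneg[OF Y(1) EG(2)] \<open>t \<ge> 0\<close>
      by (simp add: keis_disjoint)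
  next
    case False
    then obtain b where b: "b \<in> E p" by blast
    have r1: "rat X p \<le> 1"
      using rat[OF b] keis_le_1[OF X definable_fiber[OF Z]] by simp
    have split: "keis Y (E p) = keis Y (E p \<inter> G) + keis Y (E p - G)"
    proof -
      have "(E p \<inter> G) \<union> (E p - G) = E p" "(E p \<inter> G) \<inter> (E p - G) = {}" by blast+
      then show ?thesis using keis_Un[OF Y(1) EG, of p p] by simp
    qed
    have "rat X p * keis Y (E p \<inter> G) \<le> keis Y (E p \<inter> G)"
      using mult_right_mono[OF r1 keis_nonneg[OF Y(1) EG(1)]] by simp
    moreover have "rat X p * keis Y (E p - G) \<le> t * keis Y (E p - G)"
    proof (cases "(E p - G) \<inter> Y = {}")
      case False
      then obtain b' where "b' \<in> E p" "b' \<in> Y - G" by blast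
      then have "rat X p \<le> t" using rat le by simp
      then show ?thesis using keis_nonneg[OF Y(1) EG(2)] by (rule mult_right_mono)
    qed (simp add: keis_disjoint)
    ultimately show ?thesis by (simp add: split distrib_left)
  qed
  then have "(\<Sum>p\<in>D. rat X p * keis Y (E p)) \<le> (\<Sum>p\<in>D. keis Y (E p \<inter> G) + t * keis Y (E p - G))"
    by (rule sum_mono)
  also have "\<dots> = (\<Sum>p\<in>D. keis Y (E p \<inter> G)) + t * (\<Sum>p\<in>D. keis Y (E p - G))"
    by (simp add: sum.distrib sum_distrib_left)
  also have "(\<Sum>p\<in>D. keis Y (E p \<inter> G)) = keis Y (\<Union>p\<in>D. E p \<inter> G)"
    by (rule keis_UN[symmetric, OF Y(1) D(1) EG(1)]) (auto simp: E_def)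
  also have "(\<Union>p\<in>D. E p \<inter> G) = G" using D(2) definable_subset[OF G] by (auto simp: E_def)
  also have "(\<Sum>p\<in>D. keis Y (E p - G)) = keis Y (\<Union>p\<in>D. E p - G)"
    by (rule keis_UN[symmetric, OF Y(1) D(1) EG(2)]) (auto simp: E_def)
  also have "t * keis Y (\<Union>p\<in>D. E p - G) \<le> t * 1"
    by (intro mult_left_mono keis_le_1[OF Y] definable_UN D(1) EG \<open>t \<ge> 0\<close>)
  finally show ?thesis
    using keis_fubini[OF X Y Z D] by (simp add: E_def)
qed

text \<open>The Markov inequality for fibre measures: the mass above the complement of
  \<open>G\<close> is dropped, which is allowed since it is non-negative.\<close>

lemma keis_fubini_ge:
  assumes X: "definable L N n X" "X \<noteq> {}" and Y: "definable L N m Y" "Y \<noteq> {}"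
    and Z: "definable L N (n + m) Z" and G: "definable L N m G"
    and ge: "\<And>b. b \<in> Y \<inter> G \<Longrightarrow> t \<le> keis X {a \<in> U n. a @ b \<in> Z}"
  shows "t * keis Y G \<le> keis (prodset X Y) Z"
proof -
  obtain D where D: "finite D" "\<And>b. b \<in> U m \<Longrightarrow> H ({a \<in> U n. a @ b \<in> Z} \<inter> X) \<in> D"
    and dE: "\<And>p. definable L N m {b \<in> U m. H ({a \<in> U n. a @ b \<in> Z} \<inter> X) = p}"
    using fiber_Int_level_over[OF X(1) Z subset_refl] by blast
  define E where "E p = {b \<in> U m. H ({a \<in> U n. a @ b \<in> Z} \<inter> X) = p}" for p
  have E: "definable L N m (E p)" for p unfolding E_def by (rule dE)
  have EG: "definable L N m (E p \<inter> G)" for p by (intro definable_Int E G)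
  have rat: "rat X p = keis X {a \<in> U n. a @ b \<in> Z}" "b \<in> U m" if "b \<in> E p" for p b
    using that by (auto simp: E_def keis_eq)
  have "t * keis Y (E p \<inter> G) \<le> rat X p * keis Y (E p)" for p
  proof (cases "E p \<inter> G \<inter> Y = {}")
    case True
    have "rat X p * keis Y (E p) \<ge> 0"
    \<comment> \<open>For a pair \<open>p\<close> that is not the value of any fibre, nothing
      controls the sign of \<open>rat X p\<close>; but then the level set is empty.\<close>
    proof (cases "E p = {}")
      case False
      then obtain b where b: "b \<in> E p" by blast
      then have "rat X p \<ge> 0" using rat keis_nonneg[OF X(1) definable_fiber[OF Z]] by auto
      then show ?thesis using keis_nonneg[OF Y(1) E] by simp
    qed simp
    with True show ?thesis by (simp add: keis_disjoint)
  next
    case False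
    then obtain b where b: "b \<in> E p" "b \<in> Y \<inter> G" by blast
    have "t * keis Y (E p \<inter> G) \<le> rat X p * keis Y (E p \<inter> G)"
      using ge[OF b(2)] rat[OF b(1)] keis_nonneg[OF Y(1) EG] by (intro mult_right_mono) auto
    also have "\<dots> \<le> rat X p * keis Y (E p)"
      using rat[OF b(1)] keis_nonneg[OF X(1) definable_fiber[OF Z]]
      by (intro mult_left_mono keis_mono[OF Y(1) EG E]) auto
    finally show ?thesis .
  qed
  then have "(\<Sum>p\<in>D. t * keis Y (E p \<inter> G)) \<le> (\<Sum>p\<in>D. rat X p * keis Y (E p))"
    by (rule sum_mono)
  moreover have "(\<Sum>p\<in>D. keis Y (E p \<inter> G)) = keis Y (\<Union>p\<in>D. E p \<inter> G)"
    by (rule keis_UN[symmetric, OF Y(1) D(1) EG]) (auto simp: E_def)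
  moreover have "(\<Union>p\<in>D. E p \<inter> G) = G" using D(2) definable_subset[OF G] by (auto simp: E_def)
  ultimately show ?thesis
    using keis_fubini[OF X Y Z D] by (simp add: E_def sum_distrib_left[symmetric])
qed

lemma keis_level:
  assumes X: "definable_over L N A n X" and Z: "definable_over L N A (n + m) Z" and A: "A \<subseteq> univ N"
  shows "definable_over L N A m {b \<in> U m. keis X {a \<in> U n. a @ b \<in> Z} = v}"
proof -
  obtain D where D: "finite D" "\<And>b. b \<in> U m \<Longrightarrow> H ({a \<in> U n. a @ b \<in> Z} \<inter> X) \<in> D"
    and dE: "\<And>p. definable_over L N A m {b \<in> U m. H ({a \<in> U n. a @ b \<in> Z} \<inter> X) = p}"
    using fiber_Int_level_over[OF X Z A] by blast
  have "{b \<in> U m. keis X {a \<in> U n. a @ b \<in> Z} = v} =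
      (\<Union>p\<in>{p \<in> D. rat X p = v}. {b \<in> U m. H ({a \<in> U n. a @ b \<in> Z} \<inter> X) = p})"
    using D(2) by (auto simp: keis_eq)
  then show ?thesis using D(1) dE by (simp add: definable_UN)
qed

text \<open>The Fubini sum regrouped by real values. In this shape it is the integral of a simple
  function on the type space.\<close>

lemma keis_integral:
  assumes X: "definable L N n X" "X \<noteq> {}" and Y: "definable L N m Y" "Y \<noteq> {}"
    and Z: "definable L N (n + m) Z"
    and V: "finite V" "\<And>b. b \<in> U m \<Longrightarrow> keis X {a \<in> U n. a @ b \<in> Z} \<in> V"
  shows "keis (prodset X Y) Z = (\<Sum>v\<in>V. v * keis Y {b \<in> U m. keis X {a \<in> U n. a @ b \<in> Z} = v})"
proof -
  obtain D0 where D0: "finite D0" "\<And>b. b \<in> U m \<Longrightarrow> H ({a \<in> U n. a @ b \<in> Z} \<inter> X) \<in> D0"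
    and dE: "\<And>p. definable L N m {b \<in> U m. H ({a \<in> U n. a @ b \<in> Z} \<inter> X) = p}"
    using fiber_Int_level_over[OF X(1) Z subset_refl] by blast
  \<comment> \<open>\<open>D0\<close> may contain pairs that no fibre attains. Removing those with a
    ratio outside \<open>V\<close> makes the grouping by \<open>v \<in> V\<close>
    exhaustive.\<close>
  define D where "D = {p \<in> D0. rat X p \<in> V}"
  define E where "E p = {b \<in> U m. H ({a \<in> U n. a @ b \<in> Z} \<inter> X) = p}" for p
  have E: "definable L N m (E p)" for p unfolding E_def by (rule dE)
  have D: "finite D" "\<And>b. b \<in> U m \<Longrightarrow> H ({a \<in> U n. a @ b \<in> Z} \<inter> X) \<in> D"
    using D0 V(2) by (auto simp: D_def keis_eq)
  have "keis (prodset X Y) Z = (\<Sum>p\<in>D. rat X p * keis Y (E p))"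
    unfolding E_def by (rule keis_fubini[OF X Y Z D])
  also have "\<dots> = (\<Sum>v\<in>V. \<Sum>p\<in>{p \<in> D. rat X p = v}. rat X p * keis Y (E p))"
    by (rule sum.group[symmetric]) (use D V in \<open>auto simp: D_def\<close>)
  also have "\<dots> = (\<Sum>v\<in>V. v * keis Y {b \<in> U m. keis X {a \<in> U n. a @ b \<in> Z} = v})"
  proof (rule sum.cong[OF refl])
    fix v
    have "{b \<in> U m. keis X {a \<in> U n. a @ b \<in> Z} = v} = (\<Union>p\<in>{p \<in> D. rat X p = v}. E p)"
      using D(2) by (auto simp: keis_eq E_def)
    moreover have "keis Y (\<Union>p\<in>{p \<in> D. rat X p = v}. E p) = (\<Sum>p\<in>{p \<in> D. rat X p = v}. keis Y (E p))"
      by (rule keis_UN[OF Y(1) _ E]) (use D(1) in \<open>auto simp: E_def\<close>)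
    ultimately show "(\<Sum>p\<in>{p \<in> D. rat X p = v}. rat X p * keis Y (E p)) =
        v * keis Y {b \<in> U m. keis X {a \<in> U n. a @ b \<in> Z} = v}"
      by (simp add: sum_distrib_left)
  qed
  finally show ?thesis .
qed

section \<open>Exchanging the two blocks of coordinates\<close>

abbreviation swap :: "nat \<Rightarrow> 'a list \<Rightarrow> 'a list" where
  "swap n z \<equiv> drop n z @ take n z"

lemma definable_swap:
  assumes "definable_over L N A (n + m) Z"
  shows "definable_over L N A (m + n) (swap n ` Z)"
  by (rule definable_image[OF assms]) (intro coord_intros; simp)

lemma inj_swap: "inj_on (swap n) (U (n + m))"
proof (rule inj_onI)
  fix x y assume "x \<in> U (n + m)" "y \<in> U (n + m)" and eq: "swap n x = swap n y"
  then have "length x = n + m" "length y = n + m" by (auto simp: in_nlists)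
  then have "drop n x = drop n y \<and> take n x = take n y" using eq by (simp add: append_eq_append_conv)
  then show "x = y" by (metis append_take_drop_id)
qed

lemma keis_swap:
  assumes B: "definable L N (n + m) B" and Z: "definable L N (n + m) Z"
  shows "keis (swap n ` B) (swap n ` Z) = keis B Z"
proof -
  have "swap n ` Z \<inter> swap n ` B = swap n ` (Z \<inter> B)"
    by (rule inj_on_image_Int[OF inj_swap definable_subset[OF Z] definable_subset[OF B], symmetric])
  then show ?thesis
    using H_swap[OF B] H_swap[OF definable_Int[OF Z B]] by (simp add: ms_keisler_def)
qed

lemma swap_prodset:
  assumes "X \<subseteq> U n"
  shows "swap n ` prodset X Y = prodset Y X"
proof
  show "swap n ` prodset X Y \<subseteq> prodset Y X"
  proof
    fix y assume "y \<in> swap n ` prodset X Y"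
    then obtain a b where ab: "y = swap n (a @ b)" "a \<in> X" "b \<in> Y" by blast
    then have "y = b @ a" using assms by (auto simp: in_nlists)
    then show "y \<in> prodset Y X" using ab by blast
  qed
  show "prodset Y X \<subseteq> swap n ` prodset X Y"
  proof
    fix z assume "z \<in> prodset Y X"
    then obtain a b where ab: "z = b @ a" "a \<in> X" "b \<in> Y" by blast
    then show "z \<in> swap n ` prodset X Y"
      using assms by (intro image_eqI[of _ _ "a @ b"]) (auto simp: in_nlists)
  qed
qed

text \<open>Lets Fubini be used in either order, although the fibration clause projects only to the
  last block.\<close>

lemma keis_swap_prodset:
  assumes X: "definable L N n X" and Y: "definable L N m Y" and Z: "definable L N (n + m) Z"
  shows "keis (prodset Y X) (swap n ` Z) = keis (prodset X Y) Z"
  using keis_swap[OF definable_prodset[OF X Y] Z] swap_prodset[OF definable_subset[OF X]] by simp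

lemma append_in_swap:
  assumes "Z \<subseteq> U (n + m)" "b \<in> U m" "a \<in> U n"
  shows "b @ a \<in> swap n ` Z \<longleftrightarrow> a @ b \<in> Z"
proof
  assume "b @ a \<in> swap n ` Z"
  then obtain z where z: "z \<in> Z" "b @ a = swap n z" by blast
  then have "z \<in> U (n + m)" using assms by blast
  then obtain x y where "z = x @ y" "x \<in> U n" "y \<in> U m" by (rule nlists_split)
  with z assms show "a @ b \<in> Z" by (auto simp: in_nlists)
next
  assume "a @ b \<in> Z"
  then show "b @ a \<in> swap n ` Z"
    using assms by (intro image_eqI[of _ _ "a @ b"]) (auto simp: in_nlists)
qed

text \<open>Double counting for a finitely additive measure. The induction on \<open>l\<close>
  splits Y along \<open>X l\<close>: inside \<open>X l\<close> the earlier sets cover a point at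
  most \<open>t - 1\<close> times, outside it at most \<open>t\<close> times.\<close>

lemma keis_averaging:
  fixes X :: "nat \<Rightarrow> 'a list set"
  assumes "definable L N n B" "\<And>i. i < l \<Longrightarrow> definable L N n (X i)" "definable L N n Y"
    and "\<And>x. x \<in> Y \<Longrightarrow> card {i. i < l \<and> x \<in> X i} \<le> t"
  shows "(\<Sum>i<l. keis B (X i \<inter> Y)) \<le> real t * keis B Y"
  using assms(2-)
proof (induction l arbitrary: Y t)
  case 0
  then show ?case using keis_nonneg[OF assms(1)] by simp
next
  case (Suc l)
  have X: "definable L N n (X i)" if "i \<le> l" for i using Suc.prems(1) that by simp
  define Y1 where "Y1 = Y \<inter> X l"
  define Y2 where "Y2 = Y - X l"
  have Y12: "definable L N n Y1" "definable L N n Y2"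
    unfolding Y1_def Y2_def
    using definable_Int[OF Suc.prems(2) X] definable_Diff[OF Suc.prems(2) X] by auto
  have split: "keis B (W \<inter> Y) = keis B (W \<inter> Y1) + keis B (W \<inter> Y2)" if "definable L N n W" for W
  proof -
    have "W \<inter> Y = (W \<inter> Y1) \<union> (W \<inter> Y2)" by (auto simp: Y1_def Y2_def)
    moreover have "keis B ((W \<inter> Y1) \<union> (W \<inter> Y2)) = keis B (W \<inter> Y1) + keis B (W \<inter> Y2)"
      by (rule keis_Un[OF assms(1) definable_Int[OF that Y12(1)] definable_Int[OF that Y12(2)]])
        (auto simp: Y1_def Y2_def)
    ultimately show ?thesis by simp
  qed
  have c2: "card {i. i < l \<and> x \<in> X i} \<le> t" if "x \<in> Y2" for x
  proof -
    have "card {i. i < l \<and> x \<in> X i} \<le> card {i. i < Suc l \<and> x \<in> X i}"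
      by (rule card_mono) auto
    then show ?thesis using Suc.prems(3)[of x] that by (auto simp: Y2_def)
  qed
  have c1: "Suc (card {i. i < l \<and> x \<in> X i}) \<le> t" if "x \<in> Y1" for x
  proof -
    have "{i. i < Suc l \<and> x \<in> X i} = insert l {i. i < l \<and> x \<in> X i}"
      using that by (auto simp: Y1_def)
    then show ?thesis using Suc.prems(3)[of x] that by (auto simp: Y1_def)
  qed
  have IH2: "(\<Sum>i<l. keis B (X i \<inter> Y2)) \<le> real t * keis B Y2"
    by (rule Suc.IH) (use X Y12 c2 in auto)
  \<comment> \<open>The extra summand \<open>keis B Y1\<close> is the contribution of
    \<open>X l\<close>, which meets Y exactly in \<open>Y1\<close>.\<close>
  have IH1: "(\<Sum>i<l. keis B (X i \<inter> Y1)) + keis B Y1 \<le> real t * keis B Y1"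
  proof (cases "Y1 = {}")
    case False
    \<comment> \<open>A point of \<open>Y1\<close> lies in \<open>X l\<close>, so \<open>t\<close>
      is positive and the truncated difference \<open>t - 1\<close> is the true one.\<close>
    then have "t \<ge> 1" using c1 by fastforce
    have "(\<Sum>i<l. keis B (X i \<inter> Y1)) \<le> real (t - 1) * keis B Y1"
      by (rule Suc.IH) (use X Y12 c1 in fastforce)+
    then show ?thesis using \<open>t \<ge> 1\<close> by (simp add: of_nat_diff algebra_simps)
  qed simp
  have [simp]: "keis B (X l \<inter> Y) = keis B Y1" by (simp add: Y1_def Int_commute)
  have "(\<Sum>i<Suc l. keis B (X i \<inter> Y)) = (\<Sum>i<l. keis B (X i \<inter> Y1) + keis B (X i \<inter> Y2)) + keis B Y1"
  proof -
    have "(\<Sum>i<l. keis B (X i \<inter> Y)) = (\<Sum>i<l. keis B (X i \<inter> Y1) + keis B (X i \<inter> Y2))"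
      by (rule sum.cong) (simp_all add: split[OF X])
    then show ?thesis by simp
  qed
  moreover have "keis B Y = keis B Y1 + keis B Y2"
    using split[OF definable_U] Suc.prems(2) definable_subset Y12
    by (metis inf.absorb_iff2)
  ultimately show ?case using IH1 IH2 by (simp add: sum.distrib algebra_simps)
qed

end

section \<open>Saturation and definability over small sets\<close>

text \<open>If the values on the generators extend to a measure and are not all 0, equality holds.
  In the other case \<open>extend_measure\<close> is by definition the null measure, so the
  inequality holds without any extension theorem.\<close>

lemma emeasure_extend_measure_le:
  assumes "G ` I \<subseteq> Pow \<Omega>" "i \<in> I"
  shows "emeasure (extend_measure \<Omega> I G \<mu>) (G i) \<le> \<mu> i"
proof (cases "(\<exists>\<mu>'. (\<forall>i\<in>I. \<mu>' (G i) = \<mu> i) \<and> measure_space \<Omega> (sigma_sets \<Omega> (G ` I)) \<mu>') \<and> \<not> (\<forall>i\<in>I. \<mu> i = 0)")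
  case True
  then obtain \<mu>' where \<mu>': "\<And>i. i \<in> I \<Longrightarrow> \<mu>' (G i) = \<mu> i"
    "measure_space \<Omega> (sigma_sets \<Omega> (G ` I)) \<mu>'" by blast
  have "emeasure (extend_measure \<Omega> I G \<mu>) (G i) = \<mu> i"
    by (rule emeasure_extend_measure[where \<mu> = \<mu> and \<mu>' = \<mu>' and G = G and I = I and i = i,
          OF refl \<mu>'(1) assms(1) _ _ assms(2)])
      (use \<mu>'(2) in \<open>auto simp: measure_space_def sets_extend_measure[OF assms(1)]\<close>)
  then show ?thesis by simp
next
  case False
  then have "extend_measure \<Omega> I G \<mu> = sigma \<Omega> (G ` I)"
    unfolding extend_measure_def by (subst if_not_P) auto
  then show ?thesis by (simp add: emeasure_sigma)
qed

locale saturated_struct = single L N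
  for L :: "('f, 'r) lang" and N :: "('f, 'r, 'a) struct" +
  fixes \<kappa> :: "'k rel"
  assumes saturated: "saturated \<kappa> L N" and card: "Card_order \<kappa>" "natLeq <o \<kappa>"
begin

definition small :: "'a set \<Rightarrow> bool" where
  "small A \<longleftrightarrow> A \<subseteq> univ N \<and> |A| <o \<kappa>"

text \<open>\<open>\<kappa>\<close> is infinite, so a union of two sets below
  \<open>\<kappa>\<close> stays below it.\<close>

lemma small_Un_finite:
  assumes "small A" "finite F" "F \<subseteq> univ N"
  shows "small (A \<union> F)"
proof -
  have "natLeq \<le>o \<kappa>" using card(2) by (rule ordLess_imp_ordLeq)
  also have "\<kappa> =o |Field \<kappa>|" using card(1) card_of_Field_ordIso ordIso_symmetric by blast
  finally have "infinite (Field \<kappa>)" using infinite_iff_natLeq_ordLeq by blast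
  moreover have "|F| <o \<kappa>"
    using assms(2) card(2) finite_iff_ordLess_natLeq ordLess_transitive by blast
  ultimately have "|A \<union> F| <o \<kappa>"
    using card_of_Un_ordLess_infinite_Field card(1) assms(1) unfolding small_def by blast
  then show ?thesis using assms by (auto simp: small_def)
qed

lemma small_finite:
  assumes "finite F" "F \<subseteq> univ N"
  shows "small F"
proof -
  have "|F| <o \<kappa>"
    using assms(1) card(2) finite_iff_ordLess_natLeq ordLess_transitive by blast
  then show ?thesis using assms(2) by (simp add: small_def)
qed

section \<open>Complete types, compactness and descent of parameters\<close>

lemma pinst_definable: "\<theta> \<in> pforms L A n \<Longrightarrow> definable_over L N A n (pinst N n \<theta>)"
  unfolding pforms_def definable_over_def by (force simp: in_nlists)

lemma pinst_of_definable:
  assumes "definable_over L N A n X"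
  obtains \<theta> where "\<theta> \<in> pforms L A n" "pinst N n \<theta> = X"
proof -
  obtain m \<phi> b where "\<phi> \<in> forms L (n + m)" "b \<in> nlists m A" "X = inst N n \<phi> b"
    using assms unfolding definable_over_def by blast
  then show thesis by (intro that[of "(\<phi>, b)"]) (auto simp: pforms_def in_nlists)
qed

lemma Neg_pforms: "(\<phi>, c) \<in> pforms L A n \<Longrightarrow> (Neg \<phi>, c) \<in> pforms L A n"
  by (simp add: pforms_def forms_def)

lemma pinst_Neg: "a \<in> U n \<Longrightarrow> a \<in> pinst N n (Neg \<phi>, c) \<longleftrightarrow> a \<notin> pinst N n (\<phi>, c)"
  by (simp add: inst_def)

lemma mem_tp: "a \<in> U n \<Longrightarrow> \<theta> \<in> tp L N A a \<longleftrightarrow> \<theta> \<in> pforms L A n \<and> a \<in> pinst N n \<theta>"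
  by (simp add: tp_def in_nlists)

lemma tp_in_types:
  assumes "a \<in> U n"
  shows "tp L N A a \<in> types L N A n"
  unfolding types_def
proof (safe)
  show "\<exists>a\<in>U n. \<forall>\<theta>\<in>F. a \<in> pinst N n \<theta>" if "F \<subseteq> tp L N A a" for F
    using assms mem_tp[OF assms] that by blast
next
  fix \<phi> c assume "(\<phi>, c) \<in> pforms L A n" "(Neg \<phi>, c) \<notin> tp L N A a"
  then show "(\<phi>, c) \<in> tp L N A a"
    using mem_tp[OF assms] Neg_pforms pinst_Neg[OF assms] by blast
qed (use mem_tp[OF assms] in auto)

lemma realize:
  assumes "small A" "p \<in> types L N A n"
  obtains a where "a \<in> U n" "tp L N A a = p"
  using assms saturated unfolding saturated_def small_def by blast

text \<open>Saturation is stated for complete types only. By the lemma of Zorn,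
  \<open>\<Gamma>\<close> extends to a maximal finitely satisfiable set, and maximality makes this
  set complete.\<close>

lemma compactness:
  assumes A: "small A" and \<Gamma>: "\<Gamma> \<subseteq> pforms L A n"
    and fs: "\<And>F. finite F \<Longrightarrow> F \<subseteq> \<Gamma> \<Longrightarrow> \<exists>a\<in>U n. \<forall>\<theta>\<in>F. a \<in> pinst N n \<theta>"
  obtains a where "a \<in> U n" "\<And>\<theta>. \<theta> \<in> \<Gamma> \<Longrightarrow> a \<in> pinst N n \<theta>"
proof -
  let ?fs = "\<lambda>p. \<forall>F. finite F \<and> F \<subseteq> p \<longrightarrow> (\<exists>a\<in>U n. \<forall>\<theta>\<in>F. a \<in> pinst N n \<theta>)"
  define \<P> where "\<P> = {p. \<Gamma> \<subseteq> p \<and> p \<subseteq> pforms L A n \<and> ?fs p}"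
  have "\<exists>p\<in>\<P>. \<forall>q\<in>\<P>. p \<subseteq> q \<longrightarrow> q = p"
  proof (rule subset_Zorn_nonempty)
    show "\<P> \<noteq> {}" using \<Gamma> fs by (auto simp: \<P>_def)
    fix \<C> assume ne: "\<C> \<noteq> {}" and chain: "subset.chain \<P> \<C>"
    then have sub: "\<C> \<subseteq> \<P>" by (simp add: subset.chain_def)
    have "?fs (\<Union>\<C>)"
    proof (safe)
      fix F assume "finite F" "F \<subseteq> \<Union>\<C>"
      then obtain p where "p \<in> \<C>" "F \<subseteq> p" using finite_subset_Union_chain ne chain by metis
      then show "\<exists>a\<in>U n. \<forall>\<theta>\<in>F. a \<in> pinst N n \<theta>"
        using sub \<open>finite F\<close> unfolding \<P>_def by blast
    qed
    have *: "\<Gamma> \<subseteq> p \<and> p \<subseteq> pforms L A n" if "p \<in> \<C>" for p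
      using subsetD[OF sub that] unfolding \<P>_def by simp
    have "\<Gamma> \<subseteq> \<Union>\<C>" "\<Union>\<C> \<subseteq> pforms L A n" using ne * by blast+
    with \<open>?fs (\<Union>\<C>)\<close> show "\<Union>\<C> \<in> \<P>" unfolding \<P>_def by simp
  qed
  then obtain p where p: "p \<in> \<P>" and max: "\<And>q. q \<in> \<P> \<Longrightarrow> p \<subseteq> q \<Longrightarrow> q = p" by blast
  have p': "\<Gamma> \<subseteq> p \<and> p \<subseteq> pforms L A n \<and> ?fs p" using p unfolding \<P>_def by (rule CollectD)
  note pp = p'[THEN conjunct1] p'[THEN conjunct2, THEN conjunct1]
  note fsp = p'[THEN conjunct2, THEN conjunct2]
  \<comment> \<open>By maximality, adding a missing formula destroys finite satisfiability. If a
    formula and its negation were both missing, the two finite witnesses together would be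
    unsatisfiable within \<open>p\<close>.\<close>
  have unsat: "\<exists>F. finite F \<and> F \<subseteq> p \<and> (\<forall>a\<in>U n. (\<forall>\<eta>\<in>F. a \<in> pinst N n \<eta>) \<longrightarrow> a \<notin> pinst N n \<theta>)"
    if \<theta>: "\<theta> \<in> pforms L A n" "\<theta> \<notin> p" for \<theta>
  proof (rule ccontr)
    assume *: "\<not> ?thesis"
    have "insert \<theta> p \<in> \<P>"
      unfolding \<P>_def
    proof (safe)
      fix F assume F: "finite F" "F \<subseteq> insert \<theta> p"
      then have "finite (F - {\<theta>})" "F - {\<theta>} \<subseteq> p" by auto
      then obtain a where "a \<in> U n" "\<forall>\<eta>\<in>F - {\<theta>}. a \<in> pinst N n \<eta>" "a \<in> pinst N n \<theta>" using * by blast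
      then show "\<exists>a\<in>U n. \<forall>\<theta>\<in>F. a \<in> pinst N n \<theta>" by blast
    qed (use pp \<theta> in auto)
    then show False using max \<theta>(2) by blast
  qed
  have "p \<in> types L N A n"
    unfolding types_def
  proof (safe)
    fix \<phi> c assume \<phi>: "(\<phi>, c) \<in> pforms L A n" and neg: "(Neg \<phi>, c) \<notin> p"
    show "(\<phi>, c) \<in> p"
    proof (rule ccontr)
      assume "(\<phi>, c) \<notin> p"
      then obtain F where F: "finite F" "F \<subseteq> p"
        "\<forall>a\<in>U n. (\<forall>\<eta>\<in>F. a \<in> pinst N n \<eta>) \<longrightarrow> a \<notin> pinst N n (\<phi>, c)"
        using unsat[OF \<phi>] by blast
      obtain G where G: "finite G" "G \<subseteq> p"
        "\<forall>a\<in>U n. (\<forall>\<eta>\<in>G. a \<in> pinst N n \<eta>) \<longrightarrow> a \<notin> pinst N n (Neg \<phi>, c)"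
        using unsat[OF Neg_pforms[OF \<phi>] neg] by blast
      have "finite (F \<union> G)" "F \<union> G \<subseteq> p" using F G by auto
      then obtain a where a: "a \<in> U n" "\<forall>\<eta>\<in>F \<union> G. a \<in> pinst N n \<eta>" using fsp by blast
      then have "a \<notin> pinst N n (\<phi>, c)" "a \<notin> pinst N n (Neg \<phi>, c)" using F(3) G(3) by blast+
      then show False using pinst_Neg[OF a(1)] by blast
    qed
  qed (use pp fsp in auto)
  then obtain a where a: "a \<in> U n" "tp L N A a = p" by (rule realize[OF A])
  then show thesis using that mem_tp[OF a(1)] pp(1) by blast
qed

lemma definable_finite_params:
  assumes "definable L N n X"
  obtains F where "finite F" "F \<subseteq> univ N" "definable_over L N F n X"
proof -
  obtain m \<phi> b where *: "\<phi> \<in> forms L (n + m)" "b \<in> U m" "X = inst N n \<phi> b"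
    using assms unfolding definable_over_def by blast
  then have "b \<in> nlists m (set b)" by (simp add: in_nlists)
  with * have "definable_over L N (set b) n X" unfolding definable_over_def by blast
  with * show thesis by (intro that[of "set b"]) (auto simp: in_nlists)
qed

text \<open>If finitely many A-definable subsets never covered C, compactness over A and the
  parameters of C would give a point of C outside every A-definable subset of C, against
  \<open>loc\<close>. A finite cover then presents C over A.\<close>

lemma definable_over_if_locally:
  assumes A: "small A" and C: "definable L N n C"
    and loc: "\<And>b. b \<in> C \<Longrightarrow> \<exists>E. definable_over L N A n E \<and> b \<in> E \<and> E \<subseteq> C"
  shows "definable_over L N A n C"
proof -
  obtain P where P: "finite P" "P \<subseteq> univ N" "definable_over L N P n C"
    using C by (rule definable_finite_params)
  define \<E> where "\<E> = {E. definable_over L N A n E \<and> E \<subseteq> C}"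
  have small: "small (A \<union> P)" using A P(1,2) by (rule small_Un_finite)
  have "\<exists>\<F>. finite \<F> \<and> \<F> \<subseteq> \<E> \<and> C \<subseteq> \<Union>\<F>"
  proof (rule ccontr)
    assume no: "\<not> ?thesis"
    \<comment> \<open>The filter generated by the sets \<open>C - \<Union>\<F>\<close> with
      \<open>\<F>\<close> finite. Being upward closed it needs no choice of a formula for each set,
      and finite satisfiability is just the failure of finite covers.\<close>
    define \<Gamma> where "\<Gamma> = {\<theta> \<in> pforms L (A \<union> P) n. \<exists>\<F>. finite \<F> \<and> \<F> \<subseteq> \<E> \<and> C - \<Union>\<F> \<subseteq> pinst N n \<theta>}"
    obtain a where a: "a \<in> U n" "\<And>\<theta>. \<theta> \<in> \<Gamma> \<Longrightarrow> a \<in> pinst N n \<theta>"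
    proof (rule compactness[OF small, of \<Gamma> n])
      show "\<Gamma> \<subseteq> pforms L (A \<union> P) n" by (auto simp: \<Gamma>_def)
      fix F assume F: "finite F" "F \<subseteq> \<Gamma>"
      then have "\<forall>\<theta>\<in>F. \<exists>\<F>. finite \<F> \<and> \<F> \<subseteq> \<E> \<and> C - \<Union>\<F> \<subseteq> pinst N n \<theta>" by (auto simp: \<Gamma>_def)
      then obtain f where f: "\<And>\<theta>. \<theta> \<in> F \<Longrightarrow> finite (f \<theta>)" "\<And>\<theta>. \<theta> \<in> F \<Longrightarrow> f \<theta> \<subseteq> \<E>"
        "\<And>\<theta>. \<theta> \<in> F \<Longrightarrow> C - \<Union>(f \<theta>) \<subseteq> pinst N n \<theta>" by metis
      have "finite (\<Union>(f ` F))" "\<Union>(f ` F) \<subseteq> \<E>" using F(1) f(1,2) by blast+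
      then have "\<not> C \<subseteq> \<Union>(\<Union>(f ` F))" using no by blast
      then obtain a where a: "a \<in> C" "a \<notin> \<Union>(\<Union>(f ` F))" by blast
      then have "a \<in> U n" using definable_subset[OF C] by blast
      moreover have "a \<in> pinst N n \<theta>" if "\<theta> \<in> F" for \<theta>
        using f(3)[OF that] a that by blast
      ultimately show "\<exists>a\<in>U n. \<forall>\<theta>\<in>F. a \<in> pinst N n \<theta>" by blast
    qed blast
    have in_all: "a \<in> C - \<Union>\<F>" if \<F>: "finite \<F>" "\<F> \<subseteq> \<E>" for \<F>
    proof -
      have "definable_over L N (A \<union> P) n (C - (\<Union>E\<in>\<F>. E))"
      proof (rule definable_Diff)
        show "definable_over L N (A \<union> P) n C" using P(3) by (rule definable_over_mono) simp
        show "definable_over L N (A \<union> P) n (\<Union>E\<in>\<F>. E)"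
        proof (rule definable_UN[OF \<F>(1)])
          fix E assume "E \<in> \<F>"
          then have "definable_over L N A n E" using \<F> by (auto simp: \<E>_def)
          then show "definable_over L N (A \<union> P) n E" by (rule definable_over_mono) simp
        qed
      qed
      then obtain \<theta> where \<theta>: "\<theta> \<in> pforms L (A \<union> P) n" "pinst N n \<theta> = C - \<Union>\<F>"
        by (rule pinst_of_definable) auto
      then have "\<theta> \<in> \<Gamma>" using \<F> by (auto simp: \<Gamma>_def)
      then show ?thesis using a(2) \<theta>(2) by blast
    qed
    have "a \<in> C" using in_all[of "{}"] by simp
    then obtain E where "E \<in> \<E>" "a \<in> E" using loc unfolding \<E>_def by blast
    then show False using in_all[of "{E}"] by auto
  qed
  then obtain \<F> where \<F>: "finite \<F>" "\<F> \<subseteq> \<E>" "C \<subseteq> \<Union>\<F>" by blast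
  have "definable_over L N A n (\<Union>E\<in>\<F>. E)"
    by (rule definable_UN[OF \<F>(1)]) (use \<F> in \<open>auto simp: \<E>_def\<close>)
  moreover have "(\<Union>E\<in>\<F>. E) = C" using \<F> by (auto simp: \<E>_def)
  ultimately show ?thesis by simp
qed

section \<open>The type space over a small set\<close>

lemma tp_mem_cyl: "a \<in> U n \<Longrightarrow> \<theta> \<in> pforms L A n \<Longrightarrow> tp L N A a \<in> cyl L N A n \<theta> \<longleftrightarrow> a \<in> pinst N n \<theta>"
  using tp_in_types[of a n A] mem_tp[of a n \<theta> A] by (auto simp: cyl_def)

lemma cyl_mono:
  assumes A: "small A" and \<theta>: "\<theta> \<in> pforms L A n" "\<theta>' \<in> pforms L A n" "pinst N n \<theta> \<subseteq> pinst N n \<theta>'"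
  shows "cyl L N A n \<theta> \<subseteq> cyl L N A n \<theta>'"
proof
  fix p assume p: "p \<in> cyl L N A n \<theta>"
  then have "p \<in> types L N A n" by (simp add: cyl_def)
  then obtain a where "a \<in> U n" "tp L N A a = p" by (rule realize[OF A])
  then show "p \<in> cyl L N A n \<theta>'" using p \<theta> tp_mem_cyl by blast
qed

lemma pforms_univ: "(Neg Falsum, []) \<in> pforms L A n"
  by (simp add: pforms_def forms_def)

lemma pinst_univ: "pinst N n (Neg Falsum, []) = U n"
  by (auto simp: inst_def)

lemma topspace_type_space:
  assumes "small A"
  shows "topspace (type_space L N A n) = types L N A n"
proof -
  have "p \<in> cyl L N A n (Neg Falsum, [])" if p: "p \<in> types L N A n" for p
  proof -
    from p obtain a where "a \<in> U n" "tp L N A a = p" by (rule realize[OF assms])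
    then show ?thesis using tp_mem_cyl[OF _ pforms_univ] pinst_univ by blast
  qed
  then have "types L N A n \<subseteq> \<Union>(cyl L N A n ` pforms L A n)" using pforms_univ by blast
  moreover have "\<Union>(cyl L N A n ` pforms L A n) \<subseteq> types L N A n" by (auto simp: cyl_def)
  ultimately show ?thesis unfolding type_space_def by auto
qed

text \<open>Cylinders are a base, although the topology is only said to be generated by them: a
  conjunction of formulas is again a formula, and types over a small set are realised, which reduces
  inclusions of cylinders to inclusions of definable sets.\<close>

lemma open_contains_cyl:
  assumes A: "small A" and "openin (type_space L N A n) O'" "p \<in> O'"
  obtains \<theta> where "\<theta> \<in> pforms L A n" "p \<in> cyl L N A n \<theta>" "cyl L N A n \<theta> \<subseteq> O'"
proof -
  have "generate_topology_on (cyl L N A n ` pforms L A n) O'"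
    using assms(2) by (simp add: type_space_def openin_topology_generated_by_iff)
  then have "\<forall>p\<in>O'. \<exists>\<theta>\<in>pforms L A n. p \<in> cyl L N A n \<theta> \<and> cyl L N A n \<theta> \<subseteq> O'"
  proof (induction rule: generate_topology_on.induct)
    case (Int V W)
    show ?case
    proof
      fix p assume "p \<in> V \<inter> W"
      then obtain \<theta> \<eta> where *: "\<theta> \<in> pforms L A n" "p \<in> cyl L N A n \<theta>" "cyl L N A n \<theta> \<subseteq> V"
        "\<eta> \<in> pforms L A n" "p \<in> cyl L N A n \<eta>" "cyl L N A n \<eta> \<subseteq> W"
        using Int.IH by blast
      have "definable_over L N A n (pinst N n \<theta> \<inter> pinst N n \<eta>)"
        by (intro definable_Int pinst_definable *)
      then obtain \<zeta> where \<zeta>: "\<zeta> \<in> pforms L A n" "pinst N n \<zeta> = pinst N n \<theta> \<inter> pinst N n \<eta>"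
        by (rule pinst_of_definable)
      have "p \<in> types L N A n" using *(2) by (simp add: cyl_def)
      then obtain a where "a \<in> U n" "tp L N A a = p" by (rule realize[OF A])
      then have "p \<in> cyl L N A n \<zeta>" using \<zeta> * tp_mem_cyl by blast
      moreover have "cyl L N A n \<zeta> \<subseteq> cyl L N A n \<theta>" "cyl L N A n \<zeta> \<subseteq> cyl L N A n \<eta>"
        by (rule cyl_mono[OF A]; use \<zeta> * in blast)+
      ultimately show "\<exists>\<theta>\<in>pforms L A n. p \<in> cyl L N A n \<theta> \<and> cyl L N A n \<theta> \<subseteq> V \<inter> W"
        using \<zeta>(1) * by blast
    qed
  next
    case (UN K)
    then show ?case by (meson Union_iff Union_upper subset_trans)
  qed auto
  then show thesis using that assms(3) by blast
qed

lemma inst_append: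
  assumes "b \<in> U m"
  shows "{a \<in> U n. a @ b \<in> inst N (n + m) \<phi> []} = inst N n \<phi> b"
  using assms by (auto simp: inst_def in_nlists)

text \<open>The representative chosen in \<open>fiber_fun\<close> depends on the type alone, so a
  single \<open>b'\<close> serves all measures and sets.\<close>

lemma fiber_fun_tp:
  assumes "b \<in> U m"
  obtains b' where "b' \<in> U m" "tp L N A b' = tp L N A b"
    "\<And>\<mu> X. fiber_fun L N A n m \<mu> X (tp L N A b) = \<mu> {a \<in> U n. a @ b' \<in> X}"
proof -
  let ?P = "\<lambda>b'. b' \<in> U m \<and> tp L N A b' = tp L N A b"
  have "?P (SOME b'. ?P b')" by (rule someI[of ?P b]) (use assms in simp)
  then show thesis by (intro that[of "SOME b'. ?P b'"]) (auto simp: fiber_fun_def)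
qed

end

section \<open>Morley products\<close>

locale ms_monster = ms_struct L N H + saturated_struct L N \<kappa>
  for L :: "('f, 'r) lang" and N :: "('f, 'r, 'a) struct" and H \<kappa>
begin

lemma keis_values:
  assumes X: "definable L N n X" and Z: "definable L N (n + m) Z"
  obtains V where "finite V" "\<And>b. b \<in> U m \<Longrightarrow> keis X {a \<in> U n. a @ b \<in> Z} \<in> V"
    "\<And>v. v \<in> V \<Longrightarrow> v \<ge> 0"
proof -
  obtain D where D: "finite D" "\<And>b. b \<in> U m \<Longrightarrow> H ({a \<in> U n. a @ b \<in> Z} \<inter> X) \<in> D"
    by (rule fiber_Int_level_over[OF X Z subset_refl]) (rule that)
  show thesis
  proof
    show "finite {v \<in> rat X ` D. v \<ge> 0}" using D(1) by simp
    show "keis X {a \<in> U n. a @ b \<in> Z} \<in> {v \<in> rat X ` D. v \<ge> 0}" if "b \<in> U m" for b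
      using D(2)[OF that] keis_nonneg[OF X definable_fiber[OF Z that]] by (simp add: keis_eq)
  qed simp
qed

text \<open>Finitely many values with A-definable level sets: the fibre function is locally constant
  on the type space, hence continuous, and tuples of equal type lie in the same level set. This
  shows that an admissible small set for the choice in \<open>morley\<close> exists.\<close>

lemma definable_measure_keis:
  assumes A: "small A" and B: "definable_over L N A n B" "B \<noteq> {}"
  shows "definable_measure L N A n (keis B)"
  unfolding definable_measure_def
proof (intro conjI allI ballI impI)
  have AU: "A \<subseteq> univ N" using A by (simp add: small_def)
  have BU: "definable L N n B" using definable_over_mono[OF B(1) AU] .
  show "keisler_measure L N n (keis B)"
    unfolding keisler_measure_def
    using keis_nonneg[OF BU] keis_superset[OF BU B(2) definable_subset[OF BU]] keis_Un[OF BU] by blast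
  fix m \<phi> assume \<phi>: "\<phi> \<in> forms L (n + m)"
  have level: "definable_over L N A m {b \<in> U m. keis B (inst N n \<phi> b) = v}" for v
  proof -
    have "{b \<in> U m. keis B (inst N n \<phi> b) = v} =
        {b \<in> U m. keis B {a \<in> U n. a @ b \<in> inst N (n + m) \<phi> []} = v}"
      by (auto simp: inst_append)
    then show ?thesis using keis_level[OF B(1) definable_0[OF \<phi>] AU, of v] by simp
  qed
  have inv: "keis B (inst N n \<phi> b') = keis B (inst N n \<phi> b)"
    if b: "b \<in> U m" "b' \<in> U m" "tp L N A b = tp L N A b'" for b b'
  proof -
    obtain \<theta> where \<theta>: "\<theta> \<in> pforms L A m"
      "pinst N m \<theta> = {b' \<in> U m. keis B (inst N n \<phi> b') = keis B (inst N n \<phi> b)}"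
      using level by (rule pinst_of_definable)
    have "\<theta> \<in> tp L N A b" unfolding mem_tp[OF b(1)] using \<theta> b(1) by simp
    then have "\<theta> \<in> tp L N A b'" using b(3) by simp
    then have "b' \<in> pinst N m \<theta>" unfolding mem_tp[OF b(2)] by simp
    then show ?thesis using \<theta>(2) by simp
  qed
  then show "keis B (inst N n \<phi> b) = keis B (inst N n \<phi> b')"
    if "b \<in> U m" "b' \<in> U m" "tp L N A b = tp L N A b'" for b b'
    using that by metis
  let ?f = "fiber_fun L N A n m (keis B) (inst N (n + m) \<phi> [])"
  have f: "?f (tp L N A b) = keis B (inst N n \<phi> b)" if "b \<in> U m" for b
  proof -
    obtain b' where b': "b' \<in> U m" "tp L N A b' = tp L N A b"
      "\<And>\<mu> X. fiber_fun L N A n m \<mu> X (tp L N A b) = \<mu> {a \<in> U n. a @ b' \<in> X}"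
      by (rule fiber_fun_tp[OF \<open>b \<in> U m\<close>]) (rule that)
    then show ?thesis using inv[OF that b'(1) b'(2)[symmetric]] inst_append[OF b'(1)] b'(3) by simp
  qed
  show "continuous_map (type_space L N A m) euclideanreal ?f"
  proof (unfold continuous_map_def)
    show "?f \<in> topspace (type_space L N A m) \<rightarrow> topspace euclideanreal \<and>
      (\<forall>O'. openin euclideanreal O' \<longrightarrow>
        openin (type_space L N A m) {p \<in> topspace (type_space L N A m). ?f p \<in> O'})"
    proof (intro conjI allI impI)
      fix O' :: "real set"
      show "openin (type_space L N A m) {p \<in> topspace (type_space L N A m). ?f p \<in> O'}"
      proof (subst openin_subopen, safe)
        fix p assume "p \<in> topspace (type_space L N A m)" and fp: "?f p \<in> O'"
        then obtain b where b: "b \<in> U m" "tp L N A b = p"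
          using realize[OF A] topspace_type_space[OF A] by metis
        obtain \<theta> where \<theta>: "\<theta> \<in> pforms L A m" "pinst N m \<theta> = {b \<in> U m. keis B (inst N n \<phi> b) = ?f p}"
          using level by (rule pinst_of_definable)
        have "openin (type_space L N A m) (cyl L N A m \<theta>)"
          unfolding type_space_def by (rule topology_generated_by_Basis) (use \<theta> in blast)
        moreover have "p \<in> cyl L N A m \<theta>"
          using tp_mem_cyl[OF b(1) \<theta>(1)] b \<theta>(2) f[OF b(1)] by auto
        moreover have "cyl L N A m \<theta> \<subseteq> {p \<in> topspace (type_space L N A m). ?f p \<in> O'}"
        proof
          fix q assume q: "q \<in> cyl L N A m \<theta>"
          then have qt: "q \<in> types L N A m" by (simp add: cyl_def)
          then obtain c where c: "c \<in> U m" "tp L N A c = q" by (rule realize[OF A])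
          then have "?f q = ?f p" using tp_mem_cyl[OF c(1) \<theta>(1)] q \<theta>(2) f[OF c(1)] by auto
          then show "q \<in> {p \<in> topspace (type_space L N A m). ?f p \<in> O'}"
            using fp qt topspace_type_space[OF A] by auto
        qed
        ultimately show "\<exists>T. openin (type_space L N A m) T \<and> p \<in> T \<and>
            T \<subseteq> {p \<in> topspace (type_space L N A m). ?f p \<in> O'}" by blast
      qed
    qed simp
  qed
qed

text \<open>Here B is not assumed to be definable over A; only continuity of the fibre functions
  over A is available. Around each point of the level set it provides an A-definable neighbourhood
  inside the level set, and compactness does the rest.\<close>

lemma level_definable_over:
  assumes A: "small A" and dm: "definable_measure L N A n (keis B)" and B: "definable L N n B"
    and Z: "definable_over L N A (n + m) Z"
  shows "definable_over L N A m {b \<in> U m. keis B {a \<in> U n. a @ b \<in> Z} = v}"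
proof (rule definable_over_if_locally[OF A])
  have AU: "A \<subseteq> univ N" using A by (simp add: small_def)
  have ZU: "definable L N (n + m) Z" using definable_over_mono[OF Z AU] .
  show "definable L N m {b \<in> U m. keis B {a \<in> U n. a @ b \<in> Z} = v}"
    by (rule keis_level[OF B ZU]) simp
  fix b assume "b \<in> {b \<in> U m. keis B {a \<in> U n. a @ b \<in> Z} = v}"
  then have b: "b \<in> U m" "keis B {a \<in> U n. a @ b \<in> Z} = v" by auto
  \<comment> \<open>\<open>definable_measure\<close> speaks about formulas without parameters. The
    parameters \<open>c\<close> of Z are therefore treated as further variables, and the type space
    has \<open>m + q\<close> of them.\<close>
  obtain q \<phi> c where *: "\<phi> \<in> forms L (n + (m + q))" "c \<in> nlists q A" "Z = inst N (n + m) \<phi> c"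
    using Z unfolding definable_over_def by (auto simp: add.assoc)
  have c: "c \<in> U q" using *(2) AU nlists_mono by blast
  have fib: "{a \<in> U n. a @ b \<in> Z} = inst N n \<phi> (b @ c)" if "b \<in> U m" for b
    using that by (auto simp: *(3) inst_def in_nlists)
  let ?X = "inst N (n + (m + q)) \<phi> []"
  let ?f = "fiber_fun L N A n (m + q) (keis B) ?X"
  have inv: "keis B (inst N n \<phi> e) = keis B (inst N n \<phi> e')"
    if "e \<in> U (m + q)" "e' \<in> U (m + q)" "tp L N A e = tp L N A e'" for e e'
    using dm *(1) that unfolding definable_measure_def by blast
  have f: "?f (tp L N A e) = keis B (inst N n \<phi> e)" if e: "e \<in> U (m + q)" for e
  proof -
    obtain e' where e': "e' \<in> U (m + q)" "tp L N A e' = tp L N A e"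
      "\<And>\<mu> X. fiber_fun L N A n (m + q) \<mu> X (tp L N A e) = \<mu> {a \<in> U n. a @ e' \<in> X}"
      by (rule fiber_fun_tp[OF e]) (rule that)
    then show ?thesis using inv[OF e'(1) e e'(2)] inst_append[OF e'(1)] e'(3) by simp
  qed
  obtain V where V: "finite V" "\<And>e. e \<in> U (m + q) \<Longrightarrow> keis B {a \<in> U n. a @ e \<in> ?X} \<in> V"
    by (rule keis_values[OF B definable_0[OF *(1)]]) (rule that)
  have fV: "?f (tp L N A e) \<in> V" if "e \<in> U (m + q)" for e
    using V(2)[OF that] f[OF that] inst_append[OF that] by simp
  \<comment> \<open>Removes the finitely many other values, so \<open>O'\<close> is open and
    \<open>v\<close> is the only value of the fibre function that can lie in it.\<close>
  define O' where "O' = - (V - {v})"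
  have "open O'" unfolding O'_def using V(1) by (intro open_Compl finite_imp_closed) simp
  moreover have "continuous_map (type_space L N A (m + q)) euclideanreal ?f"
    using dm *(1) unfolding definable_measure_def by blast
  ultimately have op: "openin (type_space L N A (m + q)) {p \<in> topspace (type_space L N A (m + q)). ?f p \<in> O'}"
    by (simp add: openin_continuous_map_preimage)
  have bc: "b @ c \<in> U (m + q)" using b c by (intro nlists_appendI)
  have "tp L N A (b @ c) \<in> {p \<in> topspace (type_space L N A (m + q)). ?f p \<in> O'}"
    using tp_in_types[OF bc] topspace_type_space[OF A] f[OF bc] b fib[OF b(1)] by (simp add: O'_def)
  then obtain \<theta> where \<theta>: "\<theta> \<in> pforms L A (m + q)" "tp L N A (b @ c) \<in> cyl L N A (m + q) \<theta>"
    "cyl L N A (m + q) \<theta> \<subseteq> {p \<in> topspace (type_space L N A (m + q)). ?f p \<in> O'}"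
    using open_contains_cyl[OF A op] by blast
  define E where "E = {b' \<in> U m. b' @ c \<in> pinst N (m + q) \<theta>}"
  have "definable_over L N A m E"
    unfolding E_def by (rule definable_over_fiber[OF pinst_definable[OF \<theta>(1)] *(2) AU])
  moreover have "b \<in> E"
    using tp_mem_cyl[OF bc \<theta>(1)] \<theta>(2) b(1) by (simp add: E_def)
  moreover have "E \<subseteq> {b \<in> U m. keis B {a \<in> U n. a @ b \<in> Z} = v}"
  proof
    fix b' assume "b' \<in> E"
    then have b': "b' \<in> U m" "b' @ c \<in> pinst N (m + q) \<theta>" by (auto simp: E_def)
    then have b'c: "b' @ c \<in> U (m + q)" using c by (intro nlists_appendI)
    have "?f (tp L N A (b' @ c)) \<in> O'" using tp_mem_cyl[OF b'c \<theta>(1)] b'(2) \<theta>(3) by blast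
    then have "?f (tp L N A (b' @ c)) = v" using fV[OF b'c] by (auto simp: O'_def)
    then show "b' \<in> {b \<in> U m. keis B {a \<in> U n. a @ b \<in> Z} = v}"
      using f[OF b'c] fib[OF b'(1)] b'(1) by simp
  qed
  ultimately show "\<exists>E. definable_over L N A m E \<and> b \<in> E \<and> E \<subseteq> {b \<in> U m. keis B {a \<in> U n. a @ b \<in> Z} = v}"
    by blast
qed

text \<open>Only the upper bound is needed, and it also holds if the premeasure of \<open>type_measure\<close> does not
  extend, since \<open>extend_measure\<close> is then the null measure.\<close>

lemma integral_fiber_fun_le:
  assumes A: "small A" and dm: "definable_measure L N A n (keis B)" and B: "definable L N n B" "B \<noteq> {}"
    and Y: "definable L N m Y" "Y \<noteq> {}" and Z: "definable_over L N A (n + m) Z"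
    and \<nu>: "\<And>C. definable L N m C \<Longrightarrow> \<nu> C \<le> keis Y C"
  shows "integral\<^sup>L (type_measure L N A m \<nu>) (fiber_fun L N A n m (keis B) Z) \<le> keis (prodset B Y) Z"
proof -
  have AU: "A \<subseteq> univ N" using A by (simp add: small_def)
  have ZU: "definable L N (n + m) Z" using definable_over_mono[OF Z AU] .
  let ?M = "type_measure L N A m \<nu>" and ?f = "fiber_fun L N A n m (keis B) Z"
  let ?C = "\<lambda>v. {b \<in> U m. keis B {a \<in> U n. a @ b \<in> Z} = v}"
  obtain V where V: "finite V" "\<And>b. b \<in> U m \<Longrightarrow> keis B {a \<in> U n. a @ b \<in> Z} \<in> V" "\<And>v. v \<in> V \<Longrightarrow> v \<ge> 0"
    using keis_values[OF B(1) ZU] by blast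
  have "\<forall>v. \<exists>\<theta>. \<theta> \<in> pforms L A m \<and> pinst N m \<theta> = ?C v"
  proof
    fix v
    show "\<exists>\<theta>. \<theta> \<in> pforms L A m \<and> pinst N m \<theta> = ?C v"
      using level_definable_over[OF A dm B(1) Z, of v] by (rule pinst_of_definable) blast
  qed
  from choice[OF this] obtain \<theta> where "\<forall>v. \<theta> v \<in> pforms L A m \<and> pinst N m (\<theta> v) = ?C v" ..
  then have \<theta>: "\<And>v. \<theta> v \<in> pforms L A m" "\<And>v. pinst N m (\<theta> v) = ?C v" by simp_all
  have cylP: "cyl L N A m ` pforms L A m \<subseteq> Pow (types L N A m)" by (auto simp: cyl_def)
  have space: "space ?M = types L N A m" unfolding type_measure_def by (rule space_extend_measure[OF cylP])
  have sets: "cyl L N A m (\<theta> v) \<in> sets ?M" for v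
    unfolding type_measure_def sets_extend_measure[OF cylP] using \<theta>(1) by blast
  have em: "emeasure ?M (cyl L N A m (\<theta> v)) \<le> ennreal (\<nu> (?C v))" for v
    unfolding type_measure_def
    using emeasure_extend_measure_le[OF cylP \<theta>(1)[of v], of "\<lambda>\<eta>. ennreal (\<nu> (pinst N m \<eta>))"]
    by (simp only: \<theta>(2))
  have fin: "emeasure ?M (cyl L N A m (\<theta> v)) < \<infinity>" for v
    using le_less_trans[OF em, of v \<infinity>] by simp
  have dC: "definable L N m (?C v)" for v by (rule keis_level[OF B(1) ZU]) simp
  have me: "measure ?M (cyl L N A m (\<theta> v)) \<le> keis Y (?C v)" for v
  proof -
    have "ennreal (measure ?M (cyl L N A m (\<theta> v))) \<le> ennreal (\<nu> (?C v))"
      using em[of v] fin[of v] by (simp add: emeasure_eq_ennreal_measure less_top[symmetric])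
    also have "\<dots> \<le> ennreal (keis Y (?C v))" by (rule ennreal_leI[OF \<nu>[OF dC]])
    finally show ?thesis using keis_nonneg[OF Y(1) dC] by (simp add: ennreal_le_iff)
  qed
  \<comment> \<open>A simple function: each type lies in exactly one of the cylinders
    \<open>\<theta> v\<close> with \<open>v \<in> V\<close>, namely the one for the value at its
    representative.\<close>
  have f: "?f p = (\<Sum>v\<in>V. v * indicator (cyl L N A m (\<theta> v)) p)" if "p \<in> space ?M" for p
  proof -
    from that obtain b where b: "b \<in> U m" "tp L N A b = p"
      using realize[OF A] space by metis
    obtain b' where b': "b' \<in> U m" "tp L N A b' = tp L N A b"
      "\<And>\<mu> X. fiber_fun L N A n m \<mu> X (tp L N A b) = \<mu> {a \<in> U n. a @ b' \<in> X}"
      by (rule fiber_fun_tp[OF b(1)]) (rule that)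
    have "p \<in> cyl L N A m (\<theta> v) \<longleftrightarrow> v = ?f p" for v
      using tp_mem_cyl[OF b'(1) \<theta>(1), of v] b b' by (auto simp: \<theta>(2))
    then have "(\<Sum>v\<in>V. v * indicator (cyl L N A m (\<theta> v)) p) = (\<Sum>v\<in>V. if v = ?f p then ?f p else 0)"
      by (intro sum.cong) (auto simp: indicator_def)
    also have "\<dots> = ?f p" using V(1,2) b b' by auto
    finally show ?thesis by simp
  qed
  have "integral\<^sup>L ?M ?f = integral\<^sup>L ?M (\<lambda>p. \<Sum>v\<in>V. v * indicator (cyl L N A m (\<theta> v)) p)"
    by (rule Bochner_Integration.integral_cong) (use f in auto)
  also have "\<dots> = (\<Sum>v\<in>V. v * measure ?M (cyl L N A m (\<theta> v)))"
    using sets fin sets.sets_into_space[OF sets]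
    by (simp add: Bochner_Integration.integral_sum integrable_real_indicator inf.absorb1 less_top[symmetric])
  also have "\<dots> \<le> (\<Sum>v\<in>V. v * keis Y (?C v))"
    by (intro sum_mono mult_left_mono me V(3))
  also have "\<dots> = keis (prodset B Y) Z"
    by (rule keis_integral[symmetric, OF B Y ZU V(1,2)])
  finally show ?thesis .
qed

text \<open>The finitely many parameters of B and Z form an admissible small set, so the chosen A is
  admissible too. Nothing else is known about it, and the bound on the integral holds for every
  admissible A.\<close>

lemma morley_le:
  assumes B: "definable L N n B" "B \<noteq> {}" and Y: "definable L N m Y" "Y \<noteq> {}"
    and Z: "definable L N (n + m) Z"
    and \<nu>: "\<And>C. definable L N m C \<Longrightarrow> \<nu> C \<le> keis Y C"
  shows "morley \<kappa> L N n m (keis B) \<nu> Z \<le> keis (prodset B Y) Z"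
proof -
  let ?P = "\<lambda>A. A \<subseteq> univ N \<and> |A| <o \<kappa> \<and> definable_measure L N A n (keis B) \<and> definable_over L N A (n + m) Z"
  obtain F where F: "finite F" "F \<subseteq> univ N" "definable_over L N F n B"
    using B(1) by (rule definable_finite_params)
  obtain G where G: "finite G" "G \<subseteq> univ N" "definable_over L N G (n + m) Z"
    using Z by (rule definable_finite_params)
  have s: "small (F \<union> G)" using F G by (intro small_finite) auto
  have FG: "definable_over L N (F \<union> G) n B" "definable_over L N (F \<union> G) (n + m) Z"
    using F(3) G(3) by (auto intro: definable_over_mono)
  have "?P (F \<union> G)"
    using s definable_measure_keis[OF s FG(1) B(2)] FG(2) by (auto simp: small_def)
  then have "?P (SOME A. ?P A)" by (rule someI)
  then show ?thesis
    unfolding morley_def Let_def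
    by (intro integral_fiber_fun_le B Y \<nu>) (auto simp: small_def)
qed

text \<open>The new factor is placed on the left, to match the recursion of
  \<open>morley_power\<close>.\<close>

fun Bpow :: "'a list set \<Rightarrow> nat \<Rightarrow> 'a list set" where
  "Bpow B 0 = {[]}"
| "Bpow B (Suc k) = prodset B (Bpow B k)"

lemma Bpow_1: "Bpow B (Suc 0) = B"
  by auto

lemma Bpow_ne: "B \<noteq> {} \<Longrightarrow> Bpow B k \<noteq> {}"
  by (induction k) auto

lemma definable_Bpow: "definable L N m B \<Longrightarrow> definable L N (k * m) (Bpow B k)"
proof (induction k)
  case 0
  show ?case using definable_U[of _ 0] by simp
next
  case (Suc k)
  then show ?case using definable_prodset[of "univ N" m B "k * m" "Bpow B k"] by simp
qed

text \<open>The induction carries an inequality only; this is exactly what \<open>morley_le\<close>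
  asks of its inner measure.\<close>

lemma morley_power_le:
  assumes B: "definable L N m B" "B \<noteq> {}"
  shows "definable L N (Suc k * m) Z \<Longrightarrow> morley_power \<kappa> L N m (keis B) (Suc k) Z \<le> keis (Bpow B (Suc k)) Z"
proof (induction k arbitrary: Z)
  case 0
  then show ?case by (simp only: Bpow_1 morley_power.simps)
next
  case (Suc k)
  have "morley \<kappa> L N m (Suc k * m) (keis B) (morley_power \<kappa> L N m (keis B) (Suc k)) Z \<le>
      keis (prodset B (Bpow B (Suc k))) Z"
    by (rule morley_le[OF B definable_Bpow[OF B(1)] Bpow_ne[OF B(2)] _ Suc.IH])
      (use Suc.prems in simp_all)
  then show ?case by (simp only: morley_power.simps Bpow.simps(2)[of B "Suc k"])
qed

end

section \<open>Fractional Helly\<close>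

text \<open>Block \<open>i\<close> of the concatenation starts at \<open>i * m\<close>.
  Quantification over the entries of a list thus becomes a conjunction over indices, which a formula
  can express.\<close>

lemma chunks:
  assumes "bs \<in> nlists k (nlists m A)"
  shows "concat bs \<in> nlists (k * m) A"
    "(\<forall>b\<in>set bs. P b) \<longleftrightarrow> (\<forall>i<k. P (take m (drop (i * m) (concat bs))))"
  using assms
proof (induction bs arbitrary: k)
  case Nil
  { case 1 then show ?case by (simp add: in_nlists) }
  { case 2 then show ?case by (simp add: in_nlists) }
next
  case (Cons b bs)
  { case 1
    then obtain k' where "k = Suc k'" "b \<in> nlists m A" "bs \<in> nlists k' (nlists m A)" by blast
    then show ?case using Cons.IH(1)[of k'] by (auto intro: nlists_appendI) }
  { case 2
    then obtain k' where *: "k = Suc k'" "b \<in> nlists m A" "bs \<in> nlists k' (nlists m A)" by blast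
    have "length b = m" using *(2) by (simp add: in_nlists)
    then show ?case using Cons.IH(2)[OF *(3)] *(1) by (simp add: All_less_Suc2) }
qed

lemma chunks_ex: "c \<in> nlists (k * m) A \<Longrightarrow> \<exists>bs\<in>nlists k (nlists m A). concat bs = c"
proof (induction k arbitrary: c)
  case (Suc k)
  then have "c \<in> nlists (m + k * m) A" by simp
  then obtain b c' where "c = b @ c'" "b \<in> nlists m A" "c' \<in> nlists (k * m) A" by (rule nlists_split)
  then show ?case using Suc.IH[of c'] by (metis concat.simps(2) Cons_in_nlists_Suc)
qed simp

text \<open>Each step either produces the desired point or cuts down the dimension of X by intersecting it
  with a further set, and the latter happens at most \<open>dim X\<close> times.\<close>

lemma descent:
  fixes q :: "nat \<Rightarrow> 'x \<Rightarrow> real" and dim :: "'x \<Rightarrow> nat"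
  assumes step: "\<And>r j X \<alpha>. X \<in> Fam j \<Longrightarrow> j + Suc r \<le> k \<Longrightarrow> \<alpha> > 0 \<Longrightarrow> q (Suc r) X > \<alpha> \<Longrightarrow>
      Q (c * \<alpha>) \<or> (\<exists>Y\<in>Fam (Suc j). dim Y < dim X \<and> q r Y > \<alpha> / 2)"
    and mono: "\<And>s t. Q t \<Longrightarrow> s \<le> t \<Longrightarrow> Q s" and "c > 0"
  shows "X \<in> Fam j \<Longrightarrow> j + r \<le> k \<Longrightarrow> dim X < r \<Longrightarrow> \<alpha> > 0 \<Longrightarrow> q r X > \<alpha> \<Longrightarrow> Q (c * \<alpha> / 2 ^ r)"
\<comment> \<open>The case \<open>r = 0\<close> contradicts \<open>dim X < r\<close>. In a descent
  step \<open>r\<close> and the dimension both drop, so the bound persists, and the halvings of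
  \<open>\<alpha>\<close> accumulate to \<open>2 ^ r\<close>.\<close>
proof (induction r arbitrary: X j \<alpha>)
  case (Suc r)
  from step[OF Suc.prems(1,2,4,5)] show ?case
  proof
    assume "Q (c * \<alpha>)"
    \<comment> \<open>Stopping early yields a larger bound than the one claimed.\<close>
    moreover have "c * \<alpha> / 2 ^ Suc r \<le> c * \<alpha> / 1"
      using \<open>c > 0\<close> Suc.prems(4) one_le_power[of "2 :: real" "Suc r"]
      by (intro divide_left_mono) (auto simp del: power_Suc)
    ultimately show ?thesis using mono by simp
  next
    assume "\<exists>Y\<in>Fam (Suc j). dim Y < dim X \<and> q r Y > \<alpha> / 2"
    then obtain Y where "Y \<in> Fam (Suc j)" "dim Y < dim X" "q r Y > \<alpha> / 2" by blast
    then have "Q (c * (\<alpha> / 2) / 2 ^ r)"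
      using Suc.prems by (intro Suc.IH[of Y "Suc j"]) auto
    then show ?thesis by (simp add: field_simps)
  qed
qed simp

locale ms_formula = ms_struct L N H
  for L :: "('f, 'r) lang" and N :: "('f, 'r, 'a) struct" and H +
  fixes \<phi> :: "('f, 'r) fm" and n m :: nat
  assumes \<phi>: "\<phi> \<in> forms L (n + m)"
begin

section \<open>Intersections of instances of the formula\<close>

abbreviation S :: "'a list \<Rightarrow> 'a list set" where
  "S b \<equiv> inst N n \<phi> b"

definition Fam :: "nat \<Rightarrow> 'a list set set" where
  "Fam j = {{a \<in> U n. \<forall>b\<in>set bs. holds N \<phi> (a @ b)} | bs. bs \<in> nlists j (U m)}"

lemma U_Fam: "U n \<in> Fam 0"
  by (auto simp: Fam_def)

lemma Fam_Int:
  assumes "X \<in> Fam j" "b \<in> U m"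
  shows "X \<inter> S b \<in> Fam (Suc j)"
proof -
  obtain bs where "bs \<in> nlists j (U m)" "X = {a \<in> U n. \<forall>b\<in>set bs. holds N \<phi> (a @ b)}"
    using assms(1) by (auto simp: Fam_def)
  then show ?thesis
    unfolding Fam_def using assms(2) by (intro CollectI exI[of _ "b # bs"]) (auto simp: inst_def)
qed

lemma definable_S: "b \<in> U m \<Longrightarrow> definable L N n (S b)"
  using \<phi> unfolding definable_over_def by blast

lemma Fam_definable:
  assumes "X \<in> Fam j"
  shows "definable L N n X"
proof -
  obtain bs where bs: "bs \<in> nlists j (U m)" "X = {a \<in> U n. \<forall>b\<in>set bs. holds N \<phi> (a @ b)}"
    using assms by (auto simp: Fam_def)
  then have "set bs \<subseteq> U m" by (simp add: in_nlists)
  then have "definable L N n (U n \<inter> {a \<in> U n. \<forall>b\<in>set bs. holds N \<phi> (a @ b)})"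
  proof (induction bs)
    case Nil
    then show ?case by (simp add: definable_U)
  next
    case (Cons b bs)
    have "definable L N n (S b \<inter> (U n \<inter> {a \<in> U n. \<forall>b\<in>set bs. holds N \<phi> (a @ b)}))"
      by (rule definable_Int[OF definable_S Cons.IH]) (use Cons.prems in auto)
    moreover have "S b \<inter> (U n \<inter> {a \<in> U n. \<forall>b\<in>set bs. holds N \<phi> (a @ b)}) =
        U n \<inter> {a \<in> U n. \<forall>b\<in>set (b # bs). holds N \<phi> (a @ b)}"
      by (auto simp: inst_def)
    ultimately show ?case by simp
  qed
  then show ?thesis using bs(2) by (simp add: Int_absorb1)
qed

lemma dfn_chunk:
  assumes "i < r"
  shows "dfn K (r * m + n) (\<lambda>_ as. holds N \<phi> (drop (r * m) as @ take m (drop (i * m) (take (r * m) as))))"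
proof -
  have "Suc i * m \<le> r * m" using assms by (intro mult_le_mono1) simp
  then have *: "m + i * m \<le> r * m" by simp
  have "coord (r * m + n) (n + m) (\<lambda>as. drop (r * m) as @ take m (drop (i * m) as))"
    by (intro coord_intros) (use * in auto)
  moreover have "take m (drop (i * m) (take (r * m) as)) = take m (drop (i * m) as)" for as :: "'a list"
    using * by (simp add: drop_take min_def)
  ultimately show ?thesis
    using dfn_comp[OF dfn_holds[OF \<phi>], of "r * m + n" "\<lambda>as. drop (r * m) as @ take m (drop (i * m) as)" K]
    by simp
qed

text \<open>All members of \<open>Fam j\<close> are instances of one formula, whose parameter tuple
  is the concatenation of the j parameters.\<close>

lemma Fam_values: "\<exists>D. finite D \<and> (\<forall>X\<in>Fam j. H X \<in> D)"
proof -
  have "dfn {} (j * m + n) (\<lambda>_ as. \<forall>i\<in>{..<j}. holds N \<phi> (drop (j * m) as @ take m (drop (i * m) (take (j * m) as))))"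
    by (intro dfn_finite_all dfn_chunk) auto
  then have "dfn {} (n + j * m) (\<lambda>_ as. \<forall>i\<in>{..<j}. holds N \<phi>
      (drop (j * m) (drop n as @ take n as) @ take m (drop (i * m) (take (j * m) (drop n as @ take n as)))))"
    by (rule dfn_comp) (intro coord_intros; simp)
  then have "dfn {} (n + j * m) (\<lambda>_ as. \<forall>i<j. holds N \<phi> (take n as @ take m (drop (i * m) (drop n as))))"
    by (rule dfn_cong) (auto simp: in_nlists)
  then obtain cs \<psi> where "set cs \<subseteq> ({} :: (unit \<Rightarrow> 'a) set)" "\<psi> \<in> forms L (n + j * m + length cs)"
    "\<And>i as. as \<in> U (n + j * m) \<Longrightarrow> (\<forall>i<j. holds N \<phi> (take n as @ take m (drop (i * m) (drop n as)))) \<longleftrightarrow>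
       holds N \<psi> (as @ map (\<lambda>c. c i) cs)"
    by (rule dfnE) (rule that)
  then have \<psi>: "\<psi> \<in> forms L (n + j * m)"
    "\<And>as. as \<in> U (n + j * m) \<Longrightarrow> (\<forall>i<j. holds N \<phi> (take n as @ take m (drop (i * m) (drop n as)))) \<longleftrightarrow> holds N \<psi> as"
    by auto
  obtain D where D: "finite D" "\<And>c. c \<in> U (j * m) \<Longrightarrow> H (inst N n \<psi> c) \<in> D"
    using values_finite[OF \<psi>(1)] by blast
  have "H X \<in> D" if X: "X \<in> Fam j" for X
  proof -
    obtain bs where bs: "bs \<in> nlists j (U m)" "X = {a \<in> U n. \<forall>b\<in>set bs. holds N \<phi> (a @ b)}"
      using X by (auto simp: Fam_def)
    let ?c = "concat bs"
    have c: "?c \<in> U (j * m)" by (rule chunks(1)[OF bs(1)])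
    have "(\<forall>b\<in>set bs. holds N \<phi> (a @ b)) \<longleftrightarrow> holds N \<psi> (a @ ?c)" if "a \<in> U n" for a
      using chunks(2)[OF bs(1), of "\<lambda>b. holds N \<phi> (a @ b)"] \<psi>(2)[OF nlists_appendI[OF that c]] that
      by (simp add: in_nlists)
    then have "X = inst N n \<psi> ?c" by (auto simp: bs(2) inst_def)
    then show ?thesis using D(2)[OF c] by simp
  qed
  then show ?thesis using D(1) by blast
qed

lemma ratio_bound:
  obtains \<epsilon> where "\<epsilon> > 0"
    "\<And>X j b. X \<in> Fam j \<Longrightarrow> j < k \<Longrightarrow> b \<in> U m \<Longrightarrow> X \<inter> S b \<noteq> {} \<Longrightarrow> fst (H (X \<inter> S b)) = fst (H X) \<Longrightarrow>
      \<epsilon> \<le> keis X (S b)"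
proof -
  have "\<forall>j. \<exists>D. finite D \<and> (\<forall>X\<in>Fam j. H X \<in> D)" using Fam_values by blast
  from choice[OF this] obtain D where D: "\<And>j. finite (D j)" "\<And>j X. X \<in> Fam j \<Longrightarrow> H X \<in> D j" by auto
  \<comment> \<open>Both \<open>X\<close>, from \<open>Fam j\<close> with \<open>j < k\<close>, and
    \<open>X \<inter> S b\<close>, from \<open>Fam (Suc j)\<close>, have their values here. Only the
    positive ratios of such values can occur; 1 is added below so that the minimum is over a
    non-empty set.\<close>
  define E where "E = (\<Union>j\<le>k. D j)"
  define R where "R = {r \<in> (\<lambda>(p, q). snd p / snd q) ` (E \<times> E). r > (0 :: real)}"
  have fin: "finite (insert 1 R)" unfolding R_def E_def using D(1) by simp
  show thesis
  proof
    show "Min (insert 1 R) > 0" using fin by (subst Min_gr_iff) (auto simp: R_def)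
    fix X j b assume *: "X \<in> Fam j" "j < k" "b \<in> U m" "X \<inter> S b \<noteq> {}" "fst (H (X \<inter> S b)) = fst (H X)"
    have F: "X \<inter> S b \<in> Fam (Suc j)" using Fam_Int * by blast
    have "snd (H (X \<inter> S b)) > 0" by (rule H_pos[OF Fam_definable[OF F] *(4)])
    moreover have "snd (H X) > 0" using H_pos[OF Fam_definable[OF *(1)]] *(4) by blast
    moreover have "H X \<in> E" "H (X \<inter> S b) \<in> E"
      using D(2)[OF *(1)] D(2)[OF F] *(2) by (auto simp: E_def Suc_le_eq)
    ultimately have "snd (H (X \<inter> S b)) / snd (H X) \<in> R"
      unfolding R_def by (auto intro!: image_eqI[of _ _ "(H (X \<inter> S b), H X)"])
    moreover have "keis X (S b) = snd (H (X \<inter> S b)) / snd (H X)"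
      using *(5) by (simp add: ms_keisler_def Int_commute)
    ultimately show "Min (insert 1 R) \<le> keis X (S b)" using fin by simp
  qed
qed

section \<open>Consistent tuples\<close>

definition con :: "nat \<Rightarrow> 'a list set \<Rightarrow> 'a list set" where
  "con r X = {c \<in> U (r * m). \<exists>a\<in>X. \<forall>i<r. holds N \<phi> (a @ take m (drop (i * m) c))}"

lemma definable_con:
  assumes "definable L N n X"
  shows "definable L N (r * m) (con r X)"
proof -
  have "dfn (kset (univ N)) (r * m + n) (\<lambda>_ as. drop (r * m) as \<in> X \<and>
      (\<forall>i\<in>{..<r}. holds N \<phi> (drop (r * m) as @ take m (drop (i * m) (take (r * m) as)))))"
    by (intro dfn_and dfn_mem[OF assms] dfn_finite_all dfn_chunk coord_intros) auto
  then have "definable L N (r * m) {c \<in> U (r * m). \<exists>a\<in>U n. a \<in> X \<and>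
      (\<forall>i\<in>{..<r}. holds N \<phi> (a @ take m (drop (i * m) c)))}"
    by (intro definable_Collect dfn_bex)
  moreover have "{c \<in> U (r * m). \<exists>a\<in>U n. a \<in> X \<and> (\<forall>i\<in>{..<r}. holds N \<phi> (a @ take m (drop (i * m) c)))} = con r X"
    using definable_subset[OF assms] by (auto simp: con_def)
  ultimately show ?thesis by simp
qed

text \<open>The recursion behind the descent: fixing the first component \<open>b\<close> of a tuple
  replaces X by \<open>X \<inter> S b\<close> and lowers the number of components by one.\<close>

lemma con_fiber:
  assumes "b \<in> U m" "X \<subseteq> U n"
  shows "{c \<in> U (r * m). b @ c \<in> con (Suc r) X} = con r (X \<inter> S b)"
proof -
  have "length b = m" using assms(1) by (simp add: in_nlists)
  then show ?thesis
    using assms nlists_appendI[OF assms(1)] by (auto simp: con_def All_less_Suc2 inst_def subset_iff)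
qed

lemma consistent_tuples_eq: "consistent_tuples N n m k \<phi> = con k (U n)"
proof
  show "consistent_tuples N n m k \<phi> \<subseteq> con k (U n)"
  proof
    fix c assume "c \<in> consistent_tuples N n m k \<phi>"
    then obtain bs a where *: "c = concat bs" "bs \<in> nlists k (U m)" "a \<in> U n" "\<forall>b\<in>set bs. holds N \<phi> (a @ b)"
      by (auto simp: consistent_tuples_def)
    then show "c \<in> con k (U n)"
      using chunks(1)[OF *(2)] chunks(2)[OF *(2), of "\<lambda>b. holds N \<phi> (a @ b)"] by (auto simp: con_def)
  qed
  show "con k (U n) \<subseteq> consistent_tuples N n m k \<phi>"
  proof
    fix c assume "c \<in> con k (U n)"
    then obtain a where a: "c \<in> U (k * m)" "a \<in> U n" "\<forall>i<k. holds N \<phi> (a @ take m (drop (i * m) c))"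
      by (auto simp: con_def)
    then obtain bs where bs: "bs \<in> nlists k (U m)" "concat bs = c" using chunks_ex by blast
    then have "\<forall>b\<in>set bs. holds N \<phi> (a @ b)"
      using chunks(2)[OF bs(1), of "\<lambda>b. holds N \<phi> (a @ b)"] a(3) by simp
    then show "c \<in> consistent_tuples N n m k \<phi>"
      using a(2) bs unfolding consistent_tuples_def by blast
  qed
qed

text \<open>Non-emptiness is positivity of the measure, so the condition depends only on the value
  of \<open>X \<inter> S b\<close> and defines a finite union of level sets.\<close>

lemma definable_good:
  assumes "definable L N n X"
  shows "definable L N m {b \<in> U m. X \<inter> S b \<noteq> {} \<and> fst (H (X \<inter> S b)) = fst (H X)}"
proof -
  have Z: "definable L N (n + m) (inst N (n + m) \<phi> [])" by (rule definable_0[OF \<phi>])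
  have fib: "{a \<in> U n. a @ b \<in> inst N (n + m) \<phi> []} = S b" if "b \<in> U m" for b
    using that by (auto simp: inst_def in_nlists)
  obtain D where D: "finite D" "\<And>b. b \<in> U m \<Longrightarrow> H ({a \<in> U n. a @ b \<in> inst N (n + m) \<phi> []} \<inter> X) \<in> D"
    "\<And>p. definable L N m {b \<in> U m. H ({a \<in> U n. a @ b \<in> inst N (n + m) \<phi> []} \<inter> X) = p}"
    by (rule fiber_Int_level_over[OF assms Z subset_refl]) (rule that)
  define E where "E = {p \<in> D. snd p > 0 \<and> fst p = fst (H X)}"
  have "{b \<in> U m. X \<inter> S b \<noteq> {} \<and> fst (H (X \<inter> S b)) = fst (H X)} =
      (\<Union>p\<in>E. {b \<in> U m. H ({a \<in> U n. a @ b \<in> inst N (n + m) \<phi> []} \<inter> X) = p})" (is "?l = ?r")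
  proof (rule set_eqI)
    fix b
    show "b \<in> ?l \<longleftrightarrow> b \<in> ?r"
    proof (cases "b \<in> U m")
      case True
      have "X \<inter> S b \<noteq> {} \<longleftrightarrow> snd (H (X \<inter> S b)) > 0"
        using H_pos[OF definable_Int[OF assms definable_S[OF True]]] H_empty by auto
      moreover have "H (X \<inter> S b) \<in> D" using D(2)[OF True] fib[OF True] by (simp add: Int_commute)
      ultimately show ?thesis using True fib[OF True] by (auto simp: E_def Int_commute)
    qed simp
  qed
  then show ?thesis using definable_UN[of E "univ N" m] D(1,3) by (simp add: E_def)
qed

text \<open>Instantiates \<open>descent\<close> with the measure of consistent tuples. The powers of
  B enter as \<open>Bp\<close>, through their recursion, and the bound \<open>\<beta>\<close> is
  fixed before B.\<close>

lemma helly_measure: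
  assumes k: "fst (H (U n)) < k" and "\<alpha> > 0"
  obtains \<beta> where "\<beta> > 0"
    "\<And>B Bp. definable L N m B \<Longrightarrow> B \<noteq> {} \<Longrightarrow> Bp 0 = {[]} \<Longrightarrow> (\<And>r. Bp (Suc r) = prodset B (Bp r)) \<Longrightarrow>
      keis (Bp k) (con k (U n)) > \<alpha> \<Longrightarrow> \<exists>a\<in>U n. keis B {b \<in> U m. holds N \<phi> (a @ b)} > \<beta>"
proof -
  obtain \<epsilon> where \<epsilon>: "\<epsilon> > 0"
    "\<And>X j b. X \<in> Fam j \<Longrightarrow> j < k \<Longrightarrow> b \<in> U m \<Longrightarrow> X \<inter> S b \<noteq> {} \<Longrightarrow> fst (H (X \<inter> S b)) = fst (H X) \<Longrightarrow>
      \<epsilon> \<le> keis X (S b)"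
    using ratio_bound[of k] by blast
  show thesis
  proof
    \<comment> \<open>With \<open>\<gamma>\<close> the current bound, \<open>\<epsilon>\<close>
      times \<open>\<gamma> / 2\<close> bounds the mass of the incidence relation on X and B from
      below; \<open>\<epsilon> / 4 * \<gamma>\<close> at every point of X would be too little. The
      power of 2 comes from the descent.\<close>
    show "\<epsilon> / 4 * \<alpha> / 2 ^ k > 0" using \<epsilon>(1) \<open>\<alpha> > 0\<close> by simp
    fix B Bp assume B: "definable L N m B" "B \<noteq> {}" and Bp: "Bp 0 = {[]}" "\<And>r. Bp (Suc r) = prodset B (Bp r)"
      and big: "keis (Bp k) (con k (U n)) > \<alpha>"
    have Bpd: "definable L N (r * m) (Bp r)" for r
    proof (induction r)
      case 0
      then show ?case using definable_U[of _ 0] by (simp add: Bp)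
    next
      case (Suc r)
      then show ?case using definable_prodset[OF B(1) Suc] by (simp add: Bp)
    qed
    have Bpne: "Bp r \<noteq> {}" for r by (induction r) (use B Bp in auto)
    let ?\<Phi> = "inst N (n + m) \<phi> []"
    have \<Phi>: "definable L N (n + m) ?\<Phi>" by (rule definable_0[OF \<phi>])
    have fib: "{a \<in> U n. a @ b \<in> ?\<Phi>} = S b" if "b \<in> U m" for b
      using that by (auto simp: inst_def in_nlists)
    let ?Q = "\<lambda>t. \<exists>a\<in>U n. keis B {b \<in> U m. holds N \<phi> (a @ b)} > t"
    show "?Q (\<epsilon> / 4 * \<alpha> / 2 ^ k)"
    proof (rule descent[where q = "\<lambda>r X. keis (Bp r) (con r X)" and dim = "\<lambda>X. fst (H X)" and Fam = Fam
          and j = 0 and X = "U n" and k = k and Q = ?Q])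
      fix r j X and \<gamma> :: real
      assume X: "X \<in> Fam j" and j: "j + Suc r \<le> k" and "\<gamma> > 0" and gt: "\<gamma> < keis (Bp (Suc r)) (con (Suc r) X)"
      have Xd: "definable L N n X" by (rule Fam_definable[OF X])
      show "?Q (\<epsilon> / 4 * \<gamma>) \<or> (\<exists>Y\<in>Fam (Suc j). fst (H Y) < fst (H X) \<and> \<gamma> / 2 < keis (Bp r) (con r Y))"
      proof (rule disjCI)
        assume "\<not> (\<exists>Y\<in>Fam (Suc j). fst (H Y) < fst (H X) \<and> \<gamma> / 2 < keis (Bp r) (con r Y))"
        then have small: "keis (Bp r) (con r Y) \<le> \<gamma> / 2" if "Y \<in> Fam (Suc j)" "fst (H Y) < fst (H X)" for Y
          using that by fastforce
        define G where "G = {b \<in> U m. X \<inter> S b \<noteq> {} \<and> fst (H (X \<inter> S b)) = fst (H X)}"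
        have G: "definable L N m G" unfolding G_def by (rule definable_good[OF Xd])
        have W: "definable L N (m + r * m) (con (Suc r) X)" using definable_con[OF Xd, of "Suc r"] by simp
        \<comment> \<open>Fubini fibres over the last block, while the descent fixes the first
          component; hence the swap. For b outside \<open>G\<close>, either
          \<open>X \<inter> S b\<close> is empty and has no consistent tuples, or its dimension
          drops and \<open>small\<close> applies.\<close>
        have "keis (prodset (Bp r) B) (swap m ` con (Suc r) X) \<le> keis B G + \<gamma> / 2"
        proof (rule keis_fubini_le[OF Bpd Bpne B definable_swap[OF W] G])
          fix b assume b: "b \<in> B - G"
          then have bU: "b \<in> U m" using definable_subset[OF B(1)] by blast
          have F: "X \<inter> S b \<in> Fam (Suc j)" by (rule Fam_Int[OF X bU])
          have "{c \<in> U (r * m). c @ b \<in> swap m ` con (Suc r) X} = {c \<in> U (r * m). b @ c \<in> con (Suc r) X}"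
            by (rule Collect_cong, rule conj_cong[OF refl], rule append_in_swap[OF definable_subset[OF W] _ bU])
          also have "\<dots> = con r (X \<inter> S b)" by (rule con_fiber[OF bU definable_subset[OF Xd]])
          finally have "{c \<in> U (r * m). c @ b \<in> swap m ` con (Suc r) X} = con r (X \<inter> S b)" .
          moreover have "keis (Bp r) (con r (X \<inter> S b)) \<le> \<gamma> / 2"
          proof (cases "X \<inter> S b = {}")
            case True
            then show ?thesis using \<open>\<gamma> > 0\<close> by (simp add: con_def)
          next
            case False
            then have "fst (H (X \<inter> S b)) \<noteq> fst (H X)" using b bU by (auto simp: G_def)
            moreover have "fst (H (X \<inter> S b)) \<le> fst (H X)"
              by (rule dim_mono[OF Fam_definable[OF F] Xd]) simp
            ultimately show ?thesis using small[OF F] by simp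
          qed
          ultimately show "keis (Bp r) {c \<in> U (r * m). c @ b \<in> swap m ` con (Suc r) X} \<le> \<gamma> / 2" by simp
        qed (use \<open>\<gamma> > 0\<close> in simp)
        also have "keis (prodset (Bp r) B) (swap m ` con (Suc r) X) = keis (Bp (Suc r)) (con (Suc r) X)"
          unfolding Bp(2) by (rule keis_swap_prodset[OF B(1) Bpd W])
        finally have Gbig: "keis B G > \<gamma> / 2" using gt by simp
        then have "G \<noteq> {}" using \<open>\<gamma> > 0\<close> by auto
        then have Xne: "X \<noteq> {}" by (auto simp: G_def)
        \<comment> \<open>The incidence relation is measured in two orders: here with fibres in X
          over the points of B, below with fibres in B over the points of X.\<close>
        have "\<epsilon> * keis B G \<le> keis (prodset X B) ?\<Phi>"
        proof (rule keis_fubini_ge[OF Xd Xne B \<Phi> G])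
          fix b assume "b \<in> B \<inter> G"
          then show "\<epsilon> \<le> keis X {a \<in> U n. a @ b \<in> ?\<Phi>}"
            using \<epsilon>(2)[OF X, of b] j fib[of b] by (auto simp: G_def)
        qed
        moreover have "keis (prodset X B) ?\<Phi> = keis (prodset B X) (swap n ` ?\<Phi>)"
          by (rule keis_swap_prodset[OF Xd B(1) \<Phi>, symmetric])
        moreover have "\<epsilon> * (\<gamma> / 2) < \<epsilon> * keis B G" using Gbig \<epsilon>(1) by simp
        ultimately have lower: "\<epsilon> * (\<gamma> / 2) < keis (prodset B X) (swap n ` ?\<Phi>)" by linarith
        show "?Q (\<epsilon> / 4 * \<gamma>)"
        proof (rule ccontr)
          assume no: "\<not> ?Q (\<epsilon> / 4 * \<gamma>)"
          \<comment> \<open>The exceptional set is empty and contributes 0; the failure of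
            \<open>?Q\<close> bounds every fibre over X.\<close>
          have "keis (prodset B X) (swap n ` ?\<Phi>) \<le> keis X {} + \<epsilon> / 4 * \<gamma>"
          proof (rule keis_fubini_le[OF B Xd Xne definable_swap[OF \<Phi>] definable_empty])
            fix a assume "a \<in> X - {}"
            then have a: "a \<in> U n" using definable_subset[OF Xd] by blast
            have "{b \<in> U m. b @ a \<in> swap n ` ?\<Phi>} = {b \<in> U m. holds N \<phi> (a @ b)}"
              using append_in_swap[OF definable_subset[OF \<Phi>] _ a] nlists_appendI[OF a] by (auto simp: inst_def)
            then show "keis B {b \<in> U m. b @ a \<in> swap n ` ?\<Phi>} \<le> \<epsilon> / 4 * \<gamma>" using no a by force
          qed (use \<epsilon>(1) \<open>\<gamma> > 0\<close> in simp)
          then have "\<epsilon> * \<gamma> / 2 < \<epsilon> * \<gamma> / 4" using lower by simp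
          then show False using \<epsilon>(1) \<open>\<gamma> > 0\<close> by (simp add: mult_pos_pos)
        qed
      qed
    next
      show "U n \<in> Fam 0" by (rule U_Fam)
      show "\<epsilon> / 4 > 0" using \<epsilon>(1) by simp
    qed (use k big \<open>\<alpha> > 0\<close> in force)+
  qed
qed

text \<open>Indices carry the counting measure, while points of X are still measured by mu_X.
  Ordered index tuples with repetitions are counted instead of k-subsets, because they split by
  their first entry exactly as in \<open>con_fiber\<close>.\<close>

lemma helly_counting:
  assumes k: "fst (H (U n)) < k" and "\<alpha> > 0"
  obtains \<beta> where "\<beta> > 0"
    "\<And>l b. l > 0 \<Longrightarrow> (\<And>i. i < l \<Longrightarrow> b i \<in> U m) \<Longrightarrow>
      real (card {is \<in> nlists k {..<l}. U n \<inter> (\<Inter>i\<in>set is. S (b i)) \<noteq> {}}) > \<alpha> * real l ^ k \<Longrightarrow>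
      \<exists>a\<in>U n. real (card {i. i < l \<and> a \<in> S (b i)}) > \<beta> * real l"
proof -
  obtain \<epsilon> where \<epsilon>: "\<epsilon> > 0"
    "\<And>X j b. X \<in> Fam j \<Longrightarrow> j < k \<Longrightarrow> b \<in> U m \<Longrightarrow> X \<inter> S b \<noteq> {} \<Longrightarrow> fst (H (X \<inter> S b)) = fst (H X) \<Longrightarrow>
      \<epsilon> \<le> keis X (S b)"
    using ratio_bound[of k] by blast
  show thesis
  proof
    show "\<epsilon> / 4 * \<alpha> / 2 ^ k > 0" using \<epsilon>(1) \<open>\<alpha> > 0\<close> by simp
    fix l :: nat and b assume "l > 0" and b: "\<And>i. i < l \<Longrightarrow> b i \<in> U m"
    define T where "T r X = {is \<in> nlists r {..<l}. X \<inter> (\<Inter>i\<in>set is. S (b i)) \<noteq> {}}" for r X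
    assume big: "real (card {is \<in> nlists k {..<l}. U n \<inter> (\<Inter>i\<in>set is. S (b i)) \<noteq> {}}) > \<alpha> * real l ^ k"
    have finl: "finite (nlists r {..<l})" for r
      using finite_lists_length_eq[of "{..<l}" r] by (simp add: nlists_def conj_commute)
    have cardl: "card (nlists r {..<l}) = l ^ r" for r
      using card_lists_length_eq[of "{..<l}" r] by (simp add: nlists_def conj_commute)
    have T_le: "card (T r X) \<le> l ^ r" for r X
      using card_mono[OF finl, of "T r X" r] by (auto simp: cardl T_def)
    have T_Suc: "card (T (Suc r) X) = (\<Sum>i<l. card (T r (X \<inter> S (b i))))" for r X
    proof -
      have "T (Suc r) X = (\<Union>i\<in>{..<l}. (#) i ` T r (X \<inter> S (b i)))"
      proof (rule set_eqI)
        fix w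
        show "w \<in> T (Suc r) X \<longleftrightarrow> w \<in> (\<Union>i\<in>{..<l}. (#) i ` T r (X \<inter> S (b i)))"
          by (cases w) (auto simp: T_def in_nlists Int_assoc simp del: Int_iff)
      qed
      also have "card \<dots> = (\<Sum>i<l. card ((#) i ` T r (X \<inter> S (b i))))"
        by (rule card_UN_disjoint) (use finl in \<open>auto simp: T_def\<close>)
      also have "\<dots> = (\<Sum>i<l. card (T r (X \<inter> S (b i))))"
        by (intro sum.cong refl card_image) simp
      finally show ?thesis .
    qed
    let ?Q = "\<lambda>t. \<exists>a\<in>U n. real (card {i. i < l \<and> a \<in> S (b i)}) > t * real l"
    show "?Q (\<epsilon> / 4 * \<alpha> / 2 ^ k)"
    proof (rule descent[where q = "\<lambda>r X. real (card (T r X)) / real l ^ r" and dim = "\<lambda>X. fst (H X)" and Fam = Fam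
          and j = 0 and X = "U n" and k = k and Q = ?Q])
      fix r j X and \<gamma> :: real
      assume X: "X \<in> Fam j" and j: "j + Suc r \<le> k" and "\<gamma> > 0" and gt: "\<gamma> < real (card (T (Suc r) X)) / real l ^ Suc r"
      have Xd: "definable L N n X" by (rule Fam_definable[OF X])
      have lp: "real l > 0" "real l ^ r > 0" using \<open>l > 0\<close> by simp_all
      show "?Q (\<epsilon> / 4 * \<gamma>) \<or> (\<exists>Y\<in>Fam (Suc j). fst (H Y) < fst (H X) \<and> \<gamma> / 2 < real (card (T r Y)) / real l ^ r)"
      proof (rule disjCI)
        assume "\<not> (\<exists>Y\<in>Fam (Suc j). fst (H Y) < fst (H X) \<and> \<gamma> / 2 < real (card (T r Y)) / real l ^ r)"
        then have small: "real (card (T r Y)) \<le> \<gamma> / 2 * real l ^ r" if "Y \<in> Fam (Suc j)" "fst (H Y) < fst (H X)" for Y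
          using that lp by (force simp: divide_simps not_less)
        define G where "G = {i. i < l \<and> X \<inter> S (b i) \<noteq> {} \<and> fst (H (X \<inter> S (b i))) = fst (H X)}"
        \<comment> \<open>An index in \<open>G\<close> admits at most all \<open>l ^ r\<close>
          continuations. For the others \<open>X \<inter> S (b i)\<close> is empty or of smaller
          dimension, so at most a fraction \<open>\<gamma> / 2\<close> of the continuations is
          consistent.\<close>
        have "real (card (T r (X \<inter> S (b i)))) \<le> (if i \<in> G then real l ^ r else 0) + \<gamma> / 2 * real l ^ r" if "i < l" for i
        proof (cases "i \<in> G")
          case True
          have "real (card (T r (X \<inter> S (b i)))) \<le> real l ^ r"
            using T_le[of r "X \<inter> S (b i)"] by (metis of_nat_le_iff of_nat_power)
          then show ?thesis using True \<open>\<gamma> > 0\<close> lp by (simp add: add_increasing2)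
        next
          case False
          have F: "X \<inter> S (b i) \<in> Fam (Suc j)" by (rule Fam_Int[OF X b[OF that]])
          have "real (card (T r (X \<inter> S (b i)))) \<le> \<gamma> / 2 * real l ^ r"
          proof (cases "X \<inter> S (b i) = {}")
            case True
            then show ?thesis using \<open>\<gamma> > 0\<close> lp by (simp add: T_def)
          next
            case False
            then have "fst (H (X \<inter> S (b i))) \<noteq> fst (H X)" using \<open>i \<notin> G\<close> that by (auto simp: G_def)
            moreover have "fst (H (X \<inter> S (b i))) \<le> fst (H X)"
              by (rule dim_mono[OF Fam_definable[OF F] Xd]) simp
            ultimately show ?thesis using small[OF F] by simp
          qed
          then show ?thesis using False by simp
        qed
        then have "real (card (T (Suc r) X)) \<le> (\<Sum>i<l. (if i \<in> G then real l ^ r else 0) + \<gamma> / 2 * real l ^ r)"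
          unfolding T_Suc of_nat_sum by (intro sum_mono) simp
        also have "\<dots> = real (card G) * real l ^ r + real l * (\<gamma> / 2 * real l ^ r)"
        proof -
          have "{..<l} \<inter> G = G" by (auto simp: G_def)
          then show ?thesis by (simp add: sum.distrib sum.If_cases)
        qed
        also have "\<dots> = (real (card G) + real l * \<gamma> / 2) * real l ^ r" by (simp add: algebra_simps)
        finally have upper: "real (card (T (Suc r) X)) \<le> (real (card G) + real l * \<gamma> / 2) * real l ^ r" .
        have "\<gamma> * real l * real l ^ r < real (card (T (Suc r) X))"
          using gt lp by (simp add: divide_simps mult.assoc)
        with upper have "\<gamma> * real l * real l ^ r < (real (card G) + real l * \<gamma> / 2) * real l ^ r" by linarith
        then have "\<gamma> * real l < real (card G) + real l * \<gamma> / 2" using lp(2) by (simp only: mult_less_cancel_right_pos)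
        then have Gbig: "real (card G) > \<gamma> / 2 * real l" by (simp add: algebra_simps)
        have "\<gamma> / 2 * real l > 0" using \<open>\<gamma> > 0\<close> lp by simp
        then have "G \<noteq> {}" using Gbig by auto
        then have Xne: "X \<noteq> {}" by (auto simp: G_def)
        have finG: "finite G" "G \<subseteq> {..<l}" by (auto simp: G_def)
        have "\<epsilon> * real (card G) \<le> (\<Sum>i\<in>G. keis X (S (b i)))"
          using sum_bounded_below[of G \<epsilon> "\<lambda>i. keis X (S (b i))"] \<epsilon>(2)[OF X] j b
          by (simp add: G_def mult.commute)
        also have "\<dots> \<le> (\<Sum>i<l. keis X (S (b i)))"
          by (rule sum_mono2) (use finG b definable_S keis_nonneg[OF Xd] in auto)
        finally have lower: "\<epsilon> * real (card G) \<le> (\<Sum>i<l. keis X (S (b i)))" .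
        show "?Q (\<epsilon> / 4 * \<gamma>)"
        proof (rule ccontr)
          assume no: "\<not> ?Q (\<epsilon> / 4 * \<gamma>)"
          \<comment> \<open>\<open>keis_averaging\<close> wants a natural number as covering bound;
            a cardinality below the real bound is also below its floor.\<close>
          define t where "t = nat \<lfloor>\<epsilon> / 4 * \<gamma> * real l\<rfloor>"
          have pos: "\<epsilon> / 4 * \<gamma> * real l > 0" using \<epsilon>(1) \<open>\<gamma> > 0\<close> lp by simp
          have "card {i. i < l \<and> x \<in> S (b i)} \<le> t" if "x \<in> X" for x
          proof -
            have "x \<in> U n" using that definable_subset[OF Xd] by blast
            then have "real (card {i. i < l \<and> x \<in> S (b i)}) \<le> \<epsilon> / 4 * \<gamma> * real l" using no by force
            then show ?thesis unfolding t_def by (simp add: le_nat_floor)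
          qed
          then have "(\<Sum>i<l. keis X (S (b i) \<inter> X)) \<le> real t * keis X X"
            by (intro keis_averaging[OF Xd _ Xd] definable_S b)
          moreover have "keis X (S (b i) \<inter> X) = keis X (S (b i))" for i by (simp add: keis_eq)
          moreover have "keis X X = 1" by (rule keis_superset[OF Xd Xne]) simp
          moreover have "real t \<le> \<epsilon> / 4 * \<gamma> * real l" unfolding t_def by (rule of_nat_floor[OF less_imp_le[OF pos]])
          ultimately have "\<epsilon> * real (card G) \<le> \<epsilon> / 4 * \<gamma> * real l" using lower by simp
          moreover have "\<epsilon> * (\<gamma> / 2 * real l) < \<epsilon> * real (card G)" using Gbig \<epsilon>(1) by simp
          ultimately have "\<epsilon> * (\<gamma> / 2 * real l) < \<epsilon> / 4 * \<gamma> * real l" by linarith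
          then show False using pos by simp
        qed
      qed
    next
      show "U n \<in> Fam 0" by (rule U_Fam)
      show "\<epsilon> / 4 > 0" using \<epsilon>(1) by simp
      show "\<alpha> < real (card (T k (U n))) / real l ^ k"
        using big \<open>l > 0\<close> by (simp add: T_def divide_simps)
      show "?Q s" if "?Q t" "s \<le> t" for s t
      proof -
        have "s * real l \<le> t * real l" using that(2) by (simp add: mult_right_mono)
        then show ?thesis using that(1) by (meson le_less_trans)
      qed
    qed (use k \<open>\<alpha> > 0\<close> in auto)
  qed
qed

text \<open>Passes from k-subsets to index tuples: listing a k-subset in increasing order gives an
  index tuple, so there are at least as many consistent tuples as consistent k-subsets.\<close>

lemma FHP_if_dim:
  assumes k: "fst (H (U n)) < k"
  shows "FHP N n m k \<phi>"
  unfolding FHP_def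
proof (intro allI impI)
  fix \<alpha> :: real assume "\<alpha> > 0"
  have "k > 0" using k by simp
  \<comment> \<open>The factor \<open>k ^ k\<close> comes from the bound \<open>(l / k) ^ k\<close>
    for the binomial coefficient, and the 2 makes the inequality strict, as
    \<open>helly_counting\<close> requires.\<close>
  define \<gamma> where "\<gamma> = \<alpha> / (2 * real k ^ k)"
  have "\<gamma> > 0" using \<open>\<alpha> > 0\<close> \<open>k > 0\<close> by (simp add: \<gamma>_def)
  from helly_counting[OF k this] obtain \<beta> where \<beta>: "\<beta> > 0"
    "\<And>l b. l > 0 \<Longrightarrow> (\<And>i. i < l \<Longrightarrow> b i \<in> U m) \<Longrightarrow>
      real (card {is \<in> nlists k {..<l}. U n \<inter> (\<Inter>i\<in>set is. S (b i)) \<noteq> {}}) > \<gamma> * real l ^ k \<Longrightarrow>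
      \<exists>a\<in>U n. real (card {i. i < l \<and> a \<in> S (b i)}) > \<beta> * real l"
    by blast
  show "\<exists>\<beta>>0. \<forall>l\<ge>k. \<forall>S. (\<forall>i<l. S i \<in> {inst N n \<phi> b |b. b \<in> U m}) \<and>
      \<alpha> * real (l choose k) \<le> real (card {J. J \<subseteq> {..<l} \<and> card J = k \<and> (\<Inter>i\<in>J. S i) \<noteq> {}}) \<longrightarrow>
      (\<exists>J\<subseteq>{..<l}. \<beta> * real l \<le> real (card J) \<and> (\<Inter>i\<in>J. S i) \<noteq> {})"
  proof (intro exI[of _ \<beta>] conjI allI impI \<beta>(1))
    fix l F
    assume "k \<le> l" and F: "(\<forall>i<l. F i \<in> {inst N n \<phi> b |b. b \<in> U m}) \<and>
      \<alpha> * real (l choose k) \<le> real (card {J. J \<subseteq> {..<l} \<and> card J = k \<and> (\<Inter>i\<in>J. F i) \<noteq> {}})"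
    have "l > 0" using \<open>k \<le> l\<close> \<open>k > 0\<close> by simp
    from F have "\<forall>i. \<exists>b. i < l \<longrightarrow> b \<in> U m \<and> F i = S b" by blast
    from choice[OF this] obtain b where b: "\<And>i. i < l \<Longrightarrow> b i \<in> U m" "\<And>i. i < l \<Longrightarrow> F i = S (b i)" by auto
    let ?J = "{J. J \<subseteq> {..<l} \<and> card J = k \<and> (\<Inter>i\<in>J. F i) \<noteq> {}}"
    let ?T = "{is \<in> nlists k {..<l}. U n \<inter> (\<Inter>i\<in>set is. S (b i)) \<noteq> {}}"
    have "card ?J \<le> card ?T"
    proof (rule card_inj_on_le)
      show "inj_on sorted_list_of_set ?J"
        by (rule inj_onI) (metis (mono_tags, lifting) finite_lessThan finite_subset mem_Collect_eq
          set_sorted_list_of_set)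
      show "finite ?T"
      proof (rule finite_subset)
        show "finite (nlists k {..<l})"
          using finite_lists_length_eq[of "{..<l}" k] by (simp add: nlists_def conj_commute)
      qed blast
      show "sorted_list_of_set ` ?J \<subseteq> ?T"
      proof safe
        fix J x assume J: "J \<subseteq> {..<l}" "k = card J" "x \<in> (\<Inter>i\<in>J. F i)"
        then have fin: "finite J" using finite_subset by blast
        then show "sorted_list_of_set J \<in> nlists (card J) {..<l}" using J by (simp add: in_nlists)
        \<comment> \<open>Over an empty index set the intersection would be everything; since
          \<open>k > 0\<close>, a common point lies in one of the instances and is an n-tuple of
          N.\<close>
        have "J \<noteq> {}" using J(2) \<open>k > 0\<close> by auto
        then have "x \<in> U n" using J b(2) by (force simp: inst_def)
        moreover have "x \<in> (\<Inter>i\<in>set (sorted_list_of_set J). S (b i))" using J b(2) fin by force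
        ultimately show "U n \<inter> (\<Inter>i\<in>set (sorted_list_of_set J). S (b i)) = {} \<Longrightarrow> False" by blast
      qed
    qed
    have "\<gamma> * real l ^ k < \<alpha> * (real l / real k) ^ k"
      using \<open>\<alpha> > 0\<close> \<open>k > 0\<close> \<open>l > 0\<close> by (simp add: \<gamma>_def power_divide field_simps)
    also have "\<dots> \<le> \<alpha> * real (l choose k)"
      using binomial_ge_n_over_k_pow_k[OF \<open>k \<le> l\<close>, where ?'a = real] \<open>\<alpha> > 0\<close> by simp
    also have "\<dots> \<le> real (card ?T)" using F \<open>card ?J \<le> card ?T\<close> by linarith
    finally have "\<exists>a\<in>U n. real (card {i. i < l \<and> a \<in> S (b i)}) > \<beta> * real l"
      by (intro \<beta>(2)[OF \<open>l > 0\<close>] b(1))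
    then obtain a where a: "a \<in> U n" "real (card {i. i < l \<and> a \<in> S (b i)}) > \<beta> * real l" ..
    \<comment> \<open>All indices whose set contains \<open>a\<close>; then \<open>a\<close> itself
      is a common point.\<close>
    show "\<exists>J\<subseteq>{..<l}. \<beta> * real l \<le> real (card J) \<and> (\<Inter>i\<in>J. F i) \<noteq> {}"
      using a b(2) by (intro exI[of _ "{i. i < l \<and> a \<in> S (b i)}"]) auto
  qed
qed

end

locale ms_monster_formula = ms_monster L N H \<kappa> + ms_formula L N H \<phi> n m
  for L :: "('f, 'r) lang" and N :: "('f, 'r, 'a) struct" and H \<kappa> \<phi> n m
begin

text \<open>The Morley power is at most the measure of the cartesian power, so its excess over
  \<open>\<alpha>\<close> is inherited by the latter and \<open>helly_measure\<close> applies with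
  \<open>Bpow B\<close>.\<close>

lemma FHP_rel_if_dim:
  assumes k: "fst (H (U n)) < Suc k"
  shows "FHP_rel \<kappa> L N n m (Suc k) \<phi> (ms_measures L N H m)"
  unfolding FHP_rel_def
proof (intro allI impI)
  fix \<alpha> :: real assume "\<alpha> > 0"
  from helly_measure[OF k this] obtain \<beta> where \<beta>: "\<beta> > 0"
    "\<And>B Bp. definable L N m B \<Longrightarrow> B \<noteq> {} \<Longrightarrow> Bp 0 = {[]} \<Longrightarrow> (\<And>r. Bp (Suc r) = prodset B (Bp r)) \<Longrightarrow>
      keis (Bp (Suc k)) (con (Suc k) (U n)) > \<alpha> \<Longrightarrow> \<exists>a\<in>U n. keis B {b \<in> U m. holds N \<phi> (a @ b)} > \<beta>"
    by blast
  show "\<exists>\<beta>>0. \<forall>\<mu>\<in>ms_measures L N H m.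
      \<alpha> < morley_power \<kappa> L N m \<mu> (Suc k) (consistent_tuples N n m (Suc k) \<phi>) \<longrightarrow>
      (\<exists>a\<in>U n. \<beta> < \<mu> {b \<in> U m. holds N \<phi> (a @ b)})"
  proof (intro exI[of _ \<beta>] conjI ballI impI \<beta>(1))
    fix \<mu> assume "\<mu> \<in> ms_measures L N H m"
      and gt: "\<alpha> < morley_power \<kappa> L N m \<mu> (Suc k) (consistent_tuples N n m (Suc k) \<phi>)"
    then obtain B where B: "definable L N m B" "B \<noteq> {}" and \<mu>: "\<mu> = keis B"
      unfolding ms_measures_def by blast
    have "\<alpha> < keis (Bpow B (Suc k)) (con (Suc k) (U n))"
      using gt morley_power_le[OF B definable_con[OF definable_U]]
      unfolding \<mu> consistent_tuples_eq by (rule less_le_trans)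
    then show "\<exists>a\<in>U n. \<beta> < \<mu> {b \<in> U m. holds N \<phi> (a @ b)}"
      unfolding \<mu> by (intro \<beta>(2)[of B "Bpow B"] B) auto
  qed
qed

end

theorem mainTheorem8:
  fixes L :: "('f, 'r) lang"
    and M N :: "('f, 'r, 'a) struct"
    and h :: "'a list set \<Rightarrow> nat \<times> real"
    and \<kappa> :: "'k rel"
    and \<phi> :: "('f, 'r) fm"
    and n m d :: nat
  assumes "is_structure L M"
    and "ms_measuring L M h"
    and "monster \<kappa> L M N"
    and "\<phi> \<in> forms L (n + m)"
    and "n \<le> d"
    (* dim(M^x) \<le> d; this follows from |x| \<le> d if dim M \<le> 1, and cannot be dropped if dim M > 1 *)
    and "fst (h (nlists n (univ M))) \<le> d"
  shows "FHP_rel \<kappa> L N n m (d + 1) \<phi> (ms_measures L N (ext_measuring L M h N) m) \<and>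
         FHP N n m (d + 1) \<phi>"
proof -
  interpret E: ms_extension L M N h
    by unfold_locales (use assms(2,3) in \<open>auto simp: monster_def\<close>)
  interpret N: ms_struct L N "ext_measuring L M h N" by (rule E.ms_struct_extension)
  interpret N: ms_monster_formula L N "ext_measuring L M h N" \<kappa> \<phi> n m
    by unfold_locales (use assms(3,4) in \<open>auto simp: monster_def\<close>)
  \<comment> \<open>The full powers of M and N have the same value, so the bound on M shows that
    \<open>d + 1\<close> successive drops of dimension are impossible in N.\<close>
  have "fst (ext_measuring L M h N (nlists n (univ N))) < Suc d"
    using assms(6) E.ext_measuring_univ by simp
  then show ?thesis using N.FHP_rel_if_dim N.FHP_if_dim by simp
qed

end
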